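(* Let $f:\mathbb{R}^n\to(-\infty,\infty]$ be lsc, $\bar x\in\operatorname{dom}f$, $\bar x^*\in\partial f(\bar x)$ and $s\in\mathbb{R}$. The following are equivalent: (i) $f$ is variationally $s$-convex at $\bar x$ for $\bar x^*$. (ii) $f$ is prox-regular at $\bar x$ for $\bar x^*$ and there are a neighborhood $U\times V$ of $(\bar x,\bar x^* )$ and $\rho>f(\bar x)$ such that $\langle z^*,z\rangle\ge s\|z\|^2$ whenever $z^*\in\widehat D^*_f(\partial f)(x,x^* )(z)$ and $(x,x^* )\in\operatorname{gph}_\rho\partial f\cap(U\times V)$. (iii) $f$ is prox-regular at $\bar x$ for $\bar x^*$ and there are a neighborhood $U\times V$ of $(\bar x,\bar x^* )$ and $\rho>f(\bar x)$ such that $\langle z^*,z\rangle\ge s\|z\|^2$ whenever $z^*\in D^*_f(\partial f)(x,x^* )(z)$ and $(x,x^* )\in\operatorname{gph}_\rho\partial f\cap(U\times V)$. (iv) $f$ is prox-regular at $\bar x$ for $\bar x^*$ and there are a neighborhood $U\times V$ of $(\bar x,\bar x^* )$ and $\rho>f(\bar x)$ such that $\langle z^*,z\rangle\ge s\|z\|^2$ whenever $(z,z^* )\in T^f_{\operatorname{gph}\partial f}(x,x^* )$, $(x,x^* )\in\mathcal O^f_{\partial f}\cap(U\times V)$ and $f(x)<\rho$. (v) $f$ is prox-regular at $\bar x$ for $\bar x^*$ and there are a neighborhood $U\times V$ of $(\bar x,\bar x^* )$ and $\rho>f(\bar x)$ such that $\langle z^*,z\rangle\ge s\|z\|^2$ whenever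 $(z,z^* )\in L\in\mathcal S_f(\partial f)(x,x^* )$ and $(x,x^* )\in\operatorname{gph}_\rho\partial f\cap(U\times V)$. (vi) $f$ is prox-regular at $\bar x$ for $\bar x^*$ and there are a neighborhood $U\times V$ of $(\bar x,\bar x^* )$ and $\rho>f(\bar x)$ such that for every $(x,x^* )\in\operatorname{gph}_\rho\partial f\cap(U\times V)$ and every $(P,W)\in\mathcal M^f_{P,W}\partial f(x,x^* )$ the matrix $PWP-sP$ is positive semidefinite.
   Context: Open balls $\mathbb{B}_\epsilon(x)$. Regular subdifferential $\widehat\partial f(x)=\{x^*\mid\liminf_{y\to x}\frac{f(y)-f(x)-\langle x^*,y-x\rangle}{\|y-x\|}\ge0\}$; limiting subdifferential $\partial f(x)$: all $x^*$ with $x_k\to x$, $f(x_k)\to f(x)$, $x_k^*\to x^*$, $x_k^*\in\widehat\partial f(x_k)$. $\operatorname{gph}_\rho\partial f=\{(x,x^* )\in\operatorname{gph}\partial f\mid f(x)<\rho\}$. Prox-regularity of lsc $f$ at $\bar x$ for $\bar x^*\in\partial f(\bar x)$: there are $\epsilon>0$, $r\ge0$ with $f(x')\ge f(x)+\langle x^*,x'-x\rangle-\frac r2\|x'-x\|^2$ whenever $x'\in\mathbb{B}_\epsilon(\bar x)$ and $(x,x^* )\in\operatorname{gph}_{f(\bar x)+\epsilon}\partial f\cap(\mathbb{B}_\epsilon(\bar x)\times\mathbb{B}_\epsilon(\bar x^* ))$. Variational $s$-convexity of lsc $f$ at $\bar x$ for $\bar x^*$: there exist an open convex neighborhood $U\times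 V$ of $(\bar x,\bar x^* )$, an lsc function $\widehat f$ and $\rho>f(\bar x)$ such that $\widehat f-\frac s2\|\cdot\|^2$ is convex on $U$, $\widehat f\le f$ on $U$, $\operatorname{gph}_\rho\partial f\cap(U\times V)=\operatorname{gph}\partial\widehat f\cap(U\times V)$ and $f=\widehat f$ at the common elements. $f$-attentive derivatives: write $(x_k,x_k^* )\xrightarrow{f}(x,x^* )$ if $(x_k,x_k^* )\in\operatorname{gph}\partial f$, $(x_k,x_k^* )\to(x,x^* )$, $f(x_k)\to f(x)$. For $(x,x^* )\in\operatorname{gph}\partial f$: $T^f_{\operatorname{gph}\partial f}(x,x^* )=\{(u,u^* )\mid\exists t_k\downarrow0,(x_k,x_k^* )\xrightarrow{f}(x,x^* ): ((x_k,x_k^* )-(x,x^* ))/t_k\to(u,u^* )\}$; $\widehat N^f_{\operatorname{gph}\partial f}(x,x^* )$ its polar cone; $N^f_{\operatorname{gph}\partial f}(x,x^* )$ the set of limits of $v_k\in\widehat N^f_{\operatorname{gph}\partial f}(x_k,x_k^* )$ with $(x_k,x_k^* )\xrightarrow{f}(x,x^* )$; $z^*\in\widehat D^*_f(\partial f)(x,x^* )(z)$ iff $(z^*,-z)\in\widehat N^f_{\operatorname{gph}\partial f}(x,x^* )$, and $z^*\in D^*_f(\partial f)(x,x^* )(z)$ iff $(z^*,-z)\in N^f_{\operatorname{gph}\partial f}(x,x^* )$. $\mathcal Z_{nn}$: the $n$-dimensional subspaces of $\mathbb{R}^n\times\mathbb{R}^n$ with metric $d(L_1,L_2)=\|P_{L_1}-P_{L_2}\|$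 ($P_L$ orthogonal projection). $\mathcal O^f_{\partial f}$: set of $(x,x^* )\in\operatorname{gph}\partial f$ with $T^f_{\operatorname{gph}\partial f}(x,x^* )\in\mathcal Z_{nn}$. $\mathcal S_f(\partial f)(x,x^* )$: all $L\in\mathcal Z_{nn}$ such that there are $(x_k,x_k^* )\in\mathcal O^f_{\partial f}$ with $(x_k,x_k^* )\xrightarrow{f}(x,x^* )$ and $d(L,T^f_{\operatorname{gph}\partial f}(x_k,x_k^* ))\to0$. $\mathcal M^f_{P,W}\partial f(x,x^* )$: the set of pairs $(P,W)$ of symmetric $n\times n$ matrices with $P^2=P$, $W(I-P)=I-P$ and $\{(Pp,Wp)\mid p\in\mathbb{R}^n\}\in\mathcal S_f(\partial f)(x,x^* )$. *)

theory Defs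
  imports "HOL-Analysis.Analysis" "HOL-Library.Extended_Real"
begin

definition lsc :: "('a::topological_space \<Rightarrow> ereal) \<Rightarrow> bool" where
  "lsc f \<longleftrightarrow> (\<forall>x. f x \<le> Liminf (at x) f)"

definition regsub :: "('a::real_inner \<Rightarrow> ereal) \<Rightarrow> 'a \<Rightarrow> 'a set" where
  "regsub f x = {xs. \<bar>f x\<bar> \<noteq> \<infinity> \<and>
     Liminf (at x) (\<lambda>y. (f y - f x - ereal (xs \<bullet> (y - x))) / ereal (norm (y - x))) \<ge> 0}"

definition lsub :: "('a::real_inner \<Rightarrow> ereal) \<Rightarrow> 'a \<Rightarrow> 'a set" where
  "lsub f x = {xs. \<exists>xk xsk. xk \<longlonglongrightarrow> x \<and> (\<lambda>k. f (xk k)) \<longlonglongrightarrow> f x \<and> xsk \<longlonglongrightarrow> xs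
                     \<and> (\<forall>k. xsk k \<in> regsub f (xk k))}"

definition gph_sub :: "('a::real_inner \<Rightarrow> ereal) \<Rightarrow> ('a \<times> 'a) set" where
  "gph_sub f = {(x, xs). xs \<in> lsub f x}"

definition gph_sub_rho :: "('a::real_inner \<Rightarrow> ereal) \<Rightarrow> real \<Rightarrow> ('a \<times> 'a) set" where
  "gph_sub_rho f \<rho> = {(x, xs). xs \<in> lsub f x \<and> f x < ereal \<rho>}"

definition prox_regular :: "('a::real_inner \<Rightarrow> ereal) \<Rightarrow> 'a \<Rightarrow> 'a \<Rightarrow> bool" where
  "prox_regular f xb xbs \<longleftrightarrow> (\<exists>\<epsilon>>0. \<exists>r\<ge>0. \<forall>x' x xs.
      x' \<in> ball xb \<epsilon> \<and> (x, xs) \<in> gph_sub f \<and> f x < f xb + ereal \<epsilon>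
      \<and> x \<in> ball xb \<epsilon> \<and> xs \<in> ball xbs \<epsilon> \<longrightarrow>
      f x' \<ge> f x + ereal (xs \<bullet> (x' - x) - r / 2 * (norm (x' - x))\<^sup>2))"

definition ereal_convex_on :: "'a::real_vector set \<Rightarrow> ('a \<Rightarrow> ereal) \<Rightarrow> bool" where
  "ereal_convex_on U g \<longleftrightarrow> (\<forall>x\<in>U. \<forall>y\<in>U. \<forall>t::real. 0 < t \<and> t < 1 \<longrightarrow>
      g (t *\<^sub>R x + (1 - t) *\<^sub>R y) \<le> ereal t * g x + ereal (1 - t) * g y)"

definition var_s_convex :: "real \<Rightarrow> ('a::real_inner \<Rightarrow> ereal) \<Rightarrow> 'a \<Rightarrow> 'a \<Rightarrow> bool" where
  "var_s_convex s f xb xbs \<longleftrightarrow> (\<exists>U V fh \<rho>.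
      open U \<and> open V \<and> convex U \<and> convex V \<and> xb \<in> U \<and> xbs \<in> V \<and>
      lsc fh \<and> (\<forall>x. fh x \<noteq> -\<infinity>) \<and> ereal \<rho> > f xb \<and>
      ereal_convex_on U (\<lambda>x. fh x - ereal (s / 2 * (norm x)\<^sup>2)) \<and>
      (\<forall>x\<in>U. fh x \<le> f x) \<and>
      gph_sub_rho f \<rho> \<inter> (U \<times> V) = gph_sub fh \<inter> (U \<times> V) \<and>
      (\<forall>(x, xs) \<in> gph_sub_rho f \<rho> \<inter> (U \<times> V). f x = fh x))"

definition f_att_conv :: "('a::real_inner \<Rightarrow> ereal) \<Rightarrow> (nat \<Rightarrow> 'a \<times> 'a) \<Rightarrow> 'a \<times> 'a \<Rightarrow> bool" where
  "f_att_conv f p q \<longleftrightarrow> (\<forall>k. p k \<in> gph_sub f) \<and> p \<longlonglongrightarrow> q \<and>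
      (\<lambda>k. f (fst (p k))) \<longlonglongrightarrow> f (fst q)"

definition tangent_f :: "('a::real_inner \<Rightarrow> ereal) \<Rightarrow> 'a \<times> 'a \<Rightarrow> ('a \<times> 'a) set" where
  "tangent_f f q = {w. \<exists>t p. (\<forall>k. t k > 0) \<and> t \<longlonglongrightarrow> 0 \<and> f_att_conv f p q \<and>
      (\<lambda>k. (1 / t k) *\<^sub>R (p k - q)) \<longlonglongrightarrow> w}"

definition reg_normal_f :: "('a::real_inner \<Rightarrow> ereal) \<Rightarrow> 'a \<times> 'a \<Rightarrow> ('a \<times> 'a) set" where
  "reg_normal_f f q = {v. \<forall>w \<in> tangent_f f q. v \<bullet> w \<le> 0}"

definition lim_normal_f :: "('a::real_inner \<Rightarrow> ereal) \<Rightarrow> 'a \<times> 'a \<Rightarrow> ('a \<times> 'a) set" where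
  "lim_normal_f f q = {v. \<exists>p vk. f_att_conv f p q \<and> (\<forall>k. vk k \<in> reg_normal_f f (p k)) \<and> vk \<longlonglongrightarrow> v}"

definition reg_coderiv_f :: "('a::real_inner \<Rightarrow> ereal) \<Rightarrow> 'a \<Rightarrow> 'a \<Rightarrow> 'a \<Rightarrow> 'a set" where
  "reg_coderiv_f f x xs z = {zs. (zs, - z) \<in> reg_normal_f f (x, xs)}"

definition lim_coderiv_f :: "('a::real_inner \<Rightarrow> ereal) \<Rightarrow> 'a \<Rightarrow> 'a \<Rightarrow> 'a \<Rightarrow> 'a set" where
  "lim_coderiv_f f x xs z = {zs. (zs, - z) \<in> lim_normal_f f (x, xs)}"

definition Znn :: "((real^'n) \<times> (real^'n)) set set" where
  "Znn = {L. subspace L \<and> dim L = CARD('n)}"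

definition proj :: "((real^'n) \<times> (real^'n)) set \<Rightarrow> (real^'n) \<times> (real^'n) \<Rightarrow> (real^'n) \<times> (real^'n)" where
  "proj L = closest_point L"

definition dZ :: "((real^'n) \<times> (real^'n)) set \<Rightarrow> ((real^'n) \<times> (real^'n)) set \<Rightarrow> real" where
  "dZ L1 L2 = onorm (\<lambda>w. proj L1 w - proj L2 w)"

definition O_f :: "(real^'n \<Rightarrow> ereal) \<Rightarrow> ((real^'n) \<times> (real^'n)) set" where
  "O_f f = {q \<in> gph_sub f. tangent_f f q \<in> Znn}"

definition S_f :: "(real^'n \<Rightarrow> ereal) \<Rightarrow> (real^'n) \<times> (real^'n) \<Rightarrow> ((real^'n) \<times> (real^'n)) set set" where
  "S_f f q = {L \<in> Znn. \<exists>p. (\<forall>k. p k \<in> O_f f) \<and> f_att_conv f p q \<and>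
      (\<lambda>k. dZ L (tangent_f f (p k))) \<longlonglongrightarrow> 0}"

definition M_PW :: "(real^'n \<Rightarrow> ereal) \<Rightarrow> (real^'n) \<times> (real^'n) \<Rightarrow> ((real^'n^'n) \<times> (real^'n^'n)) set" where
  "M_PW f q = {(P, W). transpose P = P \<and> transpose W = W \<and> P ** P = P \<and>
      W ** (mat 1 - P) = mat 1 - P \<and>
      {(P *v p, W *v p) | p. True} \<in> S_f f q}"

definition psd :: "real^'n^'n \<Rightarrow> bool" where
  "psd A \<longleftrightarrow> (\<forall>v. v \<bullet> (A *v v) \<ge> 0)"

end

theory Submission
  imports Defs
begin

text \<open>
  Prox-regularity makes the \<open>f\<close>-attentive localisation of the subdifferential a Lipschitz manifold
  \<open>{(P w, G w)}\<close>, where \<open>P\<close> is the localised proximal mapping and \<open>G w = (w - P w) / \<mu>\<close> is the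
  gradient of the Moreau envelope. With \<open>\<kappa> = 1 + \<mu> s\<close>, \<open>s\<close>-monotonicity of this manifold says that
  \<open>2 \<kappa> P - id\<close> is nonexpansive.

  If it is, the supremum of the quadratics \<open>f (P w) + G w \<bullet> (x - P w) + s / 2 |x - P w|\<^sup>2\<close> is the
  required \<open>s\<close>-convex minorant, and testing a regular normal \<open>(zs, - z)\<close> along the direction
  \<open>\<mu> zs + z - 2 \<kappa> z\<close> gives the coderivative inequality.

  Conversely, at a point where \<open>P\<close> is differentiable with derivative \<open>B\<close>, the tangent cone is the
  subspace \<open>{(B d, (d - B d) / \<mu>)}\<close>, and \<open>B\<close> is symmetric because \<open>G\<close> is a gradient. Each of the
  second-order conditions therefore bounds the derivative of \<open>2 \<kappa> P - id\<close> by 1 there; by Rademacher's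
  theorem this happens almost everywhere, and averaging over small balls turns the bound into
  nonexpansiveness.
\<close>

section \<open>Rademacher's theorem\<close>

text \<open>The reflection \<open>2 \<kappa> P - id\<close> is the convenient quantity because a
  norm bound on it survives the three operations that occur: limits of difference quotients,
  averaging over balls, and passage to the adjoint. The last one is why coderivatives, which see the
  adjoint of a derivative, obey the same inequality as tangents, even at points where
  \<open>P\<close> has no derivative. The parameter \<open>\<mu>\<close> is so small that
  \<open>\<mu> r \<le> 1 / 2\<close>, which makes \<open>P\<close> single-valued and 2-Lipschitz,
  and that \<open>\<kappa> > 0\<close>, which admits negative \<open>s\<close>.

  The obstacle in the converse is that the second-order conditions speak only about points where
  \<open>P\<close> is differentiable, and a given segment may miss all of them. Derivatives cannot
  be integrated along that segment, so its small translates are averaged. When the minorant is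
  built, the delicate point is that the supremum of quadratics must not acquire subgradients outside
  the graph of the subdifferential of \<open>f\<close>; this is excluded by
  \<open>\<kappa> > 0\<close>.\<close>

text \<open>Two nested Vitali coverings are compared in Lebesgue measure and in the Stieltjes
  measure of \<open>F\<close>. Slow intervals cover almost all of \<open>S\<close> inside a slightly
  larger open \<open>T\<close>; fast intervals inside them cover almost all of \<open>S\<close>
  again. So \<open>q\<close> times the measure of \<open>S\<close> is at most the Stieltjes measure
  of the second cover, hence of the first, hence at most \<open>p\<close> times the measure of
  \<open>T\<close>.\<close>

lemma negligible_oscillating_quotient:
  fixes F :: "real \<Rightarrow> real"
  assumes mono: "mono F" and cont: "continuous_on UNIV F" and "0 < p" "p < q"
    and S: "S \<in> lmeasurable"
    and lo: "\<And>x d. x \<in> S \<Longrightarrow> 0 < d \<Longrightarrow> \<exists>u v. u < v \<and> x \<in> {u..v} \<and> v - u < d \<and> F v - F u \<le> p * (v - u)"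
    and hi: "\<And>x d. x \<in> S \<Longrightarrow> 0 < d \<Longrightarrow> \<exists>u v. u < v \<and> x \<in> {u..v} \<and> v - u < d \<and> q * (v - u) \<le> F v - F u"
  shows "negligible S"
proof -
  let ?M = "interval_measure F"
  have Icc: "emeasure ?M {u..v} = ennreal (F v - F u)" if "u \<le> v" for u v
    using that mono cont by (intro emeasure_interval_measure_Icc) (auto simp: mono_def)
  \<comment> \<open>The covering theorem speaks of closed balls, so intervals enter through midpoint
    and half-length.\<close>
  have cb: "cball ((u + v) / 2) ((v - u) / 2) = {u..v}" for u v :: real
    by (auto simp: cball_eq_atLeastAtMost field_simps)
  have le: "ennreal q * emeasure lebesgue S \<le> ennreal p * (emeasure lebesgue S + ennreal e)" if "e > 0" for e
  proof -
    obtain T where T: "open T" "S \<subseteq> T" "T - S \<in> lmeasurable" "emeasure lebesgue (T - S) < ennreal e"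
      using sets_lebesgue_outer_open[OF fmeasurableD[OF S] \<open>e > 0\<close>] by blast
    define K where "K = {(u,v). u < v \<and> {u..v} \<subseteq> T \<and> F v - F u \<le> p * (v - u)}"
    have K: "\<exists>i. i \<in> K \<and> x \<in> cball ((fst i + snd i) / 2) ((snd i - fst i) / 2) \<and> (snd i - fst i) / 2 < d"
      if "x \<in> S" "0 < d" for x d
    proof -
      obtain d' where d': "d' > 0" "ball x d' \<subseteq> T"
        using T \<open>x \<in> S\<close> by (meson open_contains_ball subsetD)
      obtain u v where uv: "u < v" "x \<in> {u..v}" "v - u < min d d'" "F v - F u \<le> p * (v - u)"
        using lo[OF \<open>x \<in> S\<close>, of "min d d'"] d' \<open>0 < d\<close> by auto
      have "{u..v} \<subseteq> ball x d'" using uv by (auto simp: dist_real_def)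
      then have "(u,v) \<in> K" using uv d' by (auto simp: K_def)
      then show ?thesis using uv by (intro exI[of _ "(u,v)"]) (auto simp: cb)
    qed
    have posK: "0 < (snd i - fst i) / 2" if "i \<in> K" for i using that by (auto simp: K_def)
    obtain C where C: "countable C" "C \<subseteq> K"
      "pairwise (\<lambda>i j. disjnt (cball ((fst i + snd i) / 2) ((snd i - fst i) / 2)) (cball ((fst j + snd j) / 2) ((snd j - fst j) / 2))) C"
      "negligible (S - (\<Union>i \<in> C. cball ((fst i + snd i) / 2) ((snd i - fst i) / 2)))"
      by (rule Vitali_covering_theorem_cballs[of K "\<lambda>i. (snd i - fst i) / 2" S "\<lambda>i. (fst i + snd i) / 2", OF posK K])
    note C = C[unfolded cb]
    \<comment> \<open>The second cover has to sit inside the first, and fitting short intervals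
      around a point requires an open set; the endpoints lost here are countable.\<close>
    define E where "E = (\<Union>i\<in>C. {fst i<..<snd i})"
    define S' where "S' = S \<inter> E"
    have "open E" by (auto simp: E_def)
    have null: "negligible (S - S')"
    proof -
      have "S - S' \<subseteq> (S - (\<Union>i \<in> C. {fst i..snd i})) \<union> (fst ` C \<union> snd ` C)"
        by (force simp: S'_def E_def)
      moreover have "negligible (fst ` C \<union> snd ` C)"
        unfolding negligible_iff_null_sets using C(1) by (intro null_sets_completionI countable_imp_null_set_lborel) auto
      ultimately show ?thesis
        using C(4) by (meson negligible_Un negligible_subset)
    qed
    define K' where "K' = {(u,v). u < v \<and> {u..v} \<subseteq> E \<and> q * (v - u) \<le> F v - F u}"
    have K': "\<exists>i. i \<in> K' \<and> x \<in> cball ((fst i + snd i) / 2) ((snd i - fst i) / 2) \<and> (snd i - fst i) / 2 < d"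
      if "x \<in> S'" "0 < d" for x d
    proof -
      obtain d' where d': "d' > 0" "ball x d' \<subseteq> E"
        using \<open>open E\<close> \<open>x \<in> S'\<close> unfolding S'_def by (meson open_contains_ball IntD2)
      obtain u v where uv: "u < v" "x \<in> {u..v}" "v - u < min d d'" "q * (v - u) \<le> F v - F u"
        using hi[of x "min d d'"] \<open>x \<in> S'\<close> d' \<open>0 < d\<close> by (auto simp: S'_def)
      have "{u..v} \<subseteq> ball x d'" using uv by (auto simp: dist_real_def)
      then have "(u,v) \<in> K'" using uv d' by (auto simp: K'_def)
      then show ?thesis using uv by (intro exI[of _ "(u,v)"]) (auto simp: cb)
    qed
    have posK': "0 < (snd i - fst i) / 2" if "i \<in> K'" for i using that by (auto simp: K'_def)
    obtain C' where C': "countable C'" "C' \<subseteq> K'"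
      "pairwise (\<lambda>i j. disjnt (cball ((fst i + snd i) / 2) ((snd i - fst i) / 2)) (cball ((fst j + snd j) / 2) ((snd j - fst j) / 2))) C'"
      "negligible (S' - (\<Union>i \<in> C'. cball ((fst i + snd i) / 2) ((snd i - fst i) / 2)))"
      by (rule Vitali_covering_theorem_cballs[of K' "\<lambda>i. (snd i - fst i) / 2" S' "\<lambda>i. (fst i + snd i) / 2", OF posK' K'])
    note C' = C'[unfolded cb]
    have UNm: "emeasure N (\<Union>i\<in>D. {fst i..snd i}) = (\<integral>\<^sup>+i. emeasure N {fst i..snd i} \<partial>count_space D)"
      if "countable D" "pairwise (\<lambda>i j. disjnt {fst i..snd i} {fst j..snd j}) D" "sets N = sets borel"
      for D and N :: "real measure"
      using that by (intro emeasure_UN_countable) (auto simp: disjoint_family_on_def pairwise_def disjnt_def)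
    have SU: "emeasure lebesgue S \<le> emeasure lborel (\<Union>i\<in>C'. {fst i..snd i})"
    proof -
      let ?A = "\<Union>i\<in>C'. {fst i..snd i}"
      have A: "?A \<in> sets borel" using C'(1) by (intro sets.countable_UN') auto
      have n: "negligible (S - ?A)"
        by (rule negligible_subset[OF negligible_Un[OF null C'(4)]]) auto
      have "emeasure lebesgue S \<le> emeasure lebesgue (?A \<union> (S - ?A))"
        using A n by (intro emeasure_mono sets.Un) (auto simp: negligible_imp_sets)
      also have "\<dots> = emeasure lebesgue ?A"
        using A n by (intro emeasure_Un_null_set) (auto simp: negligible_iff_null_sets)
      finally show ?thesis using A by simp
    qed
    have "ennreal q * emeasure lebesgue S \<le> ennreal q * emeasure lborel (\<Union>i\<in>C'. {fst i..snd i})"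
      using SU by (rule mult_left_mono) auto
    also have "\<dots> = (\<integral>\<^sup>+i. ennreal q * emeasure lborel {fst i..snd i} \<partial>count_space C')"
      using C' by (subst UNm) (auto simp: nn_integral_cmult)
    also have "\<dots> \<le> (\<integral>\<^sup>+i. emeasure ?M {fst i..snd i} \<partial>count_space C')"
    proof (rule nn_integral_mono)
      fix i assume "i \<in> space (count_space C')"
      then have "fst i < snd i" "q * (snd i - fst i) \<le> F (snd i) - F (fst i)"
        using C'(2) by (auto simp: K'_def)
      then show "ennreal q * emeasure lborel {fst i..snd i} \<le> emeasure ?M {fst i..snd i}"
        using \<open>0 < p\<close> \<open>p < q\<close> by (simp add: Icc ennreal_leI flip: ennreal_mult'')
    qed
    also have "\<dots> = emeasure ?M (\<Union>i\<in>C'. {fst i..snd i})"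
      using C' by (subst UNm) auto
    also have "\<dots> \<le> emeasure ?M (\<Union>i\<in>C. {fst i..snd i})"
    proof (rule emeasure_mono)
      show "(\<Union>i\<in>C'. {fst i..snd i}) \<subseteq> (\<Union>i\<in>C. {fst i..snd i})"
      proof -
        have "(\<Union>i\<in>C'. {fst i..snd i}) \<subseteq> E" using C'(2) by (fastforce simp: K'_def)
        also have "E \<subseteq> (\<Union>i\<in>C. {fst i..snd i})" by (force simp: E_def)
        finally show ?thesis .
      qed
      show "(\<Union>i\<in>C. {fst i..snd i}) \<in> sets ?M"
        using C(1) by (simp, intro sets.countable_UN') auto
    qed
    also have "\<dots> = (\<integral>\<^sup>+i. emeasure ?M {fst i..snd i} \<partial>count_space C)"
      using C by (subst UNm) auto
    also have "\<dots> \<le> (\<integral>\<^sup>+i. ennreal p * emeasure lborel {fst i..snd i} \<partial>count_space C)"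
    proof (rule nn_integral_mono)
      fix i assume "i \<in> space (count_space C)"
      then have "fst i < snd i" "F (snd i) - F (fst i) \<le> p * (snd i - fst i)"
        using C(2) by (auto simp: K_def)
      then show "emeasure ?M {fst i..snd i} \<le> ennreal p * emeasure lborel {fst i..snd i}"
        using \<open>0 < p\<close> \<open>p < q\<close> by (simp add: Icc ennreal_leI flip: ennreal_mult'')
    qed
    also have "\<dots> = ennreal p * emeasure lborel (\<Union>i\<in>C. {fst i..snd i})"
      using C by (subst UNm) (auto simp: nn_integral_cmult)
    also have "\<dots> \<le> ennreal p * emeasure lborel T"
      using C(2) T by (intro mult_left_mono emeasure_mono) (fastforce simp: K_def)+
    also have "emeasure lborel T \<le> emeasure lebesgue S + emeasure lebesgue (T - S)"
    proof -
      have "emeasure lborel T = emeasure lebesgue T" using T by simp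
      also have "\<dots> = emeasure lebesgue (S \<union> (T - S))" using T(2) by (metis Diff_partition)
      also have "\<dots> \<le> emeasure lebesgue S + emeasure lebesgue (T - S)"
        using S T by (intro emeasure_subadditive) auto
      finally show ?thesis .
    qed
    also have "emeasure lebesgue (T - S) \<le> ennreal e" using T by simp
    finally show ?thesis by (simp add: mult_left_mono add_left_mono)
  qed
  define m where "m = measure lebesgue S"
  have m: "emeasure lebesgue S = ennreal m" "m \<ge> 0" using S by (auto simp: m_def emeasure_eq_measure2)
  have "q * m \<le> p * (m + e)" if "e > 0" for e
    using le[OF that] m assms(3,4) that by (simp flip: ennreal_plus ennreal_mult add: ennreal_le_iff)
  from this[of "e / p" for e] have "q * m \<le> p * m + e" if "e > 0" for e
    using that \<open>0 < p\<close> by (auto simp: distrib_left)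
  then have "q * m \<le> p * m" by (rule field_le_epsilon)
  then have "m = 0" using \<open>p < q\<close> m by (simp add: mult_le_cancel_right)
  then show ?thesis using S by (simp add: negligible_iff_measure m_def)
qed

text \<open>Without a limit, Liminf and Limsup differ, and two rationals fit between them; the bound
  \<open>B\<close> keeps both finite, so that equality would give a real limit. Rational thresholds
  and radii \<open>inverse (real (Suc k))\<close> make the condition countable, as measurability of
  the exceptional set requires.\<close>

lemma not_convergent_at_0_iff_oscillates:
  fixes \<phi> :: "real \<Rightarrow> real"
  assumes B: "\<And>h. h \<noteq> 0 \<Longrightarrow> \<bar>\<phi> h\<bar> \<le> B"
  shows "(\<not> (\<exists>l. (\<phi> \<longlongrightarrow> l) (at 0))) \<longleftrightarrow>
    (\<exists>p q :: rat. p < q \<and> (\<forall>k. \<exists>h\<in>{h. h \<noteq> 0 \<and> \<bar>h\<bar> < inverse (real (Suc k))}. \<phi> h < of_rat p)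
                 \<and> (\<forall>k. \<exists>h\<in>{h. h \<noteq> 0 \<and> \<bar>h\<bar> < inverse (real (Suc k))}. of_rat q < \<phi> h))"
    (is "?L \<longleftrightarrow> ?R")
proof -
  have freq: "(\<forall>k. \<exists>h\<in>{h. h \<noteq> 0 \<and> \<bar>h\<bar> < inverse (real (Suc k))}. Q h) \<longleftrightarrow> (\<exists>\<^sub>F h in at 0. Q h)" for Q
  proof
    assume *: "\<forall>k. \<exists>h\<in>{h. h \<noteq> 0 \<and> \<bar>h\<bar> < inverse (real (Suc k))}. Q h"
    show "\<exists>\<^sub>F h in at 0. Q h"
      unfolding frequently_at
    proof (intro allI impI)
      fix d :: real assume "d > 0"
      then obtain k where "inverse (real (Suc k)) < d" using reals_Archimedean by blast
      moreover obtain h where "h \<noteq> 0" "\<bar>h\<bar> < inverse (real (Suc k))" "Q h" using * by blast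
      ultimately show "\<exists>x\<in>UNIV. x \<noteq> 0 \<and> dist x 0 < d \<and> Q x" by (intro bexI[of _ h]) auto
    qed
  next
    assume "\<exists>\<^sub>F h in at 0. Q h"
    then show "\<forall>k. \<exists>h\<in>{h. h \<noteq> 0 \<and> \<bar>h\<bar> < inverse (real (Suc k))}. Q h"
      unfolding frequently_at dist_real_def by (metis (mono_tags, lifting) diff_zero inverse_positive_iff_positive mem_Collect_eq of_nat_0_less_iff zero_less_Suc)
  qed
  show ?thesis
    unfolding freq
  proof
    assume L: ?L
    let ?i = "Liminf (at 0) (\<lambda>h. ereal (\<phi> h))" and ?s = "Limsup (at 0) (\<lambda>h. ereal (\<phi> h))"
    have le: "?i \<le> ?s" by (rule Liminf_le_Limsup) simp
    have ev: "\<forall>\<^sub>F h in at 0. \<bar>\<phi> h\<bar> \<le> B"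
      using B by (auto simp: eventually_at_filter)
    have "ereal (- B) \<le> ?i" by (rule Liminf_bounded) (use ev in \<open>auto elim!: eventually_mono\<close>)
    moreover have "?s \<le> ereal B" by (rule Limsup_bounded) (use ev in \<open>auto elim!: eventually_mono\<close>)
    ultimately have fin: "\<bar>?i\<bar> \<noteq> \<infinity>" using le by (cases ?i; cases ?s) auto
    have "?i \<noteq> ?s"
    proof
      assume "?i = ?s"
      then have "((\<lambda>h. ereal (\<phi> h)) \<longlongrightarrow> ?i) (at 0)"
        by (subst tendsto_iff_Liminf_eq_Limsup) auto
      then have "(\<phi> \<longlongrightarrow> real_of_ereal ?i) (at 0)" using fin by (simp flip: lim_ereal add: ereal_real)
      then show False using L by blast
    qed
    with le have "?i < ?s" by simp
    then obtain p :: rat where p: "?i < ereal (of_rat p)" "ereal (of_rat p) < ?s" using ereal_dense3 by blast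
    then obtain q :: rat where q: "ereal (of_rat p) < ereal (of_rat q)" "ereal (of_rat q) < ?s" using ereal_dense3 by blast
    have "\<exists>\<^sub>F h in at 0. \<phi> h < of_rat p"
    proof (rule ccontr)
      assume "\<not> ?thesis"
      then have "\<forall>\<^sub>F h in at 0. ereal (of_rat p) \<le> ereal (\<phi> h)" by (simp add: not_frequently not_less)
      then have "ereal (of_rat p) \<le> ?i" by (rule Liminf_bounded)
      with p show False by simp
    qed
    moreover have "\<exists>\<^sub>F h in at 0. of_rat q < \<phi> h"
    proof (rule ccontr)
      assume "\<not> ?thesis"
      then have "\<forall>\<^sub>F h in at 0. ereal (\<phi> h) \<le> ereal (of_rat q)" by (simp add: not_frequently not_less)
      then have "?s \<le> ereal (of_rat q)" by (rule Limsup_bounded)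
      with q show False by simp
    qed
    ultimately show "\<exists>p q. p < q \<and> (\<exists>\<^sub>F h in at 0. \<phi> h < of_rat p) \<and> (\<exists>\<^sub>F h in at 0. of_rat q < \<phi> h)"
      using q(1) by (auto simp: of_rat_less)
  next
    assume "\<exists>p q. p < q \<and> (\<exists>\<^sub>F h in at 0. \<phi> h < of_rat p) \<and> (\<exists>\<^sub>F h in at 0. of_rat q < \<phi> h)"
    then obtain p q :: rat where pq: "p < q" "\<exists>\<^sub>F h in at 0. \<phi> h < of_rat p" "\<exists>\<^sub>F h in at 0. of_rat q < \<phi> h" by blast
    show ?L
    proof
      assume "\<exists>l. (\<phi> \<longlongrightarrow> l) (at 0)"
      then obtain l where l: "(\<phi> \<longlongrightarrow> l) (at 0)" by blast
      have pq': "(of_rat p :: real) < of_rat q" using pq(1) by (simp add: of_rat_less)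
      show False
      proof (cases "l < of_rat q")
        case True
        then have "\<forall>\<^sub>F h in at 0. \<phi> h < of_rat q" using order_tendstoD(2)[OF l] by blast
        then have "\<not> (\<exists>\<^sub>F h in at 0. of_rat q < \<phi> h)"
          unfolding not_frequently by (auto elim!: eventually_mono)
        with pq show False by blast
      next
        case False
        then have "\<forall>\<^sub>F h in at 0. of_rat p < \<phi> h" using order_tendstoD(1)[OF l] pq' by auto
        then have "\<not> (\<exists>\<^sub>F h in at 0. \<phi> h < of_rat p)"
          unfolding not_frequently by (auto elim!: eventually_mono)
        with pq show False by blast
      qed
    qed
  qed
qed

section \<open>Directional derivatives of Lipschitz functions\<close>

definition no_dir_derivative :: "('a::real_normed_vector \<Rightarrow> real) \<Rightarrow> 'a \<Rightarrow> 'a set" where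
  "no_dir_derivative g v = {x. \<not> (\<exists>l. ((\<lambda>t. (g (x + t *\<^sub>R v) - g x) / t) \<longlongrightarrow> l) (at 0))}"

lemma lipschitz_quotient_bound:
  fixes g :: "'a::real_normed_vector \<Rightarrow> real"
  assumes L: "L-lipschitz_on UNIV g" and "t \<noteq> 0"
  shows "\<bar>(g (x + t *\<^sub>R v) - g x) / t\<bar> \<le> L * norm v"
proof -
  have "\<bar>g (x + t *\<^sub>R v) - g x\<bar> \<le> L * (\<bar>t\<bar> * norm v)"
    using lipschitz_onD[OF L, of "x + t *\<^sub>R v" x] by (simp add: dist_norm)
  then show ?thesis using \<open>t \<noteq> 0\<close> by (simp add: abs_divide field_simps)
qed

lemma no_dir_derivative_eq:
  fixes g :: "'a::real_normed_vector \<Rightarrow> real"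
  assumes L: "L-lipschitz_on UNIV g"
  shows "no_dir_derivative g v = (\<Union>(p,q)\<in>{(p,q). p < q}.
      (\<Inter>k. \<Union>h\<in>{h. h \<noteq> 0 \<and> \<bar>h\<bar> < inverse (real (Suc k))}. {x. (g (x + h *\<^sub>R v) - g x) / h < of_rat p})
    \<inter> (\<Inter>k. \<Union>h\<in>{h. h \<noteq> 0 \<and> \<bar>h\<bar> < inverse (real (Suc k))}. {x. of_rat q < (g (x + h *\<^sub>R v) - g x) / h}))"
proof (rule set_eqI)
  fix x
  show "x \<in> no_dir_derivative g v \<longleftrightarrow> x \<in> (\<Union>(p,q)\<in>{(p,q). p < q}.
      (\<Inter>k. \<Union>h\<in>{h. h \<noteq> 0 \<and> \<bar>h\<bar> < inverse (real (Suc k))}. {x. (g (x + h *\<^sub>R v) - g x) / h < of_rat p})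
    \<inter> (\<Inter>k. \<Union>h\<in>{h. h \<noteq> 0 \<and> \<bar>h\<bar> < inverse (real (Suc k))}. {x. of_rat q < (g (x + h *\<^sub>R v) - g x) / h}))"
    using not_convergent_at_0_iff_oscillates[of "\<lambda>t. (g (x + t *\<^sub>R v) - g x) / t", OF lipschitz_quotient_bound[OF L]]
    unfolding no_dir_derivative_def by auto
qed

lemma open_quotient_level:
  fixes g :: "'a::real_normed_vector \<Rightarrow> real"
  assumes L: "L-lipschitz_on UNIV g"
  shows "open {x. (g (x + h *\<^sub>R v) - g x) / h < c}" "open {x. c < (g (x + h *\<^sub>R v) - g x) / h}"
proof -
  have g: "continuous_on UNIV g" by (rule lipschitz_on_continuous_on[OF L])
  have 1: "continuous_on UNIV (\<lambda>x. (g (x + h *\<^sub>R v) - g x) / h)"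
    by (cases "h = 0") (auto intro!: continuous_intros continuous_on_compose2[OF g])
  show "open {x. (g (x + h *\<^sub>R v) - g x) / h < c}" "open {x. c < (g (x + h *\<^sub>R v) - g x) / h}"
    by (intro open_Collect_less 1 continuous_intros)+
qed

text \<open>The union over the steps \<open>h\<close> is uncountable, but a union of open sets is
  open; only the intersection over \<open>k\<close> has to be countable.\<close>

lemma borel_INT_UN_open:
  assumes "\<And>h. open (A h)"
  shows "(\<Inter>k :: nat. \<Union>h\<in>H k. A h) \<in> sets borel"
  using assms by (intro sets.countable_INT) (auto intro!: borel_open open_UN)

lemma borel_no_dir_derivative:
  fixes g :: "'a::real_normed_vector \<Rightarrow> real"
  assumes L: "L-lipschitz_on UNIV g"
  shows "no_dir_derivative g v \<in> sets borel"
  unfolding no_dir_derivative_eq[OF L]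
proof (rule sets.countable_UN'')
  show "(case i of (p, q) \<Rightarrow>
      (\<Inter>k. \<Union>h\<in>{h. h \<noteq> 0 \<and> \<bar>h\<bar> < inverse (real (Suc k))}. {x. (g (x + h *\<^sub>R v) - g x) / h < of_rat p})
    \<inter> (\<Inter>k. \<Union>h\<in>{h. h \<noteq> 0 \<and> \<bar>h\<bar> < inverse (real (Suc k))}. {x. of_rat q < (g (x + h *\<^sub>R v) - g x) / h})) \<in> sets borel" for i :: "rat \<times> rat"
    unfolding split_beta by (intro sets.Int borel_INT_UN_open open_quotient_level[OF L])
qed auto

text \<open>A linear term of slope \<open>L + 1\<close> makes \<open>g\<close> increasing and shifts
  every difference quotient by \<open>L + 1\<close>, so oscillation between two rationals becomes
  oscillation for a monotone function. Cutting with \<open>{-real N..real N}\<close> supplies finite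
  measure.\<close>

lemma negligible_no_dir_derivative_real:
  fixes g :: "real \<Rightarrow> real"
  assumes L: "L-lipschitz_on UNIV g"
  shows "negligible (no_dir_derivative g 1)"
proof -
  define F where "F x = g x + (L + 1) * x" for x
  have L0: "L \<ge> 0" using L by (rule lipschitz_on_nonneg)
  have inc: "v - u \<le> F v - F u" if "u \<le> v" for u v
    using lipschitz_onD[OF L, of v u] that by (auto simp: F_def dist_real_def algebra_simps)
  have mono: "mono F" using inc by (force intro!: monoI)
  have cont: "continuous_on UNIV F"
    unfolding F_def by (intro continuous_intros lipschitz_on_continuous_on[OF L])
  define S where "S p q = (\<Inter>k. \<Union>h\<in>{h. h \<noteq> 0 \<and> \<bar>h\<bar> < inverse (real (Suc k))}. {x. (g (x + h *\<^sub>R 1) - g x) / h < of_rat p})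
    \<inter> (\<Inter>k. \<Union>h\<in>{h. h \<noteq> 0 \<and> \<bar>h\<bar> < inverse (real (Suc k))}. {x. of_rat q < (g (x + h *\<^sub>R 1) - g x) / h})" for p q :: rat
  have "negligible (S p q \<inter> {-real N..real N})" if "p < q" for p q N
  proof (cases "0 < of_rat p + (L + 1)")
    \<comment> \<open>Here \<open>p\<close> lies below \<open>- L\<close>, and no difference
      quotient of \<open>g\<close> can be that small.\<close>
    case False
    have "S p q = {}"
    proof -
      { fix x h assume "h \<noteq> 0" "(g (x + h *\<^sub>R 1) - g x) / h < of_rat p"
        then have "- L > (g (x + h *\<^sub>R 1) - g x) / h" using False by linarith
        then have False using lipschitz_quotient_bound[OF L \<open>h \<noteq> 0\<close>, of x 1] unfolding norm_one mult_1_right by linarith }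
      note contra = this
      show ?thesis
      proof (rule equals0I)
        fix x assume "x \<in> S p q"
        then have "\<exists>h\<in>{h. h \<noteq> 0 \<and> \<bar>h\<bar> < inverse (real (Suc 0))}. (g (x + h *\<^sub>R 1) - g x) / h < of_rat p"
          unfolding S_def by (metis (mono_tags, lifting) INT_E IntD1 UNIV_I UN_E mem_Collect_eq)
        then show False using contra by blast
      qed
    qed
    then show ?thesis by simp
  next
    case True
    \<comment> \<open>For negative \<open>h\<close> the point \<open>x\<close> is the right end of
      the interval; the quotient is the same either way.\<close>
    have conv: "\<exists>u v. u < v \<and> x \<in> {u..v} \<and> v - u < d \<and> (g v - g u) / (v - u) = (g (x + h *\<^sub>R 1) - g x) / h"
      if "h \<noteq> 0" "\<bar>h\<bar> < d" for x h d
    proof (cases "h > 0")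
      case True then show ?thesis using that by (intro exI[of _ x] exI[of _ "x + h"]) auto
    next
      case False
      then show ?thesis using that
        by (intro exI[of _ "x + h"] exI[of _ x]) (auto simp: field_simps)
    qed
    show ?thesis
    proof (rule negligible_oscillating_quotient[OF mono cont True, of "of_rat q + (L + 1)"])
      show "of_rat p + (L + 1) < of_rat q + (L + 1)" using \<open>p < q\<close> by (simp add: of_rat_less)
      have "S p q \<in> sets borel"
        unfolding S_def by (intro sets.Int borel_INT_UN_open open_quotient_level[OF L])
      then show "S p q \<inter> {-real N..real N} \<in> lmeasurable"
        by (intro bounded_set_imp_lmeasurable bounded_Int) auto
      show "\<exists>u v. u < v \<and> x \<in> {u..v} \<and> v - u < d \<and> F v - F u \<le> (of_rat p + (L + 1)) * (v - u)"
        if x: "x \<in> S p q \<inter> {-real N..real N}" and "0 < d" for x d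
      proof -
        obtain k where k: "inverse (real (Suc k)) < d" using \<open>0 < d\<close> reals_Archimedean by blast
        obtain h where h: "h \<noteq> 0" "\<bar>h\<bar> < inverse (real (Suc k))" "(g (x + h *\<^sub>R 1) - g x) / h < of_rat p"
          using x unfolding S_def by blast
        obtain u v where uv: "u < v" "x \<in> {u..v}" "v - u < d" "(g v - g u) / (v - u) < of_rat p"
          using conv[OF h(1), of d x] h(2,3) k by fastforce
        then have "g v - g u < of_rat p * (v - u)" by (simp add: field_simps)
        then have "F v - F u \<le> (of_rat p + (L + 1)) * (v - u)" by (simp add: F_def algebra_simps)
        then show ?thesis using uv by blast
      qed
      show "\<exists>u v. u < v \<and> x \<in> {u..v} \<and> v - u < d \<and> (of_rat q + (L + 1)) * (v - u) \<le> F v - F u"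
        if x: "x \<in> S p q \<inter> {-real N..real N}" and "0 < d" for x d
      proof -
        obtain k where k: "inverse (real (Suc k)) < d" using \<open>0 < d\<close> reals_Archimedean by blast
        obtain h where h: "h \<noteq> 0" "\<bar>h\<bar> < inverse (real (Suc k))" "of_rat q < (g (x + h *\<^sub>R 1) - g x) / h"
          using x unfolding S_def by blast
        obtain u v where uv: "u < v" "x \<in> {u..v}" "v - u < d" "of_rat q < (g v - g u) / (v - u)"
          using conv[OF h(1), of d x] h(2,3) k by fastforce
        then have "of_rat q * (v - u) < g v - g u" by (simp add: field_simps)
        then have "(of_rat q + (L + 1)) * (v - u) \<le> F v - F u" by (simp add: F_def algebra_simps)
        then show ?thesis using uv by blast
      qed
    qed
  qed
  then have "negligible (\<Union>i\<in>{(p,q,N). p < q}. case i of (p,q,N) \<Rightarrow> S p q \<inter> {-real N..real N})"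
    by (intro negligible_countable_Union) auto
  moreover have "no_dir_derivative g 1 \<subseteq> (\<Union>i\<in>{(p,q,N). p < q}. case i of (p,q,N) \<Rightarrow> S p q \<inter> {-real N..real N})"
  proof
    fix x assume "x \<in> no_dir_derivative g 1"
    then obtain p q where "p < q" "x \<in> S p q" unfolding no_dir_derivative_eq[OF L] S_def by blast
    moreover obtain N where "\<bar>x\<bar> \<le> real N" using real_arch_simple by blast
    ultimately show "x \<in> (\<Union>i\<in>{(p,q,N). p < q}. case i of (p,q,N) \<Rightarrow> S p q \<inter> {-real N..real N})"
      by (intro UN_I[of "(p,q,N)"]) auto
  qed
  ultimately show ?thesis by (rule negligible_subset)
qed

lemma AE_lborel_translate:
  fixes c :: "'a::euclidean_space"
  assumes "N \<in> sets borel" and ae: "AE x in lborel. x + c \<notin> N"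
  shows "AE x in lborel. x \<notin> N"
proof -
  have "AE x in distr lborel borel ((+) c). x \<notin> N"
    using assms by (subst AE_distr_iff) (auto simp: add.commute)
  then show ?thesis unfolding lborel_distr_plus .
qed

text \<open>Averaging \<open>x + t v\<close> over \<open>t\<close> reduces the claim to lines without choosing coordinates.\<close>

lemma AE_lborel_lines:
  fixes v :: "'a::euclidean_space"
  assumes N: "N \<in> sets borel" and line: "\<And>x. negligible {t :: real. x + t *\<^sub>R v \<in> N}"
  shows "AE x in lborel. x \<notin> N"
proof -
  have m: "{z \<in> space (lborel \<Otimes>\<^sub>M lborel). case z of (x, t) \<Rightarrow> x + t *\<^sub>R v \<notin> N} \<in> sets (lborel \<Otimes>\<^sub>M (lborel :: real measure))"
    using N by measurable
  have "AE t in (lborel :: real measure). x + t *\<^sub>R v \<notin> N" for x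
  proof -
    have meas: "{t :: real. x + t *\<^sub>R v \<in> N} \<in> sets borel"
      using N by measurable
    have "AE t in lebesgue. t \<notin> {t :: real. x + t *\<^sub>R v \<in> N}"
      using line by (intro AE_not_in) (simp add: negligible_iff_null_sets)
    then show ?thesis
      using meas by (simp add: AE_completion_iff)
  qed
  then have "AE x in lborel. AE t in (lborel :: real measure). x + t *\<^sub>R v \<notin> N" by simp
  then have *: "AE t in (lborel :: real measure). AE x in lborel. x + t *\<^sub>R v \<notin> N"
    using m by (subst (asm) lborel_pair.AE_commute) (auto simp: split_beta)
  \<comment> \<open>A single good \<open>t\<close> is enough, since translation by
    \<open>t *\<^sub>R v\<close> preserves null sets.\<close>
  obtain t :: real where "AE x in lborel. x + t *\<^sub>R v \<notin> N"
  proof (rule_tac ccontr)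
    assume "\<not> thesis"
    then have "\<not> (AE x in lborel. x + t *\<^sub>R v \<notin> N)" for t :: real using that by blast
    with * have "AE t in (lborel :: real measure). False" by simp
    then have "AE t in (lborel :: real measure). t \<notin> {0..1}" by (rule eventually_mono) simp
    then have "{0..1} \<in> null_sets (lborel :: real measure)" by (subst AE_iff_null_sets) auto
    then show False by (simp add: null_sets_def)
  qed
  then show ?thesis by (rule AE_lborel_translate[OF N])
qed

lemma negligible_no_dir_derivative:
  fixes g :: "'a::euclidean_space \<Rightarrow> real"
  assumes L: "L-lipschitz_on UNIV g"
  shows "negligible (no_dir_derivative g v)"
proof -
  have "negligible {t :: real. x + t *\<^sub>R v \<in> no_dir_derivative g v}" for x
  proof -
    have "(L * norm v)-lipschitz_on UNIV (\<lambda>t. g (x + t *\<^sub>R v))"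
    proof (rule lipschitz_onI)
      fix s t :: real
      have "dist (g (x + s *\<^sub>R v)) (g (x + t *\<^sub>R v)) \<le> L * dist (x + s *\<^sub>R v) (x + t *\<^sub>R v)"
        by (rule lipschitz_onD[OF L]) auto
      also have "dist (x + s *\<^sub>R v) (x + t *\<^sub>R v) = norm v * dist s t"
        by (simp add: dist_norm flip: scaleR_diff_left)
      finally show "dist (g (x + s *\<^sub>R v)) (g (x + t *\<^sub>R v)) \<le> L * norm v * dist s t" by (simp add: mult.assoc)
    qed (use lipschitz_on_nonneg[OF L] in auto)
    from negligible_no_dir_derivative_real[OF this] show ?thesis
      by (simp add: no_dir_derivative_def scaleR_left_distrib add.assoc)
  qed
  from AE_lborel_lines[OF borel_no_dir_derivative[OF L] this]
  have "no_dir_derivative g v \<in> null_sets lborel"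
    using borel_no_dir_derivative[OF L] by (subst AE_iff_null_sets) auto
  then show ?thesis by (simp add: negligible_iff_null_sets null_sets_completionI)
qed

section \<open>Porous subsets of a closed set\<close>

text \<open>Near a porous point a fixed fraction of a ball misses \<open>E\<close>. The disjoint
  balls of a Vitali covering therefore have total measure at most a constant times that of
  \<open>T - F\<close>, and the open set \<open>T\<close> can be taken as close to \<open>F\<close>
  as desired.\<close>

lemma negligible_porous:
  fixes E :: "'a::euclidean_space set"
  assumes E: "closed E" and \<eta>: "0 < \<eta>" "\<eta> \<le> 1"
  shows "negligible {x \<in> E. \<forall>\<delta>>0. \<exists>h y. 0 < h \<and> h < \<delta> \<and> y \<in> ball x h \<and> ball y (\<eta> * h) \<inter> E = {}}"
    (is "negligible ?N")
proof -
  have "negligible (?N \<inter> cbox a b)" for a b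
  proof -
    let ?n = "DIM('a)"
    define F where "F = E \<inter> cbox a b"
    have F: "F \<in> lmeasurable"
      unfolding F_def by (intro lmeasurable_compact closed_Int_compact E compact_cbox)
    \<comment> \<open>Volume ratio of \<open>ball x (2 * h)\<close> to its hole
      \<open>ball y (\<eta> * h)\<close>.\<close>
    define c where "c = (2 / \<eta>) ^ ?n"
    have "c > 0" using \<eta> by (simp add: c_def)
    have "\<exists>T. ?N \<inter> cbox a b \<subseteq> T \<and> T \<in> lmeasurable \<and> measure lebesgue T \<le> e" if "e > 0" for e
    proof -
      have "e / c > 0" using that \<open>c > 0\<close> by simp
      then obtain T where T: "open T" "F \<subseteq> T" "T - F \<in> lmeasurable" "emeasure lebesgue (T - F) < ennreal (e / c)"
        using sets_lebesgue_outer_open[OF fmeasurableD[OF F]] by blast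
      \<comment> \<open>The hole has its centre within \<open>h\<close> of \<open>x\<close> and
        radius at most \<open>h\<close>, so the ball of radius \<open>2 * h\<close> contains it;
        disjoint balls then have disjoint holes.\<close>
      define K where "K = {(x,h,y). 0 < h \<and> ball x (2 * h) \<subseteq> T \<and> y \<in> ball x h \<and> ball y (\<eta> * h) \<inter> E = {}}"
      have V: "\<exists>i. i \<in> K \<and> x \<in> ball (fst i) (2 * fst (snd i)) \<and> 2 * fst (snd i) < d"
        if "x \<in> ?N \<inter> cbox a b" "0 < d" for x d
      proof -
        have "x \<in> T" using that T(2) by (auto simp: F_def)
        then obtain d' where d': "d' > 0" "ball x d' \<subseteq> T" using T(1) open_contains_ball by blast
        have "min d d' / 2 > 0" using d' \<open>0 < d\<close> by auto
        moreover have "\<forall>\<delta>>0. \<exists>h y. 0 < h \<and> h < \<delta> \<and> y \<in> ball x h \<and> ball y (\<eta> * h) \<inter> E = {}"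
          using that(1) by simp
        ultimately obtain h y where hy: "0 < h" "h < min d d' / 2" "y \<in> ball x h" "ball y (\<eta> * h) \<inter> E = {}"
          by metis
        have "ball x (2 * h) \<subseteq> ball x d'" using hy by (intro subset_ball) auto
        then have "(x,h,y) \<in> K" using hy d' by (auto simp: K_def)
        then show ?thesis using hy by (intro exI[of _ "(x,h,y)"]) auto
      qed
      obtain C where C: "countable C" "C \<subseteq> K"
        "pairwise (\<lambda>i j. disjnt (ball (fst i) (2 * fst (snd i))) (ball (fst j) (2 * fst (snd j)))) C"
        "negligible (?N \<inter> cbox a b - (\<Union>i \<in> C. ball (fst i) (2 * fst (snd i))))"
        by (rule Vitali_covering_theorem_balls[of "?N \<inter> cbox a b" K fst "\<lambda>i. 2 * fst (snd i)", OF V])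
      let ?A = "\<Union>i \<in> C. ball (fst i) (2 * fst (snd i))"
      have sub: "ball (snd (snd i)) (\<eta> * fst (snd i)) \<subseteq> ball (fst i) (2 * fst (snd i))" and
        sub': "ball (snd (snd i)) (\<eta> * fst (snd i)) \<subseteq> T - F" if i: "i \<in> C" for i
      proof -
        obtain x h y where xhy: "i = (x,h,y)" by (cases i) auto
        have K: "0 < h" "ball x (2 * h) \<subseteq> T" "y \<in> ball x h" "ball y (\<eta> * h) \<inter> E = {}"
          using i C(2) xhy by (auto simp: K_def)
        have "ball y (\<eta> * h) \<subseteq> ball x (2 * h)"
        proof
          fix z assume "z \<in> ball y (\<eta> * h)"
          moreover have "\<eta> * h \<le> h" using \<eta> K by (simp add: mult_le_cancel_right1)
          ultimately show "z \<in> ball x (2 * h)"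
            using K(3) dist_triangle[of x z y] by (auto simp: dist_commute)
        qed
        then show "ball (snd (snd i)) (\<eta> * fst (snd i)) \<subseteq> ball (fst i) (2 * fst (snd i))"
          "ball (snd (snd i)) (\<eta> * fst (snd i)) \<subseteq> T - F"
          using K by (auto simp: xhy F_def)
      qed
      have "emeasure lborel ?A = (\<integral>\<^sup>+i. emeasure lborel (ball (fst i) (2 * fst (snd i))) \<partial>count_space C)"
        using C by (intro emeasure_UN_countable) (auto simp: disjoint_family_on_def pairwise_def disjnt_def)
      also have "\<dots> = (\<integral>\<^sup>+i. ennreal c * emeasure lborel (ball (snd (snd i)) (\<eta> * fst (snd i))) \<partial>count_space C)"
      proof (rule nn_integral_cong)
        fix i assume "i \<in> space (count_space C)"
        then have "0 < fst (snd i)" using C(2) by (auto simp: K_def)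
        then show "emeasure lborel (ball (fst i) (2 * fst (snd i))) = ennreal c * emeasure lborel (ball (snd (snd i)) (\<eta> * fst (snd i)))"
          using \<eta> \<open>c > 0\<close> by (simp add: emeasure_ball c_def power_mult_distrib power_divide flip: ennreal_mult'')
      qed
      also have "\<dots> = ennreal c * emeasure lborel (\<Union>i\<in>C. ball (snd (snd i)) (\<eta> * fst (snd i)))"
      proof -
        have "emeasure lborel (\<Union>i\<in>C. ball (snd (snd i)) (\<eta> * fst (snd i))) = (\<integral>\<^sup>+i. emeasure lborel (ball (snd (snd i)) (\<eta> * fst (snd i))) \<partial>count_space C)"
        proof (rule emeasure_UN_countable)
          show "disjoint_family_on (\<lambda>i. ball (snd (snd i)) (\<eta> * fst (snd i))) C"
            unfolding disjoint_family_on_def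
          proof (intro ballI impI)
            fix i j assume ij: "i \<in> C" "j \<in> C" "i \<noteq> j"
            then have "ball (fst i) (2 * fst (snd i)) \<inter> ball (fst j) (2 * fst (snd j)) = {}"
              using C(3) by (auto simp: pairwise_def disjnt_def)
            then show "ball (snd (snd i)) (\<eta> * fst (snd i)) \<inter> ball (snd (snd j)) (\<eta> * fst (snd j)) = {}"
              using sub[OF ij(1)] sub[OF ij(2)] by blast
          qed
        qed (use C in auto)
        then show ?thesis by (simp add: nn_integral_cmult)
      qed
      also have "\<dots> \<le> ennreal c * emeasure lebesgue (T - F)"
      proof (rule mult_left_mono)
        have o: "open (\<Union>i\<in>C. ball (snd (snd i)) (\<eta> * fst (snd i)))" by auto
        have "emeasure lborel (\<Union>i\<in>C. ball (snd (snd i)) (\<eta> * fst (snd i))) = emeasure lebesgue (\<Union>i\<in>C. ball (snd (snd i)) (\<eta> * fst (snd i)))"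
          using borel_open[OF o] by simp
        also have "\<dots> \<le> emeasure lebesgue (T - F)"
          by (rule emeasure_mono) (use sub' T(3) in \<open>auto simp: fmeasurableD\<close>)
        finally show "emeasure lborel (\<Union>i\<in>C. ball (snd (snd i)) (\<eta> * fst (snd i))) \<le> emeasure lebesgue (T - F)" .
      qed auto
      also have "\<dots> \<le> ennreal c * ennreal (e / c)" using T(4) by (intro mult_left_mono) auto
      also have "\<dots> = ennreal e" using \<open>c > 0\<close> \<open>e > 0\<close> by (simp flip: ennreal_mult)
      finally have A: "emeasure lborel ?A \<le> ennreal e" .
      have oA: "open ?A" by auto
      have A': "emeasure lebesgue ?A \<le> ennreal e" using A borel_open[OF oA] by simp
      have lA: "?A \<in> lmeasurable" using A' borel_open[OF oA]
        by (intro fmeasurableI) (auto intro: le_less_trans simp: less_top[symmetric] top_unique)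
      let ?R = "?N \<inter> cbox a b - ?A"
      have "measure lebesgue (?A \<union> ?R) = measure lebesgue ?A"
        using C(4) lA by (intro measure_Un_null_set) (auto simp: negligible_iff_null_sets fmeasurableD)
      moreover have "measure lebesgue ?A \<le> e"
        using A' \<open>e > 0\<close> by (simp add: measure_def enn2real_leI)
      moreover have "?A \<union> ?R \<in> lmeasurable"
        using lA C(4) by (intro fmeasurable.Un) (auto simp: negligible_imp_measurable)
      ultimately show ?thesis by (intro exI[of _ "?A \<union> ?R"]) auto
    qed
    then show ?thesis unfolding negligible_outer_le by blast
  qed
  then show ?thesis by (subst negligible_on_intervals) blast
qed

text \<open>
  On the closed set where the difference quotients along the axes are uniformly close to those of a
  fixed linear form, a step along an axis can be moved to a nearby point of the set;
  at a nonporous point this moves every step of an axis-parallel path.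
\<close>

theorem rademacher:
  fixes g :: "'a::euclidean_space \<Rightarrow> real"
  assumes L: "L-lipschitz_on UNIV g"
  shows "negligible {x. \<not> g differentiable (at x)}"
proof -
  have L0: "L \<ge> 0" using L by (rule lipschitz_on_nonneg)
  have lip: "\<bar>g x - g y\<bar> \<le> L * norm (x - y)" for x y
    using lipschitz_onD[OF L, of x y] by (simp add: dist_norm)
  have cont: "continuous_on UNIV g" by (rule lipschitz_on_continuous_on[OF L])
  \<comment> \<open>Candidate gradients are drawn from a countable dense set, so that only countably
    many exceptional sets arise.\<close>
  obtain D :: "'a set" where D: "countable D" "\<And>X. open X \<Longrightarrow> X \<noteq> {} \<Longrightarrow> \<exists>d \<in> D. d \<in> X"
    using countable_dense_setE by blast
  define \<epsilon> where "\<epsilon> j = inverse (real (Suc j))" for j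
  have \<epsilon>: "0 < \<epsilon> j" "\<epsilon> j \<le> 1" for j by (auto simp: \<epsilon>_def field_simps)
  define E where "E a m j = {x. \<forall>b\<in>Basis. \<forall>t. \<bar>t\<bar> < inverse (real (Suc m)) \<longrightarrow>
      \<bar>g (x + t *\<^sub>R b) - g x - t * (a \<bullet> b)\<bar> \<le> \<epsilon> j * \<bar>t\<bar>}" for a m j
  have clE: "closed (E a m j)" for a m j
  proof -
    have "E a m j = (\<Inter>b\<in>Basis. \<Inter>t\<in>{t. \<bar>t\<bar> < inverse (real (Suc m))}.
        {x. \<bar>g (x + t *\<^sub>R b) - g x - t * (a \<bullet> b)\<bar> \<le> \<epsilon> j * \<bar>t\<bar>})"
      by (auto simp: E_def)
    also have "closed \<dots>"
      by (intro closed_INT ballI closed_Collect_le continuous_intros continuous_on_compose2[OF cont]) auto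
    finally show ?thesis .
  qed
  define N where "N a m j = {x \<in> E a m j. \<forall>\<delta>>0. \<exists>h y. 0 < h \<and> h < \<delta> \<and> y \<in> ball x h \<and> ball y (\<epsilon> j * h) \<inter> E a m j = {}}" for a m j
  define Bad where "Bad = (\<Union>b\<in>Basis. no_dir_derivative g b) \<union> (\<Union>(a,m,j)\<in>D \<times> UNIV \<times> UNIV. N a m j)"
  have "negligible (N a m j)" for a m j
    unfolding N_def by (rule negligible_porous[OF clE \<epsilon>])
  then have "negligible (\<Union>(a,m,j)\<in>D \<times> UNIV \<times> UNIV. N a m j)"
    using D(1) by (intro negligible_countable_Union) auto
  moreover have "negligible (\<Union>b\<in>Basis. no_dir_derivative g b)"
    by (intro negligible_Union) (auto intro: negligible_no_dir_derivative[OF L])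
  ultimately have "negligible Bad" unfolding Bad_def by (intro negligible_Un)
  moreover have "{x. \<not> g differentiable (at x)} \<subseteq> Bad"
  proof (rule subsetI, rule ccontr)
    fix x assume "x \<in> {x. \<not> g differentiable (at x)}" and good: "x \<notin> Bad"
    then have nd: "\<not> g differentiable (at x)" by simp
    have "\<exists>l. \<forall>b\<in>Basis. ((\<lambda>t. (g (x + t *\<^sub>R b) - g x) / t) \<longlongrightarrow> l b) (at 0)"
      using good unfolding Bad_def no_dir_derivative_def by (intro bchoice) auto
    then obtain l where l: "\<And>b. b \<in> Basis \<Longrightarrow> ((\<lambda>t. (g (x + t *\<^sub>R b) - g x) / t) \<longlongrightarrow> l b) (at 0)" by blast
    define a0 where "a0 = (\<Sum>b\<in>Basis. l b *\<^sub>R b)"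
    have a0: "a0 \<bullet> b = l b" if "b \<in> Basis" for b
      using that by (simp add: a0_def)
    \<comment> \<open>Each of the \<open>DIM('a)\<close> axis steps costs
      \<open>2 * L * (\<epsilon> j * h) + \<epsilon> j * norm v\<close>, where \<open>h\<close> will
      be \<open>(DIM('a) + 1) * norm v\<close>; the final 1 pays for exchanging \<open>a\<close> and
      \<open>a0\<close>.\<close>
    define C where "C = real DIM('a) * (2 * L * (real DIM('a) + 1) + 1) + 1"
    have C0: "C > 0" using L0 by (auto simp: C_def intro!: add_nonneg_pos mult_nonneg_nonneg)
    have key: "\<exists>d>0. \<forall>v. norm v < d \<longrightarrow> \<bar>g (x + v) - g x - a0 \<bullet> v\<bar> \<le> C * \<epsilon> j * norm v" for j
    proof -
      have "\<exists>a\<in>D. a \<in> ball a0 (\<epsilon> j / 2)" using D(2)[of "ball a0 (\<epsilon> j / 2)"] \<epsilon>(1)[of j] by auto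
      then obtain a where a: "a \<in> D" "norm (a0 - a) < \<epsilon> j / 2" by (auto simp: dist_norm)
      have ab: "\<bar>(a0 - a) \<bullet> v\<bar> \<le> \<epsilon> j / 2 * norm v" for v
        using a(2) by (intro order.trans[OF Cauchy_Schwarz_ineq2] mult_right_mono) auto
      have "\<forall>\<^sub>F t in at 0. \<forall>b\<in>Basis. \<bar>(g (x + t *\<^sub>R b) - g x) / t - l b\<bar> < \<epsilon> j / 2"
      proof (intro eventually_ball_finite finite_Basis ballI)
        fix b :: 'a assume "b \<in> Basis"
        from tendstoD[OF l[OF this], of "\<epsilon> j / 2"] \<epsilon>(1)[of j]
        show "\<forall>\<^sub>F t in at 0. \<bar>(g (x + t *\<^sub>R b) - g x) / t - l b\<bar> < \<epsilon> j / 2"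
          unfolding dist_real_def by simp
      qed
      then obtain d1 where d1: "d1 > 0" "\<forall>t\<in>UNIV. t \<noteq> 0 \<and> dist t 0 < d1 \<longrightarrow> (\<forall>b\<in>Basis. \<bar>(g (x + t *\<^sub>R b) - g x) / t - l b\<bar> < \<epsilon> j / 2)"
        unfolding eventually_at by blast
      have d1': "\<bar>(g (x + t *\<^sub>R b) - g x) / t - l b\<bar> < \<epsilon> j / 2" if "t \<noteq> 0" "\<bar>t\<bar> < d1" "b \<in> Basis" for t b
        using d1(2)[rule_format, of t b] that unfolding dist_real_def diff_zero by blast
      obtain m where m: "inverse (real (Suc m)) < d1" using d1(1) reals_Archimedean by blast
      have xE: "x \<in> E a m j"
        unfolding E_def
      proof (intro CollectI ballI allI impI)
        fix b :: 'a and t :: real assume b: "b \<in> Basis" and t: "\<bar>t\<bar> < inverse (real (Suc m))"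
        show "\<bar>g (x + t *\<^sub>R b) - g x - t * (a \<bullet> b)\<bar> \<le> \<epsilon> j * \<bar>t\<bar>"
        proof (cases "t = 0")
          case False
          have "\<bar>(g (x + t *\<^sub>R b) - g x) / t - l b\<bar> < \<epsilon> j / 2" using d1'[OF False _ b] t m by linarith
          moreover have "\<bar>l b - a \<bullet> b\<bar> \<le> \<epsilon> j / 2" using ab[of b] b by (simp add: inner_diff_left a0)
          ultimately have "\<bar>(g (x + t *\<^sub>R b) - g x) / t - a \<bullet> b\<bar> \<le> \<epsilon> j" by linarith
          then have "\<bar>(g (x + t *\<^sub>R b) - g x) / t - a \<bullet> b\<bar> * \<bar>t\<bar> \<le> \<epsilon> j * \<bar>t\<bar>" by (intro mult_right_mono) auto
          also have "\<bar>(g (x + t *\<^sub>R b) - g x) / t - a \<bullet> b\<bar> * \<bar>t\<bar> = \<bar>((g (x + t *\<^sub>R b) - g x) / t - a \<bullet> b) * t\<bar>"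
            by (simp add: abs_mult)
          also have "((g (x + t *\<^sub>R b) - g x) / t - a \<bullet> b) * t = g (x + t *\<^sub>R b) - g x - t * (a \<bullet> b)"
            using False by (simp add: field_simps)
          finally show ?thesis .
        qed simp
      qed
      have "x \<notin> N a m j" using good a(1) by (auto simp: Bad_def)
      then obtain \<delta> where \<delta>: "\<delta> > 0" "\<And>h y. 0 < h \<Longrightarrow> h < \<delta> \<Longrightarrow> y \<in> ball x h \<Longrightarrow> ball y (\<epsilon> j * h) \<inter> E a m j \<noteq> {}"
        using xE unfolding N_def by blast
      \<comment> \<open>The first bound keeps every axis step within the range controlled by
        \<open>E a m j\<close>; the second gives \<open>h < \<delta>\<close> below.\<close>
      define d where "d = min (inverse (real (Suc m))) (\<delta> / (real DIM('a) + 1))"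
      have "d > 0" using \<delta>(1) by (auto simp: d_def intro!: divide_pos_pos)
      moreover have "\<bar>g (x + v) - g x - a0 \<bullet> v\<bar> \<le> C * \<epsilon> j * norm v" if v: "norm v < d" for v
      proof (cases "v = 0")
        case False
        \<comment> \<open>All vertices of the path are within \<open>DIM('a) * norm v\<close> of
          \<open>x\<close>; the extra 1 puts them strictly inside \<open>ball x h\<close>.\<close>
        define h where "h = (real DIM('a) + 1) * norm v"
        have "h > 0" using False by (auto simp: h_def intro!: mult_pos_pos add_nonneg_pos)
        have "norm v < \<delta> / (real DIM('a) + 1)" using v by (simp add: d_def)
        then have "h < \<delta>" by (simp add: h_def pos_less_divide_eq add_nonneg_pos mult.commute)
        have vm: "norm v < inverse (real (Suc m))" using v by (simp add: d_def)
        have ind: "\<bar>g (x + (\<Sum>b\<in>S. (v \<bullet> b) *\<^sub>R b)) - g x - (\<Sum>b\<in>S. (v \<bullet> b) * (a \<bullet> b))\<bar> \<le> real (card S) * (2 * L * (\<epsilon> j * h) + \<epsilon> j * norm v)"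
          if "S \<subseteq> Basis" for S
          using finite_subset[OF that finite_Basis] that
        proof (induction S rule: finite_induct)
          case (insert b S)
          define y where "y = x + (\<Sum>b\<in>S. (v \<bullet> b) *\<^sub>R b)"
          have "norm (y - x) \<le> (\<Sum>b\<in>S. norm v)"
            unfolding y_def add_diff_cancel_left' using insert.prems
            by (intro sum_norm_le) (auto simp: Basis_le_norm subset_iff)
          also have "\<dots> \<le> real DIM('a) * norm v"
            using insert.prems by (auto intro!: mult_right_mono card_mono)
          also have "\<dots> < h" using False by (simp add: h_def)
          finally have "y \<in> ball x h" by (simp add: dist_norm norm_minus_commute)
          \<comment> \<open>The increment along the axis is controlled at \<open>z\<close>; moving
            each of its two endpoints between \<open>y\<close> and \<open>z\<close> costs
            \<open>L * (\<epsilon> j * h)\<close>.\<close>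
          then obtain z where z: "z \<in> ball y (\<epsilon> j * h)" "z \<in> E a m j"
            using \<delta>(2)[OF \<open>h > 0\<close> \<open>h < \<delta>\<close>] by blast
          have b: "b \<in> Basis" using insert.prems by auto
          have vb: "\<bar>v \<bullet> b\<bar> \<le> norm v" using b by (rule Basis_le_norm)
          have "\<bar>g (z + (v \<bullet> b) *\<^sub>R b) - g z - (v \<bullet> b) * (a \<bullet> b)\<bar> \<le> \<epsilon> j * \<bar>v \<bullet> b\<bar>"
            using z(2) b vb vm by (auto simp: E_def)
          also have "\<dots> \<le> \<epsilon> j * norm v" using vb \<epsilon>(1)[of j] by (intro mult_left_mono) auto
          finally have 1: "\<bar>g (z + (v \<bullet> b) *\<^sub>R b) - g z - (v \<bullet> b) * (a \<bullet> b)\<bar> \<le> \<epsilon> j * norm v" .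
          have zy: "L * norm (y - z) \<le> L * (\<epsilon> j * h)" using z(1) L0 by (intro mult_left_mono) (auto simp: dist_norm)
          have 2: "\<bar>g (y + (v \<bullet> b) *\<^sub>R b) - g (z + (v \<bullet> b) *\<^sub>R b)\<bar> \<le> L * (\<epsilon> j * h)"
            using lip[of "y + (v \<bullet> b) *\<^sub>R b" "z + (v \<bullet> b) *\<^sub>R b"] zy by simp
          have 3: "\<bar>g y - g z\<bar> \<le> L * (\<epsilon> j * h)" using lip[of y z] zy by simp
          have IH: "\<bar>g y - g x - (\<Sum>b\<in>S. (v \<bullet> b) * (a \<bullet> b))\<bar> \<le> real (card S) * (2 * L * (\<epsilon> j * h) + \<epsilon> j * norm v)"
            using insert unfolding y_def by auto
          have eq: "x + (\<Sum>b\<in>insert b S. (v \<bullet> b) *\<^sub>R b) = y + (v \<bullet> b) *\<^sub>R b"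
            using insert by (simp add: y_def)
          have "real (card (insert b S)) * (2 * L * (\<epsilon> j * h) + \<epsilon> j * norm v) = real (card S) * (2 * L * (\<epsilon> j * h) + \<epsilon> j * norm v) + (2 * L * (\<epsilon> j * h) + \<epsilon> j * norm v)"
            using insert by (simp add: algebra_simps)
          then show ?case unfolding eq using 1 2 3 IH insert(1,2) by simp
        qed simp
        have "\<bar>g (x + v) - g x - a \<bullet> v\<bar> \<le> real DIM('a) * (2 * L * (\<epsilon> j * h) + \<epsilon> j * norm v)"
          using ind[of Basis] by (simp add: euclidean_representation euclidean_inner[of a v] mult.commute)
        also have "\<dots> = (C - 1) * \<epsilon> j * norm v" by (simp add: C_def h_def algebra_simps)
        finally have "\<bar>g (x + v) - g x - a \<bullet> v\<bar> \<le> (C - 1) * \<epsilon> j * norm v" .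
        moreover have "\<bar>a0 \<bullet> v - a \<bullet> v\<bar> \<le> \<epsilon> j * norm v"
        proof -
          have "\<epsilon> j / 2 * norm v \<le> \<epsilon> j * norm v" using \<epsilon>(1)[of j] by (intro mult_right_mono) auto
          then have "\<bar>(a0 - a) \<bullet> v\<bar> \<le> \<epsilon> j * norm v" using ab[of v] by linarith
          then show ?thesis by (simp add: inner_diff_left)
        qed
        ultimately show ?thesis by (simp add: algebra_simps)
      qed simp
      ultimately show ?thesis by blast
    qed
    have "(g has_derivative (\<lambda>v. a0 \<bullet> v)) (at x)"
      unfolding has_derivative_at_alt
    proof (intro conjI allI impI)
      show "bounded_linear ((\<bullet>) a0)" by (rule bounded_linear_inner_right)
      fix e :: real assume "e > 0"
      then obtain j where j: "\<epsilon> j < e / C" using reals_Archimedean[of "e / C"] C0 by (auto simp: \<epsilon>_def)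
      then have jC: "C * \<epsilon> j \<le> e" using C0 by (simp add: field_simps)
      obtain d where d: "d > 0" "\<And>v. norm v < d \<Longrightarrow> \<bar>g (x + v) - g x - a0 \<bullet> v\<bar> \<le> C * \<epsilon> j * norm v" using key by blast
      show "\<exists>d>0. \<forall>y. norm (y - x) < d \<longrightarrow> norm (g y - g x - a0 \<bullet> (y - x)) \<le> e * norm (y - x)"
      proof (intro exI[of _ d] conjI allI impI)
        fix y assume y: "norm (y - x) < d"
        have "norm (g y - g x - a0 \<bullet> (y - x)) \<le> C * \<epsilon> j * norm (y - x)" using d(2)[OF y] by simp
        also have "\<dots> \<le> e * norm (y - x)" using jC by (rule mult_right_mono) simp
        finally show "norm (g y - g x - a0 \<bullet> (y - x)) \<le> e * norm (y - x)" .
      qed (rule d(1))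
    qed
    then show False using nd by (auto simp: differentiable_def)
  qed
  ultimately show ?thesis by (rule negligible_subset)
qed

section \<open>Lipschitz maps whose derivative is bounded almost everywhere\<close>

lemma AE_lborel_of_negligible:
  assumes "negligible {x. \<not> P x}"
  shows "AE x in lborel. P x"
proof -
  have "AE x in lebesgue. x \<notin> {x. \<not> P x}"
    using assms by (intro AE_not_in) (simp add: negligible_iff_null_sets)
  then show ?thesis by (simp add: AE_completion_iff)
qed

text \<open>Averaging over a small ball makes the function differentiable along \<open>v\<close>, with the
  derivative bound inherited by dominated convergence.\<close>

lemma increment_le_of_AE_derivative:
  fixes g :: "'a::euclidean_space \<Rightarrow> real"
  assumes L: "L-lipschitz_on UNIV g"
    and ae: "AE z in lborel. z \<in> ball c \<rho> \<longrightarrow> (\<exists>D. (g has_derivative D) (at z) \<and> D v \<le> M)"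
    and x: "x \<in> ball c \<rho>" "x + v \<in> ball c \<rho>"
  shows "g (x + v) - g x \<le> M"
proof -
  have L0: "L \<ge> 0" using L by (rule lipschitz_on_nonneg)
  have lip: "\<bar>g x - g y\<bar> \<le> L * norm (x - y)" for x y
    using lipschitz_onD[OF L, of x y] by (simp add: dist_norm)
  have cont: "continuous_on UNIV g" by (rule lipschitz_on_continuous_on[OF L])
  \<comment> \<open>Leaves a margin: balls of radius less than \<open>\<rho> - \<rho>'\<close>
    around points of the segment stay inside \<open>ball c \<rho>\<close>.\<close>
  define \<rho>' where "\<rho>' = max (dist c x) (dist c (x + v))"
  have \<rho>': "\<rho>' < \<rho>" using x by (auto simp: \<rho>'_def)
  have seg: "x + t *\<^sub>R v \<in> cball c \<rho>'" if "0 \<le> t" "t \<le> 1" for t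
  proof -
    have "(1 - t) *\<^sub>R x + t *\<^sub>R (x + v) \<in> cball c \<rho>'"
      using that by (intro convexD_alt convex_cball) (auto simp: \<rho>'_def)
    then show ?thesis by (simp add: algebra_simps)
  qed
  have main: "g (x + v) - g x \<le> M + 2 * L * \<epsilon>" if \<epsilon>: "0 < \<epsilon>" "\<epsilon> < \<rho> - \<rho>'" for \<epsilon>
  proof -
    define B where "B = (restrict_space lborel (cball 0 \<epsilon>) :: 'a measure)"
    have spB: "space B = cball 0 \<epsilon>" by (simp add: B_def space_restrict_space)
    have emB: "emeasure B (space B) = ennreal (unit_ball_vol (real DIM('a)) * \<epsilon> ^ DIM('a))"
      unfolding spB using \<epsilon> by (simp add: B_def emeasure_restrict_space emeasure_cball)
    interpret B: finite_measure B
      by (rule finite_measureI) (simp add: emB)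
    define m where "m = measure B (space B)"
    have m: "m > 0" unfolding m_def measure_def emB using \<epsilon> by simp
    have meas: "(\<lambda>z. h z) \<in> borel_measurable B" if "continuous_on UNIV h" for h :: "'a \<Rightarrow> real"
      unfolding B_def by (intro measurable_restrict_space1) (use borel_measurable_continuous_onI[OF that] in simp)
    have intg: "integrable B (\<lambda>z. g (y + z))" for y
    proof (rule B.integrable_const_bound[where B = "\<bar>g y\<bar> + L * \<epsilon>"])
      show "AE z in B. norm (g (y + z)) \<le> \<bar>g y\<bar> + L * \<epsilon>"
      proof (rule AE_I2)
        fix z assume "z \<in> space B"
        then have "L * norm z \<le> L * \<epsilon>" using L0 by (intro mult_left_mono) (auto simp: spB)
        then show "norm (g (y + z)) \<le> \<bar>g y\<bar> + L * \<epsilon>" using lip[of "y + z" y] by simp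
      qed
      show "(\<lambda>z. g (y + z)) \<in> borel_measurable B"
        by (intro meas continuous_on_compose2[OF cont] continuous_intros) auto
    qed
    \<comment> \<open>The average is not normalised; the total mass \<open>m\<close> of
      \<open>B\<close> is carried through instead.\<close>
    define A where "A t = (LINT z|B. g (x + t *\<^sub>R v + z))" for t
    have near: "\<bar>A t - m * g (x + t *\<^sub>R v)\<bar> \<le> m * (L * \<epsilon>)" for t
    proof -
      have "A t - m * g (x + t *\<^sub>R v) = (LINT z|B. g (x + t *\<^sub>R v + z) - g (x + t *\<^sub>R v))"
        unfolding A_def m_def by (subst Bochner_Integration.integral_diff[OF intg]) auto
      also have "\<bar>\<dots>\<bar> \<le> (LINT z|B. \<bar>g (x + t *\<^sub>R v + z) - g (x + t *\<^sub>R v)\<bar>)"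
        by (rule integral_abs_bound)
      also have "\<dots> \<le> (LINT z|B. L * \<epsilon>)"
      proof (rule integral_mono)
        show "integrable B (\<lambda>z. \<bar>g (x + t *\<^sub>R v + z) - g (x + t *\<^sub>R v)\<bar>)"
          by (intro integrable_abs Bochner_Integration.integrable_diff intg) auto
        fix z assume "z \<in> space B"
        then have "L * norm z \<le> L * \<epsilon>" using L0 by (intro mult_left_mono) (auto simp: spB)
        then show "\<bar>g (x + t *\<^sub>R v + z) - g (x + t *\<^sub>R v)\<bar> \<le> L * \<epsilon>" using lip[of "x + t *\<^sub>R v + z" "x + t *\<^sub>R v"] by simp
      qed auto
      also have "\<dots> = m * (L * \<epsilon>)" by (simp add: m_def)
      finally show ?thesis .
    qed
    have deriv: "\<exists>y. (A has_real_derivative y) (at t) \<and> y \<le> m * M" if t: "0 \<le> t" "t \<le> 1" for t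
    proof -
      let ?y = "x + t *\<^sub>R v"
      define q where "q h z = (g (?y + z + h *\<^sub>R v) - g (?y + z)) / h" for h :: real and z
      \<comment> \<open>Taking \<open>lim\<close> along one fixed sequence makes \<open>f\<close>
        measurable everywhere; it equals the directional derivative wherever \<open>g\<close> is
        differentiable.\<close>
      define f where "f z = lim (\<lambda>k. q (inverse (real (Suc k))) z)" for z
      have invlim: "filterlim (\<lambda>k. inverse (real (Suc k))) (at 0) sequentially"
        unfolding filterlim_at using LIMSEQ_inverse_real_of_nat by (auto simp del: of_nat_Suc)
      have qm: "q h \<in> borel_measurable B" for h
        unfolding q_def
        by (cases "h = 0") (auto intro!: meas continuous_intros continuous_on_compose2[OF cont])
      have fm: "f \<in> borel_measurable B"
        unfolding f_def by (rule borel_measurable_lim_metric) (rule qm)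
      have "AE z in lborel. z + ?y \<in> ball c \<rho> \<longrightarrow> (\<exists>D. (g has_derivative D) (at (z + ?y)) \<and> D v \<le> M)"
      proof -
        have "AE z in distr lborel borel ((+) ?y). z \<in> ball c \<rho> \<longrightarrow> (\<exists>D. (g has_derivative D) (at z) \<and> D v \<le> M)"
          unfolding lborel_distr_plus by (rule ae)
        then show ?thesis by (auto dest!: AE_distrD[rotated] simp: add.commute)
      qed
      then have "AE z in B. z + ?y \<in> ball c \<rho> \<longrightarrow> (\<exists>D. (g has_derivative D) (at (z + ?y)) \<and> D v \<le> M)"
        unfolding B_def by (subst AE_restrict_space_iff) auto
      then have lim: "AE z in B. ((\<lambda>h. q h z) \<longlongrightarrow> f z) (at 0) \<and> f z \<le> M"
      proof (rule AE_mp[OF _ AE_I2], intro impI)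
        fix z assume z: "z \<in> space B" and *: "z + ?y \<in> ball c \<rho> \<longrightarrow> (\<exists>D. (g has_derivative D) (at (z + ?y)) \<and> D v \<le> M)"
        have "z + ?y \<in> ball c \<rho>"
          using seg[OF t] z \<epsilon> dist_triangle[of c "z + ?y" ?y] by (auto simp: spB dist_norm)
        then obtain D where D: "(g has_derivative D) (at (?y + z))" "D v \<le> M" using * by (auto simp: add.commute)
        have "((\<lambda>h. g (?y + z + h *\<^sub>R v)) has_derivative (\<lambda>h. D (h *\<^sub>R v))) (at 0)"
          by (rule has_derivative_compose[of "\<lambda>h. ?y + z + h *\<^sub>R v" "\<lambda>h. h *\<^sub>R v" 0 UNIV g D])
            (use D in \<open>auto intro!: derivative_eq_intros\<close>)
        then have "((\<lambda>h. g (?y + z + h *\<^sub>R v)) has_real_derivative D v) (at 0)"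
          using has_derivative_linear[OF D(1)]
          by (simp add: has_field_derivative_def linear_cmul mult_commute_abs)
        then have ql: "((\<lambda>h. q h z) \<longlongrightarrow> D v) (at 0)"
          by (simp add: DERIV_def q_def)
        have "(\<lambda>k. q (inverse (real (Suc k))) z) \<longlonglongrightarrow> D v"
          by (rule filterlim_compose[OF ql invlim])
        then have "f z = D v" unfolding f_def by (rule limI)
        then show "((\<lambda>h. q h z) \<longlongrightarrow> f z) (at 0) \<and> f z \<le> M" using ql D by simp
      qed
      have bd: "\<bar>q h z\<bar> \<le> L * norm v" for h z
        using lipschitz_quotient_bound[OF L, of h "?y + z" v] L0 by (cases "h = 0") (auto simp: q_def)
      have intq: "integrable B (q h)" for h
        by (rule B.integrable_const_bound[where B = "L * norm v"]) (use bd qm in auto)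
      have seqlim: "(\<lambda>k. LINT z|B. q (X k) z) \<longlonglongrightarrow> (LINT z|B. f z)"
        if X: "\<And>k. X k \<noteq> 0" "X \<longlonglongrightarrow> 0" for X
      proof (rule integral_dominated_convergence[where w = "\<lambda>_. L * norm v"])
        show "AE z in B. (\<lambda>k. q (X k) z) \<longlonglongrightarrow> f z"
          using lim
        proof eventually_elim
          case (elim z)
          have "filterlim X (at 0) sequentially" using X by (simp add: filterlim_at)
          with elim show ?case using filterlim_compose[of "\<lambda>h. q h z"] by blast
        qed
      qed (use fm qm bd in auto)
      have "((\<lambda>h. LINT z|B. q h z) \<longlongrightarrow> (LINT z|B. f z)) (at 0)"
        unfolding tendsto_at_iff_sequentially using seqlim by (auto simp: comp_def)
      moreover have "(LINT z|B. q h z) = (A (t + h) - A t) / h" for h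
      proof -
        have "(LINT z|B. q h z) = (LINT z|B. (g (x + (t + h) *\<^sub>R v + z) - g (?y + z))) / h"
          by (simp add: q_def algebra_simps)
        then show ?thesis unfolding A_def by (subst (asm) Bochner_Integration.integral_diff[OF intg intg])
      qed
      ultimately have "(A has_real_derivative (LINT z|B. f z)) (at t)"
        by (simp add: DERIV_def)
      moreover have "(LINT z|B. f z) \<le> (LINT z|B. M)"
      proof (rule integral_mono_AE)
        show "integrable B f"
        proof (rule integrable_dominated_convergence[where w = "\<lambda>_. L * norm v" and s = "\<lambda>k. q (inverse (real (Suc k)))"])
          show "AE z in B. (\<lambda>k. q (inverse (real (Suc k))) z) \<longlonglongrightarrow> f z"
            using lim
          proof eventually_elim
            case (elim z)
            then show ?case using filterlim_compose[OF _ invlim, of "\<lambda>h. q h z"] by blast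
          qed
        qed (use fm qm bd in auto)
        show "AE z in B. f z \<le> M" using lim by eventually_elim simp
      qed auto
      ultimately show ?thesis by (auto simp: m_def mult.commute)
    qed
    have "A 1 - m * M * 1 \<le> A 0 - m * M * 0"
    proof (rule DERIV_nonpos_imp_nonincreasing[of 0 1 "\<lambda>t. A t - m * M * t"])
      fix t :: real assume "0 \<le> t" "t \<le> 1"
      then obtain y where y: "(A has_real_derivative y) (at t)" "y \<le> m * M" using deriv by blast
      have "((\<lambda>t. A t - m * M * t) has_real_derivative y - m * M) (at t)"
        by (auto intro!: derivative_eq_intros y)
      then show "\<exists>y. ((\<lambda>t. A t - m * M * t) has_real_derivative y) (at t) \<and> y \<le> 0" using y(2) by auto
    qed simp
    then have "m * g (x + v) - m * g x \<le> m * M + 2 * (m * (L * \<epsilon>))"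
      using near[of 1] near[of 0] by simp
    then have "m * (g (x + v) - g x) \<le> m * (M + 2 * L * \<epsilon>)" by (simp add: algebra_simps)
    then show ?thesis using m by simp
  qed
  show ?thesis
  proof (rule field_le_epsilon)
    fix e :: real assume "e > 0"
    define \<epsilon> where "\<epsilon> = min ((\<rho> - \<rho>') / 2) (e / (2 * L + 1))"
    have "\<epsilon> \<le> (\<rho> - \<rho>') / 2" unfolding \<epsilon>_def by (rule min.cobounded1)
    also have "\<dots> < \<rho> - \<rho>'" using \<rho>' by simp
    finally have "\<epsilon> < \<rho> - \<rho>'" .
    moreover have "0 < \<epsilon>" using \<open>e > 0\<close> L0 \<rho>' by (auto simp: \<epsilon>_def)
    moreover have "2 * L * \<epsilon> \<le> e"
    proof -
      have "2 * L * \<epsilon> \<le> 2 * L * (e / (2 * L + 1))" using L0 by (intro mult_left_mono) (auto simp: \<epsilon>_def)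
      also have "\<dots> \<le> e" using L0 \<open>e > 0\<close> by (simp add: field_simps)
      finally show ?thesis .
    qed
    ultimately show "g (x + v) - g x \<le> M + e" using main[of \<epsilon>] by simp
  qed
qed

text \<open>Pairing with the unit vector \<open>u\<close> in the direction of
  \<open>R y - R x\<close> turns the norm of the increment into a scalar increment, and the bound on
  the derivative into one for \<open>\<lambda>z. R z \<bullet> u\<close>.\<close>

proposition nonexpansive_of_derivative_bound:
  fixes R :: "'a::euclidean_space \<Rightarrow> 'b::euclidean_space"
  assumes L: "L-lipschitz_on UNIV R"
    and D: "\<And>z D v. z \<in> ball c \<rho> \<Longrightarrow> (R has_derivative D) (at z) \<Longrightarrow> norm (D v) \<le> norm v"
    and xy: "x \<in> ball c \<rho>" "y \<in> ball c \<rho>"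
  shows "norm (R y - R x) \<le> norm (y - x)"
proof (cases "R y = R x")
  case False
  define u where "u = (R y - R x) /\<^sub>R norm (R y - R x)"
  have u: "norm u = 1" using False by (simp add: u_def)
  have lipc: "(L * norm b)-lipschitz_on UNIV (\<lambda>z. R z \<bullet> b)" for b
  proof (rule lipschitz_onI)
    fix s t
    have "dist (R s \<bullet> b) (R t \<bullet> b) = \<bar>(R s - R t) \<bullet> b\<bar>" by (simp add: dist_real_def inner_diff_left)
    also have "\<dots> \<le> norm (R s - R t) * norm b" by (rule Cauchy_Schwarz_ineq2)
    also have "\<dots> \<le> L * dist s t * norm b"
      using lipschitz_onD[OF L, of s t] by (intro mult_right_mono) (auto simp: dist_norm)
    finally show "dist (R s \<bullet> b) (R t \<bullet> b) \<le> L * norm b * dist s t" by (simp add: mult_ac)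
  qed (use lipschitz_on_nonneg[OF L] in auto)
  have "negligible {z. \<not> R differentiable (at z)}"
  proof (rule negligible_subset)
    show "negligible (\<Union>b\<in>Basis. {z. \<not> (\<lambda>z. R z \<bullet> b) differentiable (at z)})"
      by (intro negligible_Union) (auto intro: rademacher[OF lipc])
    show "{z. \<not> R differentiable (at z)} \<subseteq> (\<Union>b\<in>Basis. {z. \<not> (\<lambda>z. R z \<bullet> b) differentiable (at z)})"
      by (auto simp: differentiable_componentwise_within[of R])
  qed
  then have ae: "AE z in lborel. R differentiable (at z)" by (rule AE_lborel_of_negligible)
  have "R (x + (y - x)) \<bullet> u - R x \<bullet> u \<le> norm (y - x)"
  proof (rule increment_le_of_AE_derivative[OF lipc, of c \<rho> u "y - x"])
    show "AE z in lborel. z \<in> ball c \<rho> \<longrightarrow> (\<exists>D. ((\<lambda>z. R z \<bullet> u) has_derivative D) (at z) \<and> D (y - x) \<le> norm (y - x))"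
      using ae
    proof eventually_elim
      case (elim z)
      then obtain D' where D': "(R has_derivative D') (at z)" by (auto simp: differentiable_def)
      show ?case
      proof
        assume "z \<in> ball c \<rho>"
        then have "norm (D' (y - x)) \<le> norm (y - x)" using D D' by blast
        then have "D' (y - x) \<bullet> u \<le> norm (y - x)"
          using norm_cauchy_schwarz[of "D' (y - x)" u] u by simp
        moreover have "((\<lambda>z. R z \<bullet> u) has_derivative (\<lambda>h. D' h \<bullet> u)) (at z)"
          by (rule has_derivative_inner_left[OF D'])
        ultimately show "\<exists>D. ((\<lambda>z. R z \<bullet> u) has_derivative D) (at z) \<and> D (y - x) \<le> norm (y - x)" by blast
      qed
    qed
  qed (use xy in auto)
  then have "(R y - R x) \<bullet> u \<le> norm (y - x)" by (simp add: inner_diff_left)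
  moreover have "(R y - R x) \<bullet> u = norm (R y - R x)"
    using False by (simp add: u_def dot_square_norm power2_eq_square)
  ultimately show ?thesis by simp
qed auto

section \<open>Subgradients\<close>

text \<open>Divided by \<open>norm (y - x)\<close>, the quadratic term tends to 0. The sign of
  \<open>C\<close> is free: it will be \<open>- s / 2\<close> for the quadratic minorants and
  \<open>1 / (2 * \<mu>)\<close> for proximal points.\<close>

lemma regsubI:
  assumes fin: "\<bar>f x\<bar> \<noteq> \<infinity>" and "d > 0"
    and le: "\<And>y. y \<in> ball x d \<Longrightarrow> f y \<ge> f x + ereal (xs \<bullet> (y - x) - C * (norm (y - x))\<^sup>2)"
  shows "xs \<in> regsub f x"
proof -
  obtain a where a: "f x = ereal a" using fin by auto
  have lim: "((\<lambda>y. ereal (- C * norm (y - x))) \<longlongrightarrow> ereal 0) (at x)"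
    unfolding lim_ereal by (auto intro!: tendsto_eq_intros)
  have ev: "\<forall>\<^sub>F y in at x. ereal (- C * norm (y - x)) \<le> (f y - f x - ereal (xs \<bullet> (y - x))) / ereal (norm (y - x))"
    unfolding eventually_at
  proof (intro exI[of _ d] conjI ballI impI)
    fix y assume y: "y \<noteq> x \<and> dist y x < d"
    then have n: "norm (y - x) > 0" by simp
    have *: "f y \<ge> ereal (a + (xs \<bullet> (y - x) - C * (norm (y - x))\<^sup>2))" using le[of y] y a by (simp add: dist_commute)
    show "ereal (- C * norm (y - x)) \<le> (f y - f x - ereal (xs \<bullet> (y - x))) / ereal (norm (y - x))"
    proof (cases "f y")
      case (real b)
      then have "- C * norm (y - x) * norm (y - x) \<le> b - a - xs \<bullet> (y - x)" using * by (simp add: power2_eq_square mult.assoc)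
      then have "- C * norm (y - x) \<le> (b - a - xs \<bullet> (y - x)) / norm (y - x)" using n by (simp add: pos_le_divide_eq)
      then show ?thesis using real a n by simp
    next
      case PInf
      then show ?thesis using a n by simp
    next
      case MInf
      then show ?thesis using * by simp
    qed
  qed (rule \<open>d > 0\<close>)
  have "0 \<le> Liminf (at x) (\<lambda>y. (f y - f x - ereal (xs \<bullet> (y - x))) / ereal (norm (y - x)))"
    unfolding le_Liminf_iff
  proof (intro allI impI)
    fix c :: ereal assume "c < 0"
    then have "\<forall>\<^sub>F y in at x. c < ereal (- C * norm (y - x))"
      using order_tendstoD(1)[OF lim, of c] by (simp flip: zero_ereal_def)
    with ev show "\<forall>\<^sub>F y in at x. c < (f y - f x - ereal (xs \<bullet> (y - x))) / ereal (norm (y - x))"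
      by eventually_elim (rule less_le_trans)
  qed
  then show ?thesis using fin by (simp add: regsub_def)
qed

lemma regsubD:
  assumes xs: "xs \<in> regsub f x" and "e > 0"
  obtains d where "d > 0" "\<And>y. y \<in> ball x d \<Longrightarrow> f y \<ge> f x + ereal (xs \<bullet> (y - x) - e * norm (y - x))"
proof -
  obtain a where a: "f x = ereal a" using xs by (auto simp: regsub_def)
  have "0 \<le> Liminf (at x) (\<lambda>y. (f y - f x - ereal (xs \<bullet> (y - x))) / ereal (norm (y - x)))"
    using xs by (simp add: regsub_def)
  then have "\<forall>\<^sub>F y in at x. ereal (- e) < (f y - f x - ereal (xs \<bullet> (y - x))) / ereal (norm (y - x))"
    unfolding le_Liminf_iff using \<open>e > 0\<close> by simp
  then obtain d where d: "d > 0" "\<And>y. y \<noteq> x \<Longrightarrow> dist y x < d \<Longrightarrow> ereal (- e) < (f y - f x - ereal (xs \<bullet> (y - x))) / ereal (norm (y - x))"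
    unfolding eventually_at by blast
  show ?thesis
  proof (rule that[OF d(1)])
    fix y assume y: "y \<in> ball x d"
    show "f y \<ge> f x + ereal (xs \<bullet> (y - x) - e * norm (y - x))"
    proof (cases "y = x")
      case True then show ?thesis by (simp flip: zero_ereal_def)
    next
      case False
      then have n: "norm (y - x) > 0" by simp
      have *: "ereal (- e) < (f y - f x - ereal (xs \<bullet> (y - x))) / ereal (norm (y - x))"
        using d(2)[OF False] y by (simp add: dist_commute)
      show ?thesis
      proof (cases "f y")
        case (real b)
        then have "- e < (b - a - xs \<bullet> (y - x)) / norm (y - x)" using * a n by simp
        then have "- e * norm (y - x) < b - a - xs \<bullet> (y - x)" using n by (simp add: pos_less_divide_eq)
        then show ?thesis using real a by simp
      next
        case MInf
        then show ?thesis using * a n by simp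
      qed simp
    qed
  qed
qed

lemma regsub_subset_lsub: "regsub f x \<subseteq> lsub f x"
proof
  fix xs assume "xs \<in> regsub f x"
  then show "xs \<in> lsub f x"
    unfolding lsub_def by (intro CollectI exI[of _ "\<lambda>_. x"] exI[of _ "\<lambda>_. xs"]) auto
qed

lemma lsc_sequence:
  assumes "lsc f" and y: "y \<longlonglongrightarrow> p" and c: "c < f p"
  shows "\<forall>\<^sub>F k in sequentially. c < f (y k)"
proof -
  have "\<forall>\<^sub>F x in at p. c < f x"
    using assms(1) c by (auto simp: lsc_def le_Liminf_iff)
  then have "\<forall>\<^sub>F x in nhds p. c < f x"
    using c by (auto simp: eventually_at_filter elim!: eventually_mono)
  then show ?thesis by (rule eventually_compose_filterlim[OF _ y])
qed

text \<open>The direct method with possibly infinite values: the continuous part is moved to the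
  other side, so that semicontinuity is applied to \<open>f\<close> alone at a real level
  \<open>c\<close>.\<close>

lemma lsc_attains_min:
  fixes f :: "'a::metric_space \<Rightarrow> ereal"
  assumes "lsc f" and "compact K" "K \<noteq> {}" and q: "continuous_on UNIV q"
  obtains p where "p \<in> K" "\<And>y. y \<in> K \<Longrightarrow> f p + ereal (q p) \<le> f y + ereal (q y)"
proof -
  define \<phi> where "\<phi> x = f x + ereal (q x)" for x
  obtain u where u: "\<And>n. u n \<in> \<phi> ` K" "u \<longlonglongrightarrow> Inf (\<phi> ` K)"
    using Inf_as_limit[of "\<phi> ` K"] \<open>K \<noteq> {}\<close> by auto
  have "\<forall>n. \<exists>z. z \<in> K \<and> u n = \<phi> z" using u(1) by blast
  from choice[OF this] obtain y where "\<forall>n. y n \<in> K \<and> u n = \<phi> (y n)" by blast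
  then have y: "\<And>n. y n \<in> K" "\<And>n. u n = \<phi> (y n)" by auto
  obtain p \<sigma> where p: "p \<in> K" "strict_mono \<sigma>" "(y \<circ> \<sigma>) \<longlonglongrightarrow> p"
    using \<open>compact K\<close> y(1) by (metis compact_def)
  have lim: "(\<lambda>n. \<phi> (y (\<sigma> n))) \<longlonglongrightarrow> Inf (\<phi> ` K)"
    using LIMSEQ_subseq_LIMSEQ[OF u(2) p(2)] y(2) by (simp add: comp_def)
  have "\<phi> p \<le> Inf (\<phi> ` K)"
  proof (rule ccontr)
    assume "\<not> \<phi> p \<le> Inf (\<phi> ` K)"
    then have "Inf (\<phi> ` K) < f p + ereal (q p)" by (simp add: \<phi>_def)
    then have "Inf (\<phi> ` K) - ereal (q p) < f p" by (simp add: ereal_minus_less_iff)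
    then obtain c where c: "Inf (\<phi> ` K) - ereal (q p) < ereal c" "ereal c < f p" using ereal_dense2 by blast
    have "\<forall>\<^sub>F n in sequentially. ereal c < f (y (\<sigma> n))"
      using lsc_sequence[OF assms(1) p(3) c(2)] by (simp add: comp_def)
    then have ev: "\<forall>\<^sub>F n in sequentially. ereal (c + q (y (\<sigma> n))) \<le> \<phi> (y (\<sigma> n))"
      by (rule eventually_mono) (simp add: \<phi>_def add_right_mono less_imp_le flip: plus_ereal.simps(1))
    have "(\<lambda>n. q (y (\<sigma> n))) \<longlonglongrightarrow> q p"
      using continuous_on_tendsto_compose[OF q p(3)] by (simp add: comp_def)
    then have "(\<lambda>n. ereal (c + q (y (\<sigma> n)))) \<longlonglongrightarrow> ereal (c + q p)" by (intro tendsto_intros)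
    then have "ereal (c + q p) \<le> Inf (\<phi> ` K)" using tendsto_le[OF _ lim _ ev] by simp
    then show False using c(1) by (cases "Inf (\<phi> ` K)") auto
  qed
  then show ?thesis using p(1) by (intro that[of p]) (auto simp: \<phi>_def intro: order.trans[OF _ Inf_lower])
qed

text \<open>The subgradient is tested at a point a fraction \<open>t\<close> of the way towards
  \<open>x'\<close>. Convexity bounds \<open>g\<close> there from above, with the quadratic
  contributing \<open>s / 2 * (t * (1 - t) * D\<^sup>2)\<close>; dividing by \<open>t\<close> and
  letting it shrink makes the local inequality global.\<close>

lemma ereal_convex_regsub_ineq:
  fixes g :: "'a::real_inner \<Rightarrow> ereal"
  assumes conv: "ereal_convex_on U (\<lambda>x. g x - ereal (s / 2 * (norm x)\<^sup>2))"
    and xs: "xs \<in> regsub g x" and x: "x \<in> U" "x' \<in> U"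
    and ninf: "\<And>x. g x \<noteq> -\<infinity>"
  shows "g x + ereal (xs \<bullet> (x' - x) + s / 2 * (norm (x' - x))\<^sup>2) \<le> g x'"
proof (cases "g x'")
  case (real b)
  obtain a where a: "g x = ereal a" using xs by (auto simp: regsub_def)
  define D where "D = norm (x' - x)"
  define c where "c = xs \<bullet> (x' - x) + s / 2 * D\<^sup>2"
  \<comment> \<open>Collects the coefficients of \<open>e'\<close> in the final error; the
    \<open>+ 1\<close> keeps it positive when \<open>x' = x\<close>.\<close>
  define K where "K = D + \<bar>s\<bar> / 2 * D\<^sup>2 + 1"
  have "K > 0" by (auto simp: K_def D_def intro!: add_nonneg_pos add_nonneg_nonneg)
  have "c \<le> b - a + e" if "e > 0" for e
  proof -
    define e' where "e' = e / K"
    have e': "e' > 0" using that \<open>K > 0\<close> by (simp add: e'_def)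
    obtain d where d: "d > 0" "\<And>y. y \<in> ball x d \<Longrightarrow> g y \<ge> g x + ereal (xs \<bullet> (y - x) - e' * norm (y - x))"
      using regsubD[OF xs e'] by blast
    \<comment> \<open>\<open>t \<le> e'\<close> absorbs the second-order term,
      \<open>t * D < d\<close> keeps the test point where the subgradient inequality holds, and
      \<open>1/2\<close> ensures \<open>t < 1\<close>.\<close>
    define t where "t = min (1/2) (min e' (d / (2 * (D + 1))))"
    have D0: "D \<ge> 0" by (simp add: D_def)
    have t: "0 < t" "t < 1" "t \<le> e'" "t * D < d"
    proof -
      show "0 < t" using e' d(1) D0 by (auto simp: t_def)
      show "t < 1" by (auto simp: t_def min_def)
      show "t \<le> e'" by (auto simp: t_def)
      have "t * D \<le> d / (2 * (D + 1)) * D" using D0 by (intro mult_right_mono) (auto simp: t_def)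
      also have "\<dots> < d" using D0 d(1) by (auto simp: field_simps intro!: add_nonneg_pos)
      finally show "t * D < d" .
    qed
    define y where "y = t *\<^sub>R x' + (1 - t) *\<^sub>R x"
    have yx: "y - x = t *\<^sub>R (x' - x)" by (simp add: y_def algebra_simps)
    have nyx: "norm (y - x) = t * D" using t by (simp add: yx D_def)
    have "y \<in> ball x d" using nyx t by (simp add: dist_norm norm_minus_commute)
    then have lower: "g y \<ge> ereal (a + (t * (xs \<bullet> (x' - x)) - e' * (t * D)))"
      using d(2)[of y] a by (simp add: nyx) (simp add: yx)
    have "g y - ereal (s / 2 * (norm y)\<^sup>2) \<le> ereal t * (g x' - ereal (s / 2 * (norm x')\<^sup>2)) + ereal (1 - t) * (g x - ereal (s / 2 * (norm x)\<^sup>2))"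
      using conv x t unfolding ereal_convex_on_def y_def by blast
    then have "g y - ereal (s / 2 * (norm y)\<^sup>2) \<le> ereal (t * (b - s / 2 * (norm x')\<^sup>2) + (1 - t) * (a - s / 2 * (norm x)\<^sup>2))"
      using real a by simp
    then obtain h where h: "g y = ereal h" "h - s / 2 * (norm y)\<^sup>2 \<le> t * (b - s / 2 * (norm x')\<^sup>2) + (1 - t) * (a - s / 2 * (norm x)\<^sup>2)"
      using ninf[of y] by (cases "g y") auto
    have id: "(norm y)\<^sup>2 = t * (norm x')\<^sup>2 + (1 - t) * (norm x)\<^sup>2 - t * (1 - t) * D\<^sup>2"
      unfolding y_def D_def power2_norm_eq_inner
      by (simp add: inner_add_left inner_add_right inner_diff_left inner_diff_right inner_commute[of x' x] algebra_simps power2_eq_square)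
    have "a + (t * (xs \<bullet> (x' - x)) - e' * (t * D)) \<le> h" using lower h by simp
    also have "h \<le> t * b + (1 - t) * a - s / 2 * (t * (1 - t) * D\<^sup>2)" using h(2) unfolding id by (simp add: field_simps)
    finally have "t * (xs \<bullet> (x' - x) - e' * D + s / 2 * ((1 - t) * D\<^sup>2)) \<le> t * (b - a)" by (simp add: algebra_simps)
    then have 1: "xs \<bullet> (x' - x) - e' * D + s / 2 * ((1 - t) * D\<^sup>2) \<le> b - a" using t by simp
    have "s / 2 * (t * D\<^sup>2) \<le> \<bar>s\<bar> / 2 * (e' * D\<^sup>2)"
      using t by (intro mult_mono) auto
    with 1 have "c \<le> b - a + e' * D + \<bar>s\<bar> / 2 * (e' * D\<^sup>2)" by (simp add: c_def algebra_simps)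
    also have "\<dots> \<le> b - a + e' * K" using e' by (simp add: K_def algebra_simps)
    finally show ?thesis using \<open>K > 0\<close> by (simp add: e'_def)
  qed
  then have "c \<le> b - a" by (rule field_le_epsilon)
  then show ?thesis using real a by (simp add: c_def D_def)
qed (use ninf in auto)

lemma ereal_convex_lsub_ineq:
  fixes g :: "'a::real_inner \<Rightarrow> ereal"
  assumes U: "open U" and conv: "ereal_convex_on U (\<lambda>x. g x - ereal (s / 2 * (norm x)\<^sup>2))"
    and xs: "xs \<in> lsub g x" and x: "x \<in> U" "x' \<in> U"
    and ninf: "\<And>x. g x \<noteq> -\<infinity>"
  shows "g x + ereal (xs \<bullet> (x' - x) + s / 2 * (norm (x' - x))\<^sup>2) \<le> g x'"
proof -
  obtain y ys where y: "y \<longlonglongrightarrow> x" "(\<lambda>k. g (y k)) \<longlonglongrightarrow> g x" "ys \<longlonglongrightarrow> xs" "\<And>k. ys k \<in> regsub g (y k)"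
    using xs by (auto simp: lsub_def)
  have "\<forall>\<^sub>F k in sequentially. y k \<in> U" using y(1) U x(1) by (rule topological_tendstoD)
  then have ev: "\<forall>\<^sub>F k in sequentially. g (y k) + ereal (ys k \<bullet> (x' - y k) + s / 2 * (norm (x' - y k))\<^sup>2) \<le> g x'"
    by (rule eventually_mono) (rule ereal_convex_regsub_ineq[OF conv y(4) _ x(2) ninf])
  have "(\<lambda>k. ereal (ys k \<bullet> (x' - y k) + s / 2 * (norm (x' - y k))\<^sup>2)) \<longlonglongrightarrow> ereal (xs \<bullet> (x' - x) + s / 2 * (norm (x' - x))\<^sup>2)"
    by (intro tendsto_intros y)
  then have "(\<lambda>k. g (y k) + ereal (ys k \<bullet> (x' - y k) + s / 2 * (norm (x' - y k))\<^sup>2)) \<longlonglongrightarrow> g x + ereal (xs \<bullet> (x' - x) + s / 2 * (norm (x' - x))\<^sup>2)"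
    using y(2) by (intro tendsto_add_ereal_general) auto
  then show ?thesis using tendsto_upperbound[OF _ ev] by simp
qed

text \<open>Symmetry of second derivatives with \<open>G\<close> differentiable only at the one
  point \<open>w\<close>. The second difference of \<open>e\<close> over the parallelogram spanned
  by \<open>h *\<^sub>R u\<close> and \<open>h *\<^sub>R v\<close> is
  \<open>h\<^sup>2 * (A u \<bullet> v)\<close> up to o(h^2), and it does not change when
  \<open>u\<close> and \<open>v\<close> are exchanged.\<close>

lemma symmetric_gradient_derivative:
  fixes e :: "'a::real_inner \<Rightarrow> real"
  assumes W: "open W" "w \<in> W"
    and e: "\<And>z. z \<in> W \<Longrightarrow> (e has_derivative (\<lambda>h. G z \<bullet> h)) (at z)"
    and G: "(G has_derivative A) (at w)"
  shows "A u \<bullet> v = A v \<bullet> u"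
proof -
  obtain \<rho> where \<rho>: "\<rho> > 0" "ball w \<rho> \<subseteq> W" using W open_contains_ball by blast
  have lin: "linear A" using G by (rule has_derivative_linear)
  have half: "\<exists>d>0. \<forall>h. 0 < h \<and> h < d \<longrightarrow>
      \<bar>e (w + h *\<^sub>R u + h *\<^sub>R v) - e (w + h *\<^sub>R u) - e (w + h *\<^sub>R v) + e w - h\<^sup>2 * (A u \<bullet> v)\<bar> \<le> h\<^sup>2 * (2 * \<epsilon> * (norm u + norm v) * norm v)"
    if "\<epsilon> > 0" for \<epsilon> u v
  proof -
    obtain d0 where d0: "d0 > 0" "\<And>y. norm (y - w) < d0 \<Longrightarrow> norm (G y - G w - A (y - w)) \<le> \<epsilon> * norm (y - w)"
      using G \<open>\<epsilon> > 0\<close> unfolding has_derivative_at_alt by blast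
    define d where "d = min \<rho> d0 / (norm u + norm v + 1)"
    have nn: "norm u + norm v + 1 > 0" by (simp add: add_nonneg_pos)
    have "d > 0" using \<rho> d0 nn by (auto simp: d_def)
    moreover have "\<bar>e (w + h *\<^sub>R u + h *\<^sub>R v) - e (w + h *\<^sub>R u) - e (w + h *\<^sub>R v) + e w - h\<^sup>2 * (A u \<bullet> v)\<bar> \<le> h\<^sup>2 * (2 * \<epsilon> * (norm u + norm v) * norm v)"
      if h: "0 < h" "h < d" for h
    proof -
      have hd: "h * (norm u + norm v) < min \<rho> d0"
      proof -
        have "h * (norm u + norm v) \<le> h * (norm u + norm v + 1)" using h by (intro mult_left_mono) auto
        also have "\<dots> < min \<rho> d0" using h nn by (simp add: d_def pos_less_divide_eq)
        finally show ?thesis .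
      qed
      have bd: "norm (a *\<^sub>R u + b *\<^sub>R v) \<le> h * (norm u + norm v)" if "0 \<le> a" "a \<le> h" "0 \<le> b" "b \<le> h" for a b
      proof -
        have "norm (a *\<^sub>R u + b *\<^sub>R v) \<le> a * norm u + b * norm v"
          using norm_triangle_ineq[of "a *\<^sub>R u" "b *\<^sub>R v"] that by simp
        also have "\<dots> \<le> h * norm u + h * norm v" using that by (intro add_mono mult_right_mono) auto
        finally show ?thesis by (simp add: algebra_simps)
      qed
      have inW: "w + (a *\<^sub>R u + b *\<^sub>R v) \<in> W" if "0 \<le> a" "a \<le> h" "0 \<le> b" "b \<le> h" for a b
        using bd[OF that] hd by (intro subsetD[OF \<rho>(2)], unfold mem_ball, subst dist_commute) (simp add: dist_norm)
      have app: "norm (G (w + (a *\<^sub>R u + b *\<^sub>R v)) - G w - A (a *\<^sub>R u + b *\<^sub>R v)) \<le> \<epsilon> * (h * (norm u + norm v))"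
        if "0 \<le> a" "a \<le> h" "0 \<le> b" "b \<le> h" for a b
      proof -
        have "norm (G (w + (a *\<^sub>R u + b *\<^sub>R v)) - G w - A (a *\<^sub>R u + b *\<^sub>R v)) \<le> \<epsilon> * norm (a *\<^sub>R u + b *\<^sub>R v)"
          using d0(2)[of "w + (a *\<^sub>R u + b *\<^sub>R v)"] bd[OF that] hd by simp
        also have "\<dots> \<le> \<epsilon> * (h * (norm u + norm v))" using bd[OF that] \<open>\<epsilon> > 0\<close> by (intro mult_left_mono) auto
        finally show ?thesis .
      qed
      \<comment> \<open>The second difference becomes the increment of \<open>F\<close> from 0 to 1.
        Writing \<open>0 *\<^sub>R u\<close> makes both terms instances of the estimates
        \<open>inW\<close> and \<open>app\<close>.\<close>
      define F where "F \<tau> = e (w + (h *\<^sub>R u + (\<tau> * h) *\<^sub>R v)) - e (w + (0 *\<^sub>R u + (\<tau> * h) *\<^sub>R v))" for \<tau>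
      define F' where "F' \<tau> = (G (w + (h *\<^sub>R u + (\<tau> * h) *\<^sub>R v)) - G (w + (0 *\<^sub>R u + (\<tau> * h) *\<^sub>R v))) \<bullet> (h *\<^sub>R v)" for \<tau>
      have "\<exists>z. 0 < z \<and> z < 1 \<and> F 1 - F 0 = (1 - 0) * F' z"
      proof (rule MVT2)
        fix \<tau> :: real assume \<tau>: "0 \<le> \<tau>" "\<tau> \<le> 1"
        have \<tau>h: "0 \<le> \<tau> * h" "\<tau> * h \<le> h" using \<tau> h by (auto simp: mult_left_le_one_le)
        have *: "((\<lambda>\<tau>. e (w + (a *\<^sub>R u + (\<tau> * h) *\<^sub>R v))) has_derivative (\<lambda>x. G (w + (a *\<^sub>R u + (\<tau> * h) *\<^sub>R v)) \<bullet> (x *\<^sub>R h *\<^sub>R v))) (at \<tau>)"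
          if "0 \<le> a" "a \<le> h" for a
          by (rule has_derivative_compose[of "\<lambda>\<tau>. w + (a *\<^sub>R u + (\<tau> * h) *\<^sub>R v)" "\<lambda>x. x *\<^sub>R h *\<^sub>R v"])
            (auto intro!: derivative_eq_intros e inW that \<tau>h)
        show "(F has_real_derivative F' \<tau>) (at \<tau>)"
          unfolding F_def has_field_derivative_def
          by (rule has_derivative_eq_rhs[OF has_derivative_diff[OF *[of h] *[of 0]]])
            (use h in \<open>auto simp: F'_def inner_diff_left algebra_simps\<close>)
      qed simp
      then obtain z where z: "0 < z" "z < 1" "F 1 - F 0 = F' z" by auto
      have zh: "0 \<le> z * h" "z * h \<le> h" using z h by (auto simp: mult_left_le_one_le)
      let ?r1 = "G (w + (h *\<^sub>R u + (z * h) *\<^sub>R v)) - G w - A (h *\<^sub>R u + (z * h) *\<^sub>R v)"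
      let ?r2 = "G (w + (0 *\<^sub>R u + (z * h) *\<^sub>R v)) - G w - A (0 *\<^sub>R u + (z * h) *\<^sub>R v)"
      have "F' z - h\<^sup>2 * (A u \<bullet> v) = h * ((?r1 - ?r2) \<bullet> v)"
        using lin by (simp add: F'_def linear_add linear_cmul inner_diff_left inner_add_left algebra_simps power2_eq_square)
      moreover have "\<bar>(?r1 - ?r2) \<bullet> v\<bar> \<le> (2 * (\<epsilon> * (h * (norm u + norm v)))) * norm v"
      proof -
        have "norm (?r1 - ?r2) \<le> 2 * (\<epsilon> * (h * (norm u + norm v)))"
          using norm_triangle_ineq4[of ?r1 ?r2] app[of h "z * h"] app[of 0 "z * h"] zh h by linarith
        then show ?thesis
          using Cauchy_Schwarz_ineq2[of "?r1 - ?r2" v] mult_right_mono[of "norm (?r1 - ?r2)" _ "norm v"] by (meson norm_ge_zero order.trans)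
      qed
      ultimately have "\<bar>F' z - h\<^sup>2 * (A u \<bullet> v)\<bar> \<le> h * ((2 * (\<epsilon> * (h * (norm u + norm v)))) * norm v)"
        using h by (simp add: abs_mult)
      also have "\<dots> = h\<^sup>2 * (2 * \<epsilon> * (norm u + norm v) * norm v)" by (simp add: power2_eq_square algebra_simps)
      finally show ?thesis unfolding z(3)[symmetric] by (simp add: F_def algebra_simps)
    qed
    ultimately show ?thesis by blast
  qed
  have "\<bar>A u \<bullet> v - A v \<bullet> u\<bar> \<le> 0 + e0" if "e0 > 0" for e0
  proof -
    define \<epsilon> where "\<epsilon> = e0 / (2 * (norm u + norm v)\<^sup>2 + 1)"
    have "2 * (norm u + norm v)\<^sup>2 + 1 > 0" by (simp add: add_nonneg_pos)
    then have \<epsilon>: "\<epsilon> > 0" "\<epsilon> * (2 * (norm u + norm v)\<^sup>2 + 1) = e0" using that by (auto simp: \<epsilon>_def)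
    obtain d1 where d1: "d1 > 0" "\<And>h. 0 < h \<Longrightarrow> h < d1 \<Longrightarrow>
      \<bar>e (w + h *\<^sub>R u + h *\<^sub>R v) - e (w + h *\<^sub>R u) - e (w + h *\<^sub>R v) + e w - h\<^sup>2 * (A u \<bullet> v)\<bar> \<le> h\<^sup>2 * (2 * \<epsilon> * (norm u + norm v) * norm v)"
      using half[OF \<epsilon>(1), of u v] by blast
    obtain d2 where d2: "d2 > 0" "\<And>h. 0 < h \<Longrightarrow> h < d2 \<Longrightarrow>
      \<bar>e (w + h *\<^sub>R v + h *\<^sub>R u) - e (w + h *\<^sub>R v) - e (w + h *\<^sub>R u) + e w - h\<^sup>2 * (A v \<bullet> u)\<bar> \<le> h\<^sup>2 * (2 * \<epsilon> * (norm v + norm u) * norm u)"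
      using half[OF \<epsilon>(1), of v u] by blast
    define h where "h = min d1 d2 / 2"
    have h: "0 < h" "h < d1" "h < d2" using d1(1) d2(1) by (auto simp: h_def min_def)
    have sw: "w + h *\<^sub>R v + h *\<^sub>R u = w + h *\<^sub>R u + h *\<^sub>R v" by (simp add: algebra_simps)
    have "\<bar>h\<^sup>2 * (A u \<bullet> v) - h\<^sup>2 * (A v \<bullet> u)\<bar> \<le> h\<^sup>2 * (2 * \<epsilon> * (norm u + norm v) * norm v) + h\<^sup>2 * (2 * \<epsilon> * (norm v + norm u) * norm u)"
      using d1(2)[OF h(1,2)] d2(2)[OF h(1,3)] unfolding sw by linarith
    also have "\<dots> = h\<^sup>2 * (\<epsilon> * (2 * (norm u + norm v)\<^sup>2))" by (simp add: algebra_simps power2_eq_square)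
    also have "\<dots> \<le> h\<^sup>2 * e0" unfolding \<epsilon>(2)[symmetric] using \<epsilon>(1) by (intro mult_left_mono) auto
    finally have "h\<^sup>2 * \<bar>A u \<bullet> v - A v \<bullet> u\<bar> \<le> h\<^sup>2 * e0" by (simp add: abs_mult flip: right_diff_distrib)
    then show ?thesis using h by simp
  qed
  then have "\<bar>A u \<bullet> v - A v \<bullet> u\<bar> \<le> 0" by (rule field_le_epsilon)
  then show ?thesis by simp
qed

section \<open>The localised proximal mapping\<close>

text \<open>Completing the square. The inner-product form is what \<open>s\<close>-monotonicity
  yields for displacements of the proximal mapping; the norm form is the one that passes through
  averages.\<close>

lemma norm_reflection_le_iff:
  fixes p d :: "'a::real_inner"
  assumes "\<kappa> > 0"
  shows "norm ((2 * \<kappa>) *\<^sub>R p - d) \<le> norm d \<longleftrightarrow> \<kappa> * (norm p)\<^sup>2 \<le> p \<bullet> d"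
proof -
  have "norm ((2 * \<kappa>) *\<^sub>R p - d) \<le> norm d \<longleftrightarrow> (norm ((2 * \<kappa>) *\<^sub>R p - d))\<^sup>2 \<le> (norm d)\<^sup>2"
    by (simp add: power_mono_iff)
  also have "(norm ((2 * \<kappa>) *\<^sub>R p - d))\<^sup>2 = 4 * \<kappa> * (\<kappa> * (norm p)\<^sup>2 - p \<bullet> d) + (norm d)\<^sup>2"
    unfolding power2_norm_eq_inner
    by (simp add: inner_diff_left inner_diff_right inner_commute[of d p] algebra_simps power2_eq_square)
  also have "\<dots> \<le> (norm d)\<^sup>2 \<longleftrightarrow> \<kappa> * (norm p)\<^sup>2 \<le> p \<bullet> d"
    using assms by (simp add: mult_le_0_iff)
  finally show ?thesis .
qed

text \<open>Exactly the part of the graph for which the prox-regularity inequality is postulated,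
  hence a single radius for points, subgradients and values of \<open>f\<close>.\<close>

definition attentive :: "('a::real_inner \<Rightarrow> ereal) \<Rightarrow> 'a \<Rightarrow> 'a \<Rightarrow> real \<Rightarrow> ('a \<times> 'a) set" where
  "attentive f xb xbs \<epsilon> = {(x, xs). (x, xs) \<in> gph_sub f \<and> f x < f xb + ereal \<epsilon> \<and> x \<in> ball xb \<epsilon> \<and> xs \<in> ball xbs \<epsilon>}"

text \<open>\<open>P\<close> is the proximal mapping of \<open>f\<close> with parameter \<open>\<mu>\<close>, localised near \<open>xb + \<mu> xbs\<close>;
  it parametrises the \<open>f\<close>-attentive localisation of the subdifferential.\<close>

locale prox_param =
  fixes f :: "'a::euclidean_space \<Rightarrow> ereal" and xb xbs :: 'a and \<epsilon> r \<mu> \<delta> :: real and P :: "'a \<Rightarrow> 'a"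
  assumes \<epsilon>: "\<epsilon> > 0" and r: "r \<ge> 0" and \<mu>: "\<mu> > 0" "\<mu> * r \<le> 1 / 2" and \<delta>: "\<delta> > 0"
    and ninf: "\<And>x. f x \<noteq> -\<infinity>" and fxb: "f xb \<noteq> \<infinity>" and base: "xbs \<in> lsub f xb"
    and prox: "\<And>x' x xs. x' \<in> ball xb \<epsilon> \<Longrightarrow> (x, xs) \<in> attentive f xb xbs \<epsilon> \<Longrightarrow>
        f x + ereal (xs \<bullet> (x' - x) - r / 2 * (norm (x' - x))\<^sup>2) \<le> f x'"
    and par: "\<And>w. w \<in> ball (xb + \<mu> *\<^sub>R xbs) \<delta> \<Longrightarrow> (P w, (w - P w) /\<^sub>R \<mu>) \<in> attentive f xb xbs \<epsilon>"
begin

abbreviation "wb \<equiv> xb + \<mu> *\<^sub>R xbs"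
abbreviation "\<Gamma> \<equiv> attentive f xb xbs \<epsilon>"
definition "G w = (w - P w) /\<^sub>R \<mu>"
text \<open>\<open>real_of_ereal\<close> sends infinity to 0, so \<open>\<phi>\<close> represents
  \<open>f\<close> only where \<open>f\<close> is finite; on \<open>\<Gamma>\<close> this is
  \<open>f_eq\<close>.\<close>

definition "\<phi> x = real_of_ereal (f x)"

lemma in_graph: "w \<in> ball wb \<delta> \<Longrightarrow> (P w, G w) \<in> \<Gamma>"
  using par by (simp add: G_def)

lemma f_xb: "f xb = ereal (\<phi> xb)"
  using ninf[of xb] fxb by (cases "f xb") (auto simp: \<phi>_def)

lemma f_eq: "(x, xs) \<in> \<Gamma> \<Longrightarrow> f x = ereal (\<phi> x)"
proof -
  assume "(x, xs) \<in> \<Gamma>"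
  then have "f x \<noteq> \<infinity>" using f_xb by (auto simp: attentive_def)
  then show "f x = ereal (\<phi> x)" using ninf[of x] by (cases "f x") (auto simp: \<phi>_def)
qed

lemma base_in: "(xb, xbs) \<in> \<Gamma>"
  using base \<epsilon> f_xb by (simp add: attentive_def gph_sub_def)

lemma prox_real:
  assumes "(x, xs) \<in> \<Gamma>" "(y, ys) \<in> \<Gamma>"
  shows "\<phi> x + xs \<bullet> (y - x) - r / 2 * (norm (y - x))\<^sup>2 \<le> \<phi> y"
  using prox[of y x xs] f_eq[OF assms(1)] f_eq[OF assms(2)] assms by (simp add: attentive_def)

text \<open>Adding the prox-regularity inequalities of the two points gives monotonicity up to
  \<open>- r\<close>; as \<open>\<mu> * r \<le> 1 / 2\<close>, at least half of the squared distance
  remains.\<close>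

lemma graph_strong_monotone:
  assumes "(x, xs) \<in> \<Gamma>" "(y, ys) \<in> \<Gamma>"
  shows "(norm (x - y))\<^sup>2 \<le> 2 * (((x + \<mu> *\<^sub>R xs) - (y + \<mu> *\<^sub>R ys)) \<bullet> (x - y))"
proof -
  have "xs \<bullet> (y - x) + ys \<bullet> (x - y) \<le> r * (norm (x - y))\<^sup>2"
    using prox_real[OF assms] prox_real[OF assms(2,1)] by (simp add: norm_minus_commute)
  then have m: "- r * (norm (x - y))\<^sup>2 \<le> (xs - ys) \<bullet> (x - y)"
    by (simp add: inner_diff_left inner_diff_right)
  have "((x + \<mu> *\<^sub>R xs) - (y + \<mu> *\<^sub>R ys)) \<bullet> (x - y) = (norm (x - y))\<^sup>2 + \<mu> * ((xs - ys) \<bullet> (x - y))"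
    unfolding power2_norm_eq_inner by (simp add: inner_diff_left inner_add_left algebra_simps)
  moreover have "\<mu> * (- r * (norm (x - y))\<^sup>2) \<le> \<mu> * ((xs - ys) \<bullet> (x - y))"
    using m \<mu> by (intro mult_left_mono) auto
  moreover have "\<mu> * r * (norm (x - y))\<^sup>2 \<le> 1 / 2 * (norm (x - y))\<^sup>2"
    using \<mu> by (intro mult_right_mono) auto
  ultimately show ?thesis by simp
qed

lemma graph_lipschitz:
  assumes "(x, xs) \<in> \<Gamma>" "(y, ys) \<in> \<Gamma>"
  shows "norm (x - y) \<le> 2 * norm ((x + \<mu> *\<^sub>R xs) - (y + \<mu> *\<^sub>R ys))"
proof (cases "x = y")
  case False
  have "norm (x - y) * norm (x - y) \<le> 2 * (norm ((x + \<mu> *\<^sub>R xs) - (y + \<mu> *\<^sub>R ys)) * norm (x - y))"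
    using graph_strong_monotone[OF assms] norm_cauchy_schwarz[of "(x + \<mu> *\<^sub>R xs) - (y + \<mu> *\<^sub>R ys)" "x - y"]
    by (simp add: power2_eq_square)
  then show ?thesis using False by (simp flip: mult.assoc)
qed simp

lemma P_G: "P w + \<mu> *\<^sub>R G w = w"
  using \<mu> by (simp add: G_def)

text \<open>By the Lipschitz estimate \<open>x + \<mu> *\<^sub>R xs\<close> is injective on
  \<open>\<Gamma>\<close>, so membership in \<open>\<Gamma>\<close> already determines
  \<open>P\<close>.\<close>

lemma P_eq:
  assumes "(x, xs) \<in> \<Gamma>" "x + \<mu> *\<^sub>R xs \<in> ball wb \<delta>"
  shows "P (x + \<mu> *\<^sub>R xs) = x" "G (x + \<mu> *\<^sub>R xs) = xs"
proof -
  show *: "P (x + \<mu> *\<^sub>R xs) = x"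
    using graph_lipschitz[OF in_graph[OF assms(2)] assms(1)] unfolding P_G by simp
  show "G (x + \<mu> *\<^sub>R xs) = xs" using \<mu> by (simp add: G_def *)
qed

lemma P_lip: "w \<in> ball wb \<delta> \<Longrightarrow> w' \<in> ball wb \<delta> \<Longrightarrow> norm (P w - P w') \<le> 2 * norm (w - w')"
  using graph_lipschitz[OF in_graph in_graph] unfolding P_G by blast

lemma G_lip:
  assumes "w \<in> ball wb \<delta>" "w' \<in> ball wb \<delta>"
  shows "norm (G w - G w') \<le> 3 / \<mu> * norm (w - w')"
proof -
  have eq: "G w - G w' = ((w - w') - (P w - P w')) /\<^sub>R \<mu>"
    by (simp add: G_def scaleR_diff_right)
  have "norm (G w - G w') = norm ((w - w') - (P w - P w')) / \<mu>"
    unfolding eq norm_scaleR using \<mu>(1) by (simp add: divide_simps)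
  also have "\<dots> \<le> 3 * norm (w - w') / \<mu>"
    using P_lip[OF assms] norm_triangle_ineq4[of "w - w'" "P w - P w'"] \<mu> by (intro divide_right_mono) auto
  finally show ?thesis by simp
qed

lemma P_wb: "P wb = xb" "G wb = xbs"
  using P_eq[OF base_in] \<delta> by auto

text \<open>Prox-regularity is used from both sides, with slopes bounded on \<open>\<Gamma>\<close>.
  In consequence, convergence of parameters alone implies convergence of the values of
  \<open>f\<close>, that is, \<open>f\<close>-attentive convergence.\<close>

lemma graph_phi_lipschitz:
  assumes "(x, xs) \<in> \<Gamma>" "(y, ys) \<in> \<Gamma>"
  shows "\<bar>\<phi> x - \<phi> y\<bar> \<le> (norm xbs + \<epsilon> + r * \<epsilon>) * norm (x - y)"
proof -
  have half: "\<phi> y - \<phi> x \<le> (norm xbs + \<epsilon> + r * \<epsilon>) * norm (x - y)" if "(x, xs) \<in> \<Gamma>" "(y, ys) \<in> \<Gamma>" for x xs y ys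
  proof -
    have xy: "x \<in> ball xb \<epsilon>" "y \<in> ball xb \<epsilon>" "ys \<in> ball xbs \<epsilon>" using that by (auto simp: attentive_def)
    have "norm (x - y) \<le> 2 * \<epsilon>"
      using xy dist_triangle[of x y xb] dist_commute[of x xb] unfolding mem_ball dist_norm[symmetric] by linarith
    then have "norm (x - y) * norm (x - y) \<le> 2 * \<epsilon> * norm (x - y)" by (intro mult_right_mono) auto
    then have 1: "r / 2 * (norm (x - y))\<^sup>2 \<le> r * \<epsilon> * norm (x - y)"
      using r mult_left_mono[of "norm (x - y) * norm (x - y)" "2 * \<epsilon> * norm (x - y)" "r / 2"] by (simp add: power2_eq_square mult_ac)
    have "norm ys \<le> norm xbs + \<epsilon>"
      using xy norm_triangle_ineq2[of ys xbs] dist_commute[of xbs ys] unfolding mem_ball dist_norm[symmetric] by linarith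
    then have "norm ys * norm (x - y) \<le> (norm xbs + \<epsilon>) * norm (x - y)" by (intro mult_right_mono) auto
    then have 2: "- (ys \<bullet> (x - y)) \<le> (norm xbs + \<epsilon>) * norm (x - y)"
      using Cauchy_Schwarz_ineq2[of ys "x - y"] by linarith
    show ?thesis using prox_real[OF that(2,1)] 1 2 by (simp add: distrib_right)
  qed
  show ?thesis using half[OF assms] half[OF assms(2,1)] by (simp add: norm_minus_commute abs_le_iff)
qed

lemma P_tendsto:
  assumes "\<And>k. wk k \<in> ball wb \<delta>" "wk \<longlonglongrightarrow> w" "w \<in> ball wb \<delta>"
  shows "(\<lambda>k. P (wk k)) \<longlonglongrightarrow> P w" "(\<lambda>k. G (wk k)) \<longlonglongrightarrow> G w" "(\<lambda>k. f (P (wk k))) \<longlonglongrightarrow> f (P w)"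
proof -
  have z: "(\<lambda>k. norm (wk k - w)) \<longlonglongrightarrow> 0" using assms(2) by (simp add: LIM_zero tendsto_norm_zero)
  show P: "(\<lambda>k. P (wk k)) \<longlonglongrightarrow> P w"
  proof (rule Lim_null_comparison[THEN LIM_zero_cancel])
    show "\<forall>\<^sub>F k in sequentially. norm (P (wk k) - P w) \<le> 2 * norm (wk k - w)"
      by (intro always_eventually allI P_lip assms)
    show "(\<lambda>k. 2 * norm (wk k - w)) \<longlonglongrightarrow> 0" using z by (rule tendsto_mult_right_zero)
  qed
  show "(\<lambda>k. G (wk k)) \<longlonglongrightarrow> G w"
    unfolding G_def by (intro tendsto_intros P assms)
  have "(\<lambda>k. \<phi> (P (wk k))) \<longlonglongrightarrow> \<phi> (P w)"
  proof (rule Lim_null_comparison[THEN LIM_zero_cancel])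
    show "\<forall>\<^sub>F k in sequentially. norm (\<phi> (P (wk k)) - \<phi> (P w)) \<le> (norm xbs + \<epsilon> + r * \<epsilon>) * norm (P (wk k) - P w)"
      unfolding real_norm_def
      by (intro always_eventually allI graph_phi_lipschitz[OF in_graph in_graph] assms)
    show "(\<lambda>k. (norm xbs + \<epsilon> + r * \<epsilon>) * norm (P (wk k) - P w)) \<longlonglongrightarrow> 0"
      using P by (intro tendsto_mult_right_zero tendsto_norm_zero LIM_zero)
  qed
  then show "(\<lambda>k. f (P (wk k))) \<longlonglongrightarrow> f (P w)"
    using f_eq[OF in_graph] assms by simp
qed

text \<open>Since \<open>w\<close> is \<open>P w + \<mu> *\<^sub>R G w\<close>, a limit for the
  quotients of \<open>P\<close> determines the one for \<open>G\<close>. Convergence along one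
  sequence of steps suffices, so the lemma also serves points where \<open>P\<close> is not
  differentiable.\<close>

lemma tangent_of_curve:
  assumes w: "w \<in> ball wb \<delta>" and t: "\<And>k. t k > 0" "t \<longlonglongrightarrow> 0" and in_ball: "\<And>k. w + t k *\<^sub>R d \<in> ball wb \<delta>"
    and u: "(\<lambda>k. (1 / t k) *\<^sub>R (P (w + t k *\<^sub>R d) - P w)) \<longlonglongrightarrow> u"
  shows "(u, (d - u) /\<^sub>R \<mu>) \<in> tangent_f f (P w, G w)"
proof -
  define p where "p k = (P (w + t k *\<^sub>R d), G (w + t k *\<^sub>R d))" for k
  have lim: "(\<lambda>k. w + t k *\<^sub>R d) \<longlonglongrightarrow> w" using t by (auto intro!: tendsto_eq_intros)
  have "f_att_conv f p (P w, G w)"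
    unfolding f_att_conv_def p_def fst_conv
  proof (intro conjI allI tendsto_Pair P_tendsto[OF in_ball lim w])
    show "(P (w + t k *\<^sub>R d), G (w + t k *\<^sub>R d)) \<in> gph_sub f" for k
      using in_graph[OF in_ball[of k]] by (simp add: attentive_def)
  qed
  moreover have "(\<lambda>k. (1 / t k) *\<^sub>R (p k - (P w, G w))) \<longlonglongrightarrow> (u, (d - u) /\<^sub>R \<mu>)"
  proof -
    have "(1 / t k) *\<^sub>R (G (w + t k *\<^sub>R d) - G w) = (d - (1 / t k) *\<^sub>R (P (w + t k *\<^sub>R d) - P w)) /\<^sub>R \<mu>" for k
      using t(1)[of k] by (simp add: G_def algebra_simps)
    then have "(\<lambda>k. (1 / t k) *\<^sub>R (G (w + t k *\<^sub>R d) - G w)) \<longlonglongrightarrow> (d - u) /\<^sub>R \<mu>"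
      by (simp only:) (intro tendsto_intros u)
    with u show ?thesis by (auto simp: p_def intro!: tendsto_Pair)
  qed
  ultimately show ?thesis using t unfolding tangent_f_def by blast
qed

lemma small_steps:
  assumes "w \<in> ball wb \<delta>"
  obtains t where "\<And>k. t k > (0::real)" "t \<longlonglongrightarrow> 0" "\<And>k. w + t k *\<^sub>R d \<in> ball wb \<delta>"
proof -
  obtain \<rho> where \<rho>: "\<rho> > 0" "ball w \<rho> \<subseteq> ball wb \<delta>" using openE[OF open_ball assms] by blast
  define c where "c = \<rho> / (norm d + 1)"
  have n: "norm d + 1 > 0" by (simp add: add_nonneg_pos)
  then have "c > 0" using \<rho> by (simp add: c_def)
  show ?thesis
  proof (rule that[of "\<lambda>k. c * inverse (real (Suc k))"])
    show "c * inverse (real (Suc k)) > 0" for k using \<open>c > 0\<close> by simp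
    show "(\<lambda>k. c * inverse (real (Suc k))) \<longlonglongrightarrow> 0"
      using tendsto_mult_right_zero[OF LIMSEQ_inverse_real_of_nat] .
    fix k
    have "inverse (real (Suc k)) \<le> 1" by (simp add: inverse_le_1_iff)
    then have "c * inverse (real (Suc k)) * norm d \<le> c * norm d"
      using \<open>c > 0\<close> by (simp add: mult_left_le mult_right_mono)
    also have "\<dots> < \<rho>" using n \<rho> by (simp add: c_def field_simps)
    finally have "w + (c * inverse (real (Suc k))) *\<^sub>R d \<in> ball w \<rho>"
      using \<open>c > 0\<close> by (simp add: dist_commute[of w] dist_norm)
    then show "w + (c * inverse (real (Suc k))) *\<^sub>R d \<in> ball wb \<delta>" using \<rho>(2) by blast
  qed
qed

text \<open>An \<open>f\<close>-attentive sequence in the graph eventually enters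
  \<open>\<Gamma>\<close>, where it is the image of its parameters \<open>wk\<close>; so every
  tangent comes from a curve of parameters. The direction is recovered from the pair as
  \<open>u + \<mu> *\<^sub>R us\<close>.\<close>

lemma tangent_eq_range:
  assumes w: "w \<in> ball wb \<delta>" and B: "(P has_derivative B) (at w)"
  shows "tangent_f f (P w, G w) = range (\<lambda>d. (B d, (d - B d) /\<^sub>R \<mu>))"
proof -
  have lin: "bounded_linear B" using B by (rule has_derivative_bounded_linear)
  \<comment> \<open>Parameters of a graph sequence need not lie on a line, so the derivative is
    taken along any \<open>wk\<close> whose difference quotients converge.\<close>
  have quot: "(\<lambda>k. (1 / t k) *\<^sub>R (P (wk k) - P w)) \<longlonglongrightarrow> B d"
    if t: "\<And>k. t k > 0" and wk: "wk \<longlonglongrightarrow> w" and d: "(\<lambda>k. (1 / t k) *\<^sub>R (wk k - w)) \<longlonglongrightarrow> d" for t wk d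
  proof -
    have "Bseq (\<lambda>k. (1 / t k) *\<^sub>R (wk k - w))" using d by (intro convergent_imp_Bseq convergentI)
    then obtain M where M: "M > 0" "\<And>k. norm ((1 / t k) *\<^sub>R (wk k - w)) \<le> M" by (auto simp: Bseq_def)
    have "(\<lambda>k. (1 / t k) *\<^sub>R (P (wk k) - P w - B (wk k - w))) \<longlonglongrightarrow> 0"
    proof (rule tendstoI)
      fix e :: real assume "e > 0"
      define e' where "e' = e / (2 * M)"
      have e': "e' > 0" "e' * M < e" using \<open>e > 0\<close> M by (auto simp: e'_def)
      obtain d0 where d0: "d0 > 0" "\<And>y. norm (y - w) < d0 \<Longrightarrow> norm (P y - P w - B (y - w)) \<le> e' * norm (y - w)"
        using B e'(1) unfolding has_derivative_at_alt by blast
      have "\<forall>\<^sub>F k in sequentially. dist (wk k) w < d0" using tendstoD[OF wk d0(1)] .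
      then show "\<forall>\<^sub>F k in sequentially. dist ((1 / t k) *\<^sub>R (P (wk k) - P w - B (wk k - w))) 0 < e"
      proof (rule eventually_mono)
        fix k assume "dist (wk k) w < d0"
        then have "norm (P (wk k) - P w - B (wk k - w)) \<le> e' * norm (wk k - w)" using d0(2) by (simp add: dist_norm)
        then have "norm ((1 / t k) *\<^sub>R (P (wk k) - P w - B (wk k - w))) \<le> e' * norm ((1 / t k) *\<^sub>R (wk k - w))"
          unfolding norm_scaleR using t[of k] by (simp add: divide_right_mono)
        also have "\<dots> \<le> e' * M" using M(2)[of k] e'(1) by (intro mult_left_mono) auto
        finally show "dist ((1 / t k) *\<^sub>R (P (wk k) - P w - B (wk k - w))) 0 < e" using e'(2) by simp
      qed
    qed
    moreover have "(\<lambda>k. B ((1 / t k) *\<^sub>R (wk k - w))) \<longlonglongrightarrow> B d"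
      by (rule bounded_linear.tendsto[OF lin d])
    ultimately have "(\<lambda>k. (1 / t k) *\<^sub>R (P (wk k) - P w - B (wk k - w)) + B ((1 / t k) *\<^sub>R (wk k - w))) \<longlonglongrightarrow> 0 + B d"
      by (rule tendsto_add)
    moreover have "(1 / t k) *\<^sub>R (P (wk k) - P w - B (wk k - w)) + B ((1 / t k) *\<^sub>R (wk k - w)) = (1 / t k) *\<^sub>R (P (wk k) - P w)" for k
      using linear_cmul[OF bounded_linear.linear[OF lin], of "1 / t k" "wk k - w"] by (simp only: scaleR_diff_right) simp
    ultimately show ?thesis by simp
  qed
  show ?thesis
  proof (intro equalityI subsetI)
    fix x assume "x \<in> range (\<lambda>d. (B d, (d - B d) /\<^sub>R \<mu>))"
    then obtain d where x: "x = (B d, (d - B d) /\<^sub>R \<mu>)" by blast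
    obtain t where t: "\<And>k. t k > 0" "t \<longlonglongrightarrow> 0" "\<And>k. w + t k *\<^sub>R d \<in> ball wb \<delta>" using small_steps[OF w] by blast
    have "(\<lambda>k. (1 / t k) *\<^sub>R (P (w + t k *\<^sub>R d) - P w)) \<longlonglongrightarrow> B d"
    proof (rule quot)
      show "(\<lambda>k. w + t k *\<^sub>R d) \<longlonglongrightarrow> w" using t(2) by (auto intro!: tendsto_eq_intros)
      have "(1 / t k) *\<^sub>R (w + t k *\<^sub>R d - w) = d" for k using t(1)[of k] by simp
      then show "(\<lambda>k. (1 / t k) *\<^sub>R (w + t k *\<^sub>R d - w)) \<longlonglongrightarrow> d" by simp
    qed (rule t(1))
    then show "x \<in> tangent_f f (P w, G w)" unfolding x by (rule tangent_of_curve[OF w t])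
  next
    fix x assume "x \<in> tangent_f f (P w, G w)"
    moreover obtain u us where x: "x = (u, us)" by (cases x)
    ultimately obtain t p where t: "\<And>k. t k > 0" "t \<longlonglongrightarrow> 0" and p: "f_att_conv f p (P w, G w)"
      and lim: "(\<lambda>k. (1 / t k) *\<^sub>R (p k - (P w, G w))) \<longlonglongrightarrow> (u, us)" unfolding tangent_f_def by blast
    have pl: "(\<lambda>k. fst (p k)) \<longlonglongrightarrow> P w" "(\<lambda>k. snd (p k)) \<longlonglongrightarrow> G w"
      using p tendsto_fst[of p] tendsto_snd[of p] by (auto simp: f_att_conv_def)
    have u: "(\<lambda>k. (1 / t k) *\<^sub>R (fst (p k) - P w)) \<longlonglongrightarrow> u"
      using tendsto_fst[OF lim] by simp
    have us: "(\<lambda>k. (1 / t k) *\<^sub>R (snd (p k) - G w)) \<longlonglongrightarrow> us"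
      using tendsto_snd[OF lim] by simp
    define wk where "wk k = fst (p k) + \<mu> *\<^sub>R snd (p k)" for k
    have wk: "wk \<longlonglongrightarrow> w"
      using tendsto_add[OF pl(1) tendsto_scaleR[OF tendsto_const[of \<mu>] pl(2)]] unfolding wk_def[abs_def] P_G .
    have "(1 / t k) *\<^sub>R (wk k - w) = (1 / t k) *\<^sub>R (fst (p k) - P w) + \<mu> *\<^sub>R ((1 / t k) *\<^sub>R (snd (p k) - G w))" for k
      by (subst (1) P_G[of w, symmetric]) (simp add: wk_def algebra_simps)
    then have d: "(\<lambda>k. (1 / t k) *\<^sub>R (wk k - w)) \<longlonglongrightarrow> u + \<mu> *\<^sub>R us"
      by (simp only:) (intro tendsto_intros u us)
    note q = quot[OF t(1) wk d]
    have PG: "(P w, G w) \<in> \<Gamma>" by (rule in_graph[OF w])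
    have e1: "\<forall>\<^sub>F k in sequentially. f (fst (p k)) < f xb + ereal \<epsilon>"
      using p PG by (intro order_tendstoD(2)[of _ "f (P w)"]) (auto simp: f_att_conv_def attentive_def)
    have e2: "\<forall>\<^sub>F k in sequentially. fst (p k) \<in> ball xb \<epsilon>"
      by (rule topological_tendstoD[OF pl(1) open_ball]) (use PG in \<open>simp add: attentive_def\<close>)
    have e3: "\<forall>\<^sub>F k in sequentially. snd (p k) \<in> ball xbs \<epsilon>"
      by (rule topological_tendstoD[OF pl(2) open_ball]) (use PG in \<open>simp add: attentive_def\<close>)
    have e4: "\<forall>\<^sub>F k in sequentially. wk k \<in> ball wb \<delta>"
      by (rule topological_tendstoD[OF wk open_ball w])
    have "\<forall>\<^sub>F k in sequentially. (1 / t k) *\<^sub>R (P (wk k) - P w) = (1 / t k) *\<^sub>R (fst (p k) - P w)"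
      using e1 e2 e3 e4
    proof eventually_elim
      case (elim k)
      have "p k \<in> gph_sub f" using p by (simp add: f_att_conv_def)
      then have "(fst (p k), snd (p k)) \<in> \<Gamma>" using elim by (cases "p k") (simp add: attentive_def)
      from P_eq(1)[OF this] elim(4) show ?case by (simp add: wk_def)
    qed
    then have "(\<lambda>k. (1 / t k) *\<^sub>R (fst (p k) - P w)) \<longlonglongrightarrow> B (u + \<mu> *\<^sub>R us)"
      using q by (rule Lim_transform_eventually[rotated])
    with u have "u = B (u + \<mu> *\<^sub>R us)" by (rule LIMSEQ_unique)
    then show "x \<in> range (\<lambda>d. (B d, (d - B d) /\<^sub>R \<mu>))"
      using \<mu> by (intro image_eqI[of _ _ "u + \<mu> *\<^sub>R us"]) (auto simp: x)
  qed
qed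

text \<open>\<open>env\<close> is the Moreau envelope of \<open>f\<close>, written at its minimiser; its gradient is \<open>G\<close>.\<close>

definition "env w = \<phi> (P w) + \<mu> / 2 * (norm (G w))\<^sup>2"

text \<open>Expanding \<open>norm (x - w)\<close> about \<open>P w\<close> turns the left-hand side
  into the parabola of curvature \<open>- 1 / \<mu>\<close> with value \<open>\<phi> (P w)\<close>
  and slope \<open>G w\<close> at \<open>P w\<close>. The prox-regularity parabola has curvature
  \<open>- r\<close>, which is no smaller because \<open>\<mu> * r \<le> 1\<close>.\<close>

lemma env_minorant_real:
  shows "env w - (norm (x - w))\<^sup>2 / (2 * \<mu>) \<le> \<phi> (P w) + G w \<bullet> (x - P w) - r / 2 * (norm (x - P w))\<^sup>2"
proof -
  have xw: "x - w = (x - P w) - \<mu> *\<^sub>R G w" by (subst (1) P_G[of w, symmetric]) (simp add: algebra_simps)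
  have sq: "(norm (y - \<mu> *\<^sub>R z))\<^sup>2 = (norm y)\<^sup>2 - 2 * \<mu> * (z \<bullet> y) + \<mu> * (\<mu> * (norm z)\<^sup>2)" for y z :: 'a
    unfolding power2_norm_eq_inner by (simp add: inner_diff_left inner_diff_right inner_commute algebra_simps)
  have "(norm (x - w))\<^sup>2 = (norm (x - P w))\<^sup>2 - 2 * \<mu> * (G w \<bullet> (x - P w)) + \<mu> * (\<mu> * (norm (G w))\<^sup>2)"
    unfolding xw by (rule sq)
  then have "(norm (x - w))\<^sup>2 / (2 * \<mu>) = (norm (x - P w))\<^sup>2 / (2 * \<mu>) - G w \<bullet> (x - P w) + \<mu> / 2 * (norm (G w))\<^sup>2"
    using \<mu> by (simp add: field_simps)
  moreover have "r / 2 * (norm (x - P w))\<^sup>2 \<le> (norm (x - P w))\<^sup>2 / (2 * \<mu>)"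
  proof -
    have "\<mu> * r * (norm (x - P w))\<^sup>2 \<le> 1 * (norm (x - P w))\<^sup>2" using \<mu> by (intro mult_right_mono) auto
    then show ?thesis using \<mu> by (simp add: field_simps)
  qed
  ultimately show ?thesis by (simp add: env_def)
qed

lemma env_minorant:
  assumes "w \<in> ball wb \<delta>" "x \<in> ball xb \<epsilon>"
  shows "ereal (env w - (norm (x - w))\<^sup>2 / (2 * \<mu>)) \<le> f x"
proof -
  have "ereal (env w - (norm (x - w))\<^sup>2 / (2 * \<mu>)) \<le> ereal (\<phi> (P w) + (G w \<bullet> (x - P w) - r / 2 * (norm (x - P w))\<^sup>2))"
    using env_minorant_real[of w x] by simp
  also have "\<dots> \<le> f x"
    using prox[OF assms(2) in_graph[OF assms(1)]] f_eq[OF in_graph[OF assms(1)]] by simp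
  finally show ?thesis .
qed

text \<open>The minorant belonging to \<open>w'\<close> is evaluated at \<open>P w\<close>, where
  the value of \<open>f\<close> is known.\<close>

lemma env_upper:
  assumes "w \<in> ball wb \<delta>" "w' \<in> ball wb \<delta>"
  shows "env w' \<le> env w + G w \<bullet> (w' - w) + (norm (w' - w))\<^sup>2 / (2 * \<mu>)"
proof -
  have "P w \<in> ball xb \<epsilon>" using in_graph[OF assms(1)] by (simp add: attentive_def)
  then have "env w' - (norm (P w - w'))\<^sup>2 / (2 * \<mu>) \<le> \<phi> (P w)"
    using env_minorant[OF assms(2), of "P w"] f_eq[OF in_graph[OF assms(1)]] by simp
  moreover have "P w - w' = - (\<mu> *\<^sub>R G w + (w' - w))" using P_G[of w] by (simp add: algebra_simps)
  then have "(norm (P w - w'))\<^sup>2 = \<mu> * (\<mu> * (norm (G w))\<^sup>2) + 2 * \<mu> * (G w \<bullet> (w' - w)) + (norm (w' - w))\<^sup>2"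
    unfolding power2_norm_eq_inner by (simp only: inner_minus_left inner_minus_right) (simp add: inner_add_left inner_add_right inner_commute algebra_simps)
  then have "(norm (P w - w'))\<^sup>2 / (2 * \<mu>) = \<mu> / 2 * (norm (G w))\<^sup>2 + G w \<bullet> (w' - w) + (norm (w' - w))\<^sup>2 / (2 * \<mu>)"
    using \<mu> by (simp add: field_simps)
  ultimately show ?thesis by (simp add: env_def)
qed

text \<open>Exchanging the two points in \<open>env_upper\<close> gives the matching lower estimate
  with slope \<open>G y\<close>; the Lipschitz bound replaces that slope by \<open>G w\<close> at
  quadratic cost.\<close>

lemma env_has_derivative:
  assumes w: "w \<in> ball wb \<delta>"
  shows "(env has_derivative (\<lambda>h. G w \<bullet> h)) (at w)"
  unfolding has_derivative_at_alt
proof (intro conjI allI impI)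
  show "bounded_linear ((\<bullet>) (G w))" by (rule bounded_linear_inner_right)
  fix e :: real assume "e > 0"
  obtain \<rho> where \<rho>: "\<rho> > 0" "ball w \<rho> \<subseteq> ball wb \<delta>" using openE[OF open_ball assms] by blast
  \<comment> \<open>The constant is \<open>3 / \<mu>\<close> from \<open>G_lip\<close> plus
    \<open>1 / \<mu>\<close>, which majorises the coefficient
    \<open>1 / (2 * \<mu>)\<close>.\<close>
  have bd: "\<bar>env y - env w - G w \<bullet> (y - w)\<bar> \<le> 4 / \<mu> * (norm (y - w))\<^sup>2" if y: "y \<in> ball wb \<delta>" for y
  proof -
    have n: "norm (w - y) = norm (y - w)" by (rule norm_minus_commute)
    have "(G y - G w) \<bullet> (w - y) \<le> norm (G y - G w) * norm (w - y)" by (rule norm_cauchy_schwarz)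
    also have "\<dots> \<le> 3 / \<mu> * norm (y - w) * norm (y - w)"
      unfolding n using G_lip[OF y w] by (intro mult_right_mono) auto
    finally have 1: "(G y - G w) \<bullet> (w - y) \<le> 3 / \<mu> * (norm (y - w))\<^sup>2" by (simp add: power2_eq_square)
    have 2: "(norm (y - w))\<^sup>2 / (2 * \<mu>) \<le> 1 / \<mu> * (norm (y - w))\<^sup>2" using \<mu> by (simp add: field_simps)
    have "G y \<bullet> (w - y) = (G y - G w) \<bullet> (w - y) - G w \<bullet> (y - w)" by (simp add: inner_diff_left inner_diff_right)
    then have "env w \<le> env y - G w \<bullet> (y - w) + 4 / \<mu> * (norm (y - w))\<^sup>2"
      using env_upper[OF y w] 1 2 unfolding n by (simp add: field_simps)
    moreover have "env y \<le> env w + G w \<bullet> (y - w) + 4 / \<mu> * (norm (y - w))\<^sup>2"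
    proof -
      have "1 / \<mu> * (norm (y - w))\<^sup>2 \<le> 4 / \<mu> * (norm (y - w))\<^sup>2" using \<mu> by (intro mult_right_mono) (auto simp: divide_right_mono)
      then show ?thesis using env_upper[OF w y] 2 by linarith
    qed
    ultimately show ?thesis by linarith
  qed
  show "\<exists>d>0. \<forall>y. norm (y - w) < d \<longrightarrow> norm (env y - env w - G w \<bullet> (y - w)) \<le> e * norm (y - w)"
  proof (intro exI[of _ "min \<rho> (e * \<mu> / 4)"] conjI allI impI)
    show "0 < min \<rho> (e * \<mu> / 4)" using \<rho> \<mu> \<open>e > 0\<close> by simp
    fix y assume y: "norm (y - w) < min \<rho> (e * \<mu> / 4)"
    then have "y \<in> ball w \<rho>" by (simp add: dist_norm norm_minus_commute)
    then have "norm (env y - env w - G w \<bullet> (y - w)) \<le> 4 / \<mu> * norm (y - w) * norm (y - w)"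
      using bd[of y] \<rho>(2) by (auto simp: power2_eq_square mult.assoc)
    also have "\<dots> \<le> e * norm (y - w)" using y \<mu> by (intro mult_right_mono) (auto simp: field_simps)
    finally show "norm (env y - env w - G w \<bullet> (y - w)) \<le> e * norm (y - w)" .
  qed
qed

lemma P_derivative_symmetric:
  assumes w: "w \<in> ball wb \<delta>" and B: "(P has_derivative B) (at w)"
  shows "B u \<bullet> v = B v \<bullet> u"
proof -
  have "(G has_derivative (\<lambda>h. (h - B h) /\<^sub>R \<mu>)) (at w)"
    unfolding G_def[abs_def] by (intro derivative_intros B)
  from symmetric_gradient_derivative[OF open_ball w env_has_derivative this, of u v]
  have "((u - B u) /\<^sub>R \<mu>) \<bullet> v = ((v - B v) /\<^sub>R \<mu>) \<bullet> u" .
  then have "(u - B u) \<bullet> v = (v - B v) \<bullet> u" using \<mu> by simp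
  then show ?thesis by (simp add: inner_diff_left inner_commute[of u v])
qed

end

section \<open>Nonexpansive reflections, quadratic minorants and coderivatives\<close>

context prox_param
begin

text \<open>Continuity at \<open>wb\<close> of \<open>P\<close>, of \<open>G\<close> and of the
  values of \<open>f\<close> along \<open>P\<close>, in neighbourhood form. A bad parameter in every
  ball of radius \<open>\<delta> * inverse (real (Suc k))\<close> would contradict
  \<open>P_tendsto\<close>.\<close>

lemma graph_near_base:
  assumes "open U" "open V" "xb \<in> U" "xbs \<in> V" "f xb < ereal \<rho>"
  obtains \<delta>' where "0 < \<delta>'" "\<delta>' \<le> \<delta>" "\<And>w. w \<in> ball wb \<delta>' \<Longrightarrow> (P w, G w) \<in> gph_sub_rho f \<rho> \<inter> (U \<times> V)"
proof (rule ccontr)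
  note goal = that
  assume nt: "\<not> thesis"
  have neg: "\<exists>w. w \<in> ball wb \<delta>' \<and> (P w, G w) \<notin> gph_sub_rho f \<rho> \<inter> (U \<times> V)" if \<delta>': "0 < \<delta>'" "\<delta>' \<le> \<delta>" for \<delta>'
  proof (rule ccontr)
    assume "\<not> ?thesis"
    then have "(P w, G w) \<in> gph_sub_rho f \<rho> \<inter> (U \<times> V)" if "w \<in> ball wb \<delta>'" for w using that by blast
    then show False using nt goal[OF \<delta>'] by blast
  qed
  have "\<delta> * inverse (real (Suc k)) \<le> \<delta>" for k
    using \<delta> by (simp add: mult_left_le inverse_le_1_iff)
  then have "\<forall>k. \<exists>w. w \<in> ball wb (\<delta> * inverse (real (Suc k))) \<and> (P w, G w) \<notin> gph_sub_rho f \<rho> \<inter> (U \<times> V)"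
    using neg \<delta> by simp
  from choice[OF this] obtain wk where wk: "\<And>k. wk k \<in> ball wb (\<delta> * inverse (real (Suc k)))"
    "\<And>k. (P (wk k), G (wk k)) \<notin> gph_sub_rho f \<rho> \<inter> (U \<times> V)" by blast
  have in\<delta>: "wk k \<in> ball wb \<delta>" for k
    using wk(1)[of k] \<open>\<And>k. \<delta> * inverse (real (Suc k)) \<le> \<delta>\<close>[of k] by (metis ball_subset_ball_iff less_eq_real_def subset_ball subsetD)
  have "wk \<longlonglongrightarrow> wb"
  proof (rule metric_tendsto_imp_tendsto)
    show "(\<lambda>k. \<delta> * inverse (real (Suc k))) \<longlonglongrightarrow> 0" using tendsto_mult_right_zero[OF LIMSEQ_inverse_real_of_nat] .
    show "\<forall>\<^sub>F k in sequentially. dist (wk k) wb \<le> dist (\<delta> * inverse (real (Suc k))) 0"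
      using wk(1) \<delta> by (intro always_eventually allI) (simp add: dist_commute less_imp_le)
  qed
  from P_tendsto[OF in\<delta> this] \<delta>
  have lim: "(\<lambda>k. P (wk k)) \<longlonglongrightarrow> xb" "(\<lambda>k. G (wk k)) \<longlonglongrightarrow> xbs" "(\<lambda>k. f (P (wk k))) \<longlonglongrightarrow> f xb"
    by (auto simp: P_wb)
  have "\<forall>\<^sub>F k in sequentially. P (wk k) \<in> U \<and> G (wk k) \<in> V \<and> f (P (wk k)) < ereal \<rho>"
    using topological_tendstoD[OF lim(1)] topological_tendstoD[OF lim(2)] order_tendstoD(2)[OF lim(3)] assms
    by (auto intro!: eventually_conj)
  then obtain k where "P (wk k) \<in> U" "G (wk k) \<in> V" "f (P (wk k)) < ereal \<rho>"
    using eventually_happens' sequentially_bot by blast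
  moreover have "(P (wk k), G (wk k)) \<in> gph_sub f" using in_graph[OF in\<delta>[of k]] by (simp add: attentive_def)
  ultimately show False using wk(2)[of k] by (simp add: gph_sub_rho_def gph_sub_def)
qed

text \<open>Counterpart of \<open>graph_near_base\<close>: it ensures that no graph point near the
  base pair is missed by the parameters.\<close>

lemma graph_parametrised:
  assumes \<delta>': "0 < \<delta>'" "\<delta>' \<le> \<delta>"
  obtains \<eta> where "0 < \<eta>" "\<eta> \<le> \<epsilon>" "\<eta> \<le> \<delta>'" "\<And>x xs. x \<in> ball xb \<eta> \<Longrightarrow> xs \<in> ball xbs \<eta> \<Longrightarrow> x + \<mu> *\<^sub>R xs \<in> ball wb \<delta>'"
    "\<And>x xs. (x, xs) \<in> gph_sub_rho f (\<phi> xb + \<epsilon>) \<inter> (ball xb \<eta> \<times> ball xbs \<eta>) \<Longrightarrow>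
       x + \<mu> *\<^sub>R xs \<in> ball wb \<delta>' \<and> P (x + \<mu> *\<^sub>R xs) = x \<and> G (x + \<mu> *\<^sub>R xs) = xs"
proof -
  \<comment> \<open>\<open>x + \<mu> *\<^sub>R xs\<close> moves by less than
    \<open>\<eta> * (1 + \<mu>)\<close>.\<close>
  define \<eta> where "\<eta> = min \<epsilon> (\<delta>' / (1 + \<mu>))"
  have \<eta>: "0 < \<eta>" "\<eta> \<le> \<epsilon>" using \<epsilon> \<delta>' \<mu> by (auto simp: \<eta>_def)
  have "\<eta> \<le> \<delta>' / (1 + \<mu>)" by (simp add: \<eta>_def)
  then have \<eta>1: "\<eta> * (1 + \<mu>) \<le> \<delta>'" using \<mu> by (simp add: pos_le_divide_eq)
  have "\<eta> * 1 \<le> \<eta> * (1 + \<mu>)" using \<mu> \<eta> by (intro mult_left_mono) auto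
  then have \<eta>2: "\<eta> \<le> \<delta>'" using \<eta>1 by simp
  have ib: "x + \<mu> *\<^sub>R xs \<in> ball wb \<delta>'" if "x \<in> ball xb \<eta>" "xs \<in> ball xbs \<eta>" for x xs
  proof -
    have "norm (wb - (x + \<mu> *\<^sub>R xs)) \<le> norm (xb - x) + \<mu> * norm (xbs - xs)"
    proof -
      have e: "wb - (x + \<mu> *\<^sub>R xs) = (xb - x) + \<mu> *\<^sub>R (xbs - xs)" by (simp add: algebra_simps)
      show ?thesis unfolding e using norm_triangle_ineq[of "xb - x" "\<mu> *\<^sub>R (xbs - xs)"] \<mu>(1) by simp
    qed
    also have "\<dots> < \<eta> + \<mu> * \<eta>"
      using that \<mu> by (intro add_strict_mono mult_strict_left_mono) (auto simp: dist_norm)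
    also have "\<dots> \<le> \<delta>'" using \<eta>1 by (simp add: algebra_simps)
    finally show ?thesis by (simp add: dist_norm)
  qed
  show ?thesis
  proof (rule that[OF \<eta> \<eta>2 ib])
    fix x xs assume x: "(x, xs) \<in> gph_sub_rho f (\<phi> xb + \<epsilon>) \<inter> (ball xb \<eta> \<times> ball xbs \<eta>)"
    then have 1: "x + \<mu> *\<^sub>R xs \<in> ball wb \<delta>'" by (intro ib) auto
    then have 2: "x + \<mu> *\<^sub>R xs \<in> ball wb \<delta>" using \<delta>' by auto
    have "(x, xs) \<in> \<Gamma>" using x \<eta> f_xb by (auto simp: attentive_def gph_sub_rho_def gph_sub_def)
    from P_eq[OF this 2] 1 show "x + \<mu> *\<^sub>R xs \<in> ball wb \<delta>' \<and> P (x + \<mu> *\<^sub>R xs) = x \<and> G (x + \<mu> *\<^sub>R xs) = xs" by blast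
  qed
qed

text \<open>Cauchy-Schwarz turns the reflection bound into
  \<open>p \<bullet> h \<le> \<tau> * (norm h)\<^sup>2 / \<kappa>\<close>, so the gradient
  \<open>G\<close> is monotone with modulus \<open>(1 - 1 / \<kappa>) / \<mu>\<close>. This equals
  \<open>s / \<kappa>\<close>, the familiar modulus of the Moreau envelope of an
  \<open>s\<close>-convex function.\<close>

lemma env_convex:
  assumes \<kappa>: "\<kappa> = 1 + \<mu> * s" "\<kappa> > 0" and \<delta>': "\<delta>' \<le> \<delta>"
    and ne: "\<And>w w'. w \<in> ball wb \<delta>' \<Longrightarrow> w' \<in> ball wb \<delta>' \<Longrightarrow> norm ((2 * \<kappa>) *\<^sub>R (P w - P w') - (w - w')) \<le> norm (w - w')"
    and w: "w \<in> ball wb \<delta>'" "w' \<in> ball wb \<delta>'"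
  shows "env w + G w \<bullet> (w' - w) + s / (2 * \<kappa>) * (norm (w' - w))\<^sup>2 \<le> env w'"
proof -
  define h where "h = w' - w"
  define F where "F \<tau> = env (w + \<tau> *\<^sub>R h) - \<tau> * (G w \<bullet> h) - s / (2 * \<kappa>) * \<tau>\<^sup>2 * (norm h)\<^sup>2" for \<tau>
  have "F 0 \<le> F 1"
  proof (rule DERIV_nonneg_imp_nondecreasing[of 0 1 F])
    fix \<tau> :: real assume \<tau>: "0 \<le> \<tau>" "\<tau> \<le> 1"
    have "(1 - \<tau>) *\<^sub>R w + \<tau> *\<^sub>R w' \<in> ball wb \<delta>'" using w \<tau> by (intro convexD_alt convex_ball) auto
    then have z: "w + \<tau> *\<^sub>R h \<in> ball wb \<delta>'" by (simp add: h_def algebra_simps)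
    then have "w + \<tau> *\<^sub>R h \<in> ball wb \<delta>" using \<delta>' by auto
    note env_d = env_has_derivative[OF this]
    have "((\<lambda>\<tau>. w + \<tau> *\<^sub>R h) has_derivative (\<lambda>x. x *\<^sub>R h)) (at \<tau>)" by (auto intro!: derivative_eq_intros)
    from has_derivative_compose[OF this env_d]
    have "((\<lambda>\<tau>. env (w + \<tau> *\<^sub>R h)) has_derivative (\<lambda>x. G (w + \<tau> *\<^sub>R h) \<bullet> (x *\<^sub>R h))) (at \<tau>)" .
    then have d: "((\<lambda>\<tau>. env (w + \<tau> *\<^sub>R h)) has_real_derivative G (w + \<tau> *\<^sub>R h) \<bullet> h) (at \<tau>)"
      by (simp add: has_field_derivative_def mult_commute_abs)
    have "(F has_real_derivative (G (w + \<tau> *\<^sub>R h) \<bullet> h - G w \<bullet> h - s / \<kappa> * \<tau> * (norm h)\<^sup>2)) (at \<tau>)"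
      unfolding F_def by (rule derivative_eq_intros d refl | simp)+
    moreover have "0 \<le> G (w + \<tau> *\<^sub>R h) \<bullet> h - G w \<bullet> h - s / \<kappa> * \<tau> * (norm h)\<^sup>2"
    proof (cases "\<tau> = 0")
      case False
      then have "\<tau> > 0" using \<tau> by simp
      define p where "p = P (w + \<tau> *\<^sub>R h) - P w"
      have "((2 * \<kappa>) *\<^sub>R p - \<tau> *\<^sub>R h) \<bullet> h \<le> norm (\<tau> *\<^sub>R h) * norm h"
      proof (rule order.trans[OF norm_cauchy_schwarz mult_right_mono])
        show "norm ((2 * \<kappa>) *\<^sub>R p - \<tau> *\<^sub>R h) \<le> norm (\<tau> *\<^sub>R h)" using ne[OF z w(1)] by (simp add: p_def)
      qed simp
      then have "2 * (\<kappa> * (p \<bullet> h)) \<le> 2 * (\<tau> * (norm h)\<^sup>2)"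
        using \<open>\<tau> > 0\<close> by (simp add: inner_diff_left power2_norm_eq_inner dot_square_norm power2_eq_square)
      then have ph: "p \<bullet> h \<le> \<tau> * (norm h)\<^sup>2 / \<kappa>" using \<kappa>(2) by (simp add: pos_le_divide_eq mult.commute)
      have "G (w + \<tau> *\<^sub>R h) - G w = (\<tau> *\<^sub>R h - p) /\<^sub>R \<mu>" by (simp add: G_def p_def algebra_simps)
      then have "(G (w + \<tau> *\<^sub>R h) - G w) \<bullet> h = (\<tau> * (norm h)\<^sup>2 - p \<bullet> h) / \<mu>"
        using \<mu>(1) by (simp only: inner_scaleR_left inner_diff_left power2_norm_eq_inner) (simp add: field_simps)
      then have eq: "G (w + \<tau> *\<^sub>R h) \<bullet> h - G w \<bullet> h = (\<tau> * (norm h)\<^sup>2 - p \<bullet> h) / \<mu>" by (simp only: inner_diff_left)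
      have "s / \<kappa> * \<tau> * (norm h)\<^sup>2 = (\<tau> * (norm h)\<^sup>2 - \<tau> * (norm h)\<^sup>2 / \<kappa>) / \<mu>"
      proof -
        have "(1 - 1 / \<kappa>) = \<mu> * s / \<kappa>" using \<kappa>(2) by (simp add: diff_divide_eq_iff) (simp add: \<kappa>(1))
        then have "(1 - 1 / \<kappa>) / \<mu> * (\<tau> * (norm h)\<^sup>2) = s / \<kappa> * (\<tau> * (norm h)\<^sup>2)" using \<mu>(1) by simp
        then show ?thesis by (simp add: left_diff_distrib diff_divide_distrib mult.assoc)
      qed
      also have "\<dots> \<le> (\<tau> * (norm h)\<^sup>2 - p \<bullet> h) / \<mu>" using ph \<mu>(1) by (intro divide_right_mono) auto
      finally show ?thesis unfolding eq by simp
    qed simp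
    ultimately show "\<exists>y. (F has_real_derivative y) (at \<tau>) \<and> 0 \<le> y" by blast
  qed simp
  then show ?thesis by (simp add: F_def h_def)
qed

definition "quad s w x = \<phi> (P w) + G w \<bullet> (x - P w) + s / 2 * (norm (x - P w))\<^sup>2"

text \<open>The quadratic minorants are obtained by evaluating the envelope at the point at which
  \<open>quad s w\<close> has proximal point \<open>x\<close>.\<close>

lemma quad_le_f:
  assumes \<kappa>: "\<kappa> = 1 + \<mu> * s" "\<kappa> > 0" and \<delta>': "\<delta>' \<le> \<delta>"
    and ne: "\<And>w w'. w \<in> ball wb \<delta>' \<Longrightarrow> w' \<in> ball wb \<delta>' \<Longrightarrow> norm ((2 * \<kappa>) *\<^sub>R (P w - P w') - (w - w')) \<le> norm (w - w')"
    and w: "w \<in> ball wb \<delta>'" and x: "x \<in> ball xb \<epsilon>" and w': "x + \<mu> *\<^sub>R (G w + s *\<^sub>R (x - P w)) \<in> ball wb \<delta>'"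
  shows "ereal (quad s w x) \<le> f x"
proof -
  define y where "y = x - P w"
  define w' where "w' = x + \<mu> *\<^sub>R (G w + s *\<^sub>R y)"
  have w'b: "w' \<in> ball wb \<delta>'" using w' by (simp add: w'_def y_def)
  have "w' - w = \<kappa> *\<^sub>R y"
    by (subst (1) P_G[of w, symmetric]) (simp add: w'_def y_def \<kappa>(1) algebra_simps)
  then have 1: "env w + \<kappa> * (G w \<bullet> y) + s / (2 * \<kappa>) * (\<kappa>\<^sup>2 * (norm y)\<^sup>2) \<le> env w'"
    using env_convex[OF \<kappa> \<delta>' ne w w'b] \<kappa>(2) by (simp add: power_mult_distrib)
  have "(norm (x - w'))\<^sup>2 = \<mu> * \<mu> * ((norm (G w))\<^sup>2 + 2 * s * (G w \<bullet> y) + s * s * (norm y)\<^sup>2)"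
    unfolding power2_norm_eq_inner w'_def
    by (simp add: inner_add_left inner_add_right inner_commute[of y "G w"] algebra_simps)
  then have 2: "(norm (x - w'))\<^sup>2 / (2 * \<mu>) = \<mu> / 2 * ((norm (G w))\<^sup>2 + 2 * s * (G w \<bullet> y) + s * s * (norm y)\<^sup>2)"
    using \<mu> by simp
  have 3: "s / (2 * \<kappa>) * (\<kappa>\<^sup>2 * (norm y)\<^sup>2) = s * \<kappa> / 2 * (norm y)\<^sup>2" using \<kappa>(2) by (simp add: power2_eq_square)
  have "quad s w x \<le> env w' - (norm (x - w'))\<^sup>2 / (2 * \<mu>)"
    using 1 unfolding 2 3 quad_def env_def y_def[symmetric] by (simp add: \<kappa>(1) algebra_simps add_divide_distrib)
  moreover have "ereal (env w' - (norm (x - w'))\<^sup>2 / (2 * \<mu>)) \<le> f x"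
    using w'b \<delta>' by (intro env_minorant x) auto
  ultimately show ?thesis by (meson ereal_less_eq(3) order.trans)
qed

text \<open>The minorant has the right subgradients because each quadratic touches \<open>f\<close>
  at its \<open>P w\<close>. It has no others near the base pair: for \<open>xs\<close> a
  subgradient of \<open>fh\<close> at \<open>x\<close>, its inequality at \<open>p\<close>, the
  value of \<open>P\<close> at \<open>x + \<mu> *\<^sub>R xs\<close>, is combined with the quadratic
  of that parameter evaluated at \<open>x\<close>. This yields
  \<open>\<kappa> * (norm (p - x))\<^sup>2 \<le> 0\<close>.\<close>

lemma var_s_convex_of_nonexpansive:
  assumes \<kappa>: "\<kappa> = 1 + \<mu> * s" "\<kappa> > 0" and \<delta>': "0 < \<delta>'" "\<delta>' \<le> \<delta>"
    and ne: "\<And>w w'. w \<in> ball wb \<delta>' \<Longrightarrow> w' \<in> ball wb \<delta>' \<Longrightarrow> norm ((2 * \<kappa>) *\<^sub>R (P w - P w') - (w - w')) \<le> norm (w - w')"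
  shows "var_s_convex s f xb xbs"
proof -
  \<comment> \<open>If \<open>x\<close> and \<open>w\<close> are within \<open>\<delta>2\<close> of
    their centres, \<open>P w\<close> is within \<open>2 * \<delta>2\<close> of \<open>xb\<close>.
    These displacements sum to at most \<open>4 * \<delta>2\<close> and occur once plainly and once,
    in part, with factor \<open>\<mu> * \<bar>s\<bar>\<close>.\<close>
  define \<delta>2 where "\<delta>2 = \<delta>' / (4 * (1 + \<mu> * \<bar>s\<bar>))"
  have pos: "1 + \<mu> * \<bar>s\<bar> \<ge> 1" using \<mu> by simp
  then have \<delta>2: "0 < \<delta>2" "\<delta>2 \<le> \<delta>'" "4 * (1 + \<mu> * \<bar>s\<bar>) * \<delta>2 = \<delta>'"
    using \<delta>' by (auto simp: \<delta>2_def divide_le_eq mult_le_cancel_left1)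
  have \<delta>2\<delta>: "\<delta>2 \<le> \<delta>" using \<delta>2 \<delta>' by simp
  define \<delta>3 where "\<delta>3 = min \<epsilon> \<delta>2"
  have \<delta>3: "0 < \<delta>3" "\<delta>3 \<le> \<epsilon>" "\<delta>3 \<le> \<delta>2" using \<epsilon> \<delta>2 by (auto simp: \<delta>3_def)
  \<comment> \<open>Halved because \<open>P\<close> is 2-Lipschitz: it maps this ball of parameters
    into \<open>ball xb \<delta>3\<close>, where \<open>fh\<close> lies below
    \<open>f\<close>.\<close>
  have \<delta>4: "0 < \<delta>3 / 2" "\<delta>3 / 2 \<le> \<delta>" using \<delta>3 \<delta>2\<delta> by auto
  have \<delta>42: "ball wb (\<delta>3 / 2) \<subseteq> ball wb \<delta>2" using \<delta>3 by (intro subset_ball) auto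
  obtain \<eta> where \<eta>: "0 < \<eta>" "\<eta> \<le> \<delta>3 / 2" "\<And>x xs. x \<in> ball xb \<eta> \<Longrightarrow> xs \<in> ball xbs \<eta> \<Longrightarrow> x + \<mu> *\<^sub>R xs \<in> ball wb (\<delta>3 / 2)"
    "\<And>x xs. (x, xs) \<in> gph_sub_rho f (\<phi> xb + \<epsilon>) \<inter> (ball xb \<eta> \<times> ball xbs \<eta>) \<Longrightarrow>
       x + \<mu> *\<^sub>R xs \<in> ball wb (\<delta>3 / 2) \<and> P (x + \<mu> *\<^sub>R xs) = x \<and> G (x + \<mu> *\<^sub>R xs) = xs"
    using graph_parametrised[OF \<delta>4] by metis
  have \<eta>3: "ball xb \<eta> \<subseteq> ball xb \<delta>3" using \<eta>(2) \<delta>3 by (intro subset_ball) auto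
  define fh where "fh x = (SUP w\<in>ball wb \<delta>2. ereal (quad s w x))" for x
  have le_fh: "ereal (quad s w x) \<le> fh x" if "w \<in> ball wb \<delta>2" for w x
    unfolding fh_def using that by (rule SUP_upper)
  have fh_ninf: "fh x \<noteq> -\<infinity>" for x
    using le_fh[of wb x] \<delta>2 by auto
  have fh_le: "fh x \<le> f x" if x: "x \<in> ball xb \<delta>3" for x
    unfolding fh_def
  proof (rule SUP_least)
    fix w assume w: "w \<in> ball wb \<delta>2"
    have wd: "w \<in> ball wb \<delta>" "wb \<in> ball wb \<delta>" using w \<delta>2 \<delta>' by auto
    have nw: "norm (w - wb) \<le> \<delta>2" using w by (simp add: dist_norm norm_minus_commute)
    have Pw: "norm (P w - xb) \<le> 2 * \<delta>2" using P_lip[OF wd] nw by (simp add: P_wb)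
    have xx: "norm (x - xb) < \<delta>2" using x \<delta>3(3) by (simp add: dist_norm norm_minus_commute)
    have "x + \<mu> *\<^sub>R (G w + s *\<^sub>R (x - P w)) - wb = (x - xb) + (w - wb) - (P w - xb) + (\<mu> * s) *\<^sub>R ((x - xb) - (P w - xb))"
      by (subst (2) P_G[of w, symmetric]) (simp add: algebra_simps)
    also have "norm \<dots> \<le> (norm (x - xb) + norm (w - wb) + norm (P w - xb)) + \<mu> * \<bar>s\<bar> * (norm (x - xb) + norm (P w - xb))"
    proof -
      have "norm ((\<mu> * s) *\<^sub>R ((x - xb) - (P w - xb))) \<le> \<mu> * \<bar>s\<bar> * (norm (x - xb) + norm (P w - xb))"
        using \<mu> norm_triangle_ineq4[of "x - xb" "P w - xb"] by (simp add: abs_mult mult_left_mono)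
      moreover have "norm ((x - xb) + (w - wb) - (P w - xb)) \<le> norm (x - xb) + norm (w - wb) + norm (P w - xb)"
        using norm_triangle_ineq4[of "(x - xb) + (w - wb)" "P w - xb"] norm_triangle_ineq[of "x - xb" "w - wb"] by linarith
      ultimately show ?thesis using norm_triangle_ineq[of "(x - xb) + (w - wb) - (P w - xb)" "(\<mu> * s) *\<^sub>R ((x - xb) - (P w - xb))"] by linarith
    qed
    also have "\<dots> < 4 * \<delta>2 + \<mu> * \<bar>s\<bar> * (4 * \<delta>2)"
      using xx nw Pw \<mu> \<delta>2 by (intro add_less_le_mono mult_left_mono) auto
    also have "\<dots> = \<delta>'" using \<delta>2(3) by (simp add: algebra_simps)
    finally have "x + \<mu> *\<^sub>R (G w + s *\<^sub>R (x - P w)) \<in> ball wb \<delta>'" by (simp only: mem_ball dist_norm norm_minus_commute[of wb])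
    then show "ereal (quad s w x) \<le> f x"
      using w x \<delta>2 \<delta>3(2) by (intro quad_le_f[OF \<kappa> \<delta>'(2) ne]) auto
  qed
  have quad_self: "quad s w (P w) = \<phi> (P w)" for w by (simp add: quad_def)
  have fh_P: "fh (P w) \<ge> f (P w)" if "w \<in> ball wb \<delta>2" for w
    using le_fh[OF that, of "P w"] f_eq[OF in_graph] that \<delta>2\<delta> by (auto simp: quad_self)
  have lsc: "lsc fh"
    unfolding lsc_def le_Liminf_iff
  proof (intro allI impI)
    fix x y assume "y < fh x"
    then obtain w where w: "w \<in> ball wb \<delta>2" "y < ereal (quad s w x)" unfolding fh_def less_SUP_iff by blast
    have "((\<lambda>z. ereal (quad s w z)) \<longlongrightarrow> ereal (quad s w x)) (at x)"
      unfolding quad_def by (intro tendsto_intros)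
    then have "\<forall>\<^sub>F z in at x. y < ereal (quad s w z)" using w(2) by (rule order_tendstoD)
    then show "\<forall>\<^sub>F z in at x. y < fh z"
      by (rule eventually_mono) (rule less_le_trans[OF _ le_fh[OF w(1)]])
  qed
  \<comment> \<open>Each quadratic minus \<open>s / 2 * (norm x)\<^sup>2\<close> is affine, so
    convexity holds on the whole space; infinite values of \<open>fh\<close> are treated
    apart.\<close>
  have conv: "ereal_convex_on UNIV (\<lambda>x. fh x - ereal (s / 2 * (norm x)\<^sup>2))"
    unfolding ereal_convex_on_def
  proof (intro ballI allI impI)
    fix x y :: 'a and t :: real assume t: "0 < t \<and> t < 1"
    let ?z = "t *\<^sub>R x + (1 - t) *\<^sub>R y" and ?q = "\<lambda>x. s / 2 * (norm x)\<^sup>2"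
    show "fh ?z - ereal (?q ?z) \<le> ereal t * (fh x - ereal (?q x)) + ereal (1 - t) * (fh y - ereal (?q y))"
    proof (cases "fh x = \<infinity> \<or> fh y = \<infinity>")
      case True
      then show ?thesis using fh_ninf[of x] fh_ninf[of y] t by (cases "fh x"; cases "fh y") auto
    next
      case False
      then obtain a b where ab: "fh x = ereal a" "fh y = ereal b"
        using fh_ninf[of x] fh_ninf[of y] by (cases "fh x"; cases "fh y") auto
      have "fh ?z \<le> ereal (?q ?z + (t * (a - ?q x) + (1 - t) * (b - ?q y)))"
        unfolding fh_def
      proof (rule SUP_least)
        fix w assume w: "w \<in> ball wb \<delta>2"
        define C g where "C = \<phi> (P w) - G w \<bullet> P w + s / 2 * (P w \<bullet> P w)" and "g = G w - s *\<^sub>R P w"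
        have aff: "quad s w x - ?q x = C + g \<bullet> x" for x
          unfolding quad_def power2_norm_eq_inner C_def g_def
          by (simp add: inner_diff_left inner_diff_right inner_commute[of x "P w"] algebra_simps)
        have "quad s w x \<le> a" "quad s w y \<le> b" using le_fh[OF w, of x] le_fh[OF w, of y] ab by auto
        then have "t * (quad s w x - ?q x) + (1 - t) * (quad s w y - ?q y) \<le> t * (a - ?q x) + (1 - t) * (b - ?q y)"
          using t by (intro add_mono mult_left_mono) auto
        moreover have "quad s w ?z - ?q ?z = t * (quad s w x - ?q x) + (1 - t) * (quad s w y - ?q y)"
          unfolding aff by (simp add: inner_add_right algebra_simps)
        ultimately show "ereal (quad s w ?z) \<le> ereal (?q ?z + (t * (a - ?q x) + (1 - t) * (b - ?q y)))" by simp
      qed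
      then show ?thesis using ab fh_ninf[of ?z] by (cases "fh ?z") auto
    qed
  qed
  have sub: "xs \<in> lsub fh x \<Longrightarrow> fh x + ereal (xs \<bullet> (x' - x) + s / 2 * (norm (x' - x))\<^sup>2) \<le> fh x'" for x xs x'
    by (rule ereal_convex_lsub_ineq[OF open_UNIV conv]) (auto simp: fh_ninf)
  have fwd: "xs \<in> lsub fh x \<and> f x = fh x" if x: "(x, xs) \<in> gph_sub_rho f (\<phi> xb + \<epsilon>) \<inter> (ball xb \<eta> \<times> ball xbs \<eta>)" for x xs
  proof -
    let ?w = "x + \<mu> *\<^sub>R xs"
    have w: "?w \<in> ball wb \<delta>2" "P ?w = x" "G ?w = xs" using \<eta>(4)[OF x] \<delta>42 by auto
    have "x \<in> ball xb \<delta>3" using x \<eta>3 by auto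
    then have fx: "f x = fh x" using fh_P[OF w(1)] fh_le[of x] unfolding w(2) by (auto intro: antisym)
    have fr: "f x = ereal (\<phi> x)" using f_eq[OF in_graph, of ?w] w \<delta>2\<delta> by auto
    have "xs \<in> regsub fh x"
    proof (rule regsubI[of _ _ 1 _ "- s / 2"])
      show "\<bar>fh x\<bar> \<noteq> \<infinity>" using fr fx by simp
      show "fh x + ereal (xs \<bullet> (y - x) - - s / 2 * (norm (y - x))\<^sup>2) \<le> fh y" for y
        using le_fh[OF w(1), of y] fr fx w by (simp add: quad_def add.assoc)
    qed simp
    then show ?thesis using fx regsub_subset_lsub by blast
  qed
  have bwd: "(x, xs) \<in> gph_sub_rho f (\<phi> xb + \<epsilon>)" if xs: "xs \<in> lsub fh x" and x: "x \<in> ball xb \<eta>" "xs \<in> ball xbs \<eta>" for x xs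
  proof -
    let ?w = "x + \<mu> *\<^sub>R xs"
    define p ps where "p = P ?w" and "ps = G ?w"
    have w: "?w \<in> ball wb (\<delta>3 / 2)" using \<eta>(3) x by blast
    have w2: "?w \<in> ball wb \<delta>2" "?w \<in> ball wb \<delta>" using w \<delta>42 \<delta>4 by auto
    have inG: "(p, ps) \<in> \<Gamma>" unfolding p_def ps_def by (rule in_graph[OF w2(2)])
    have "norm (p - xb) \<le> 2 * norm (?w - wb)" using P_lip[OF w2(2), of wb] \<delta> by (simp add: p_def P_wb)
    also have "norm (?w - wb) < \<delta>3 / 2" using w by (simp add: dist_norm norm_minus_commute)
    finally have "p \<in> ball xb \<delta>3" by (simp add: dist_norm norm_minus_commute)
    then have fp: "fh p \<le> ereal (\<phi> p)" using fh_le[of p] f_eq[OF inG] by simp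
    have "fh xb \<le> f xb" using fh_le[of xb] \<delta>3(1) by simp
    then have "fh x \<noteq> \<infinity>" using sub[OF xs, of xb] f_xb by auto
    then obtain a where a: "fh x = ereal a" using fh_ninf[of x] by (cases "fh x") auto
    have 1: "\<phi> p + ps \<bullet> (x - p) + s / 2 * (norm (x - p))\<^sup>2 \<le> a"
      using le_fh[OF w2(1), of x] a by (simp add: quad_def p_def ps_def)
    have "ereal (a + (xs \<bullet> (p - x) + s / 2 * (norm (p - x))\<^sup>2)) \<le> ereal (\<phi> p)"
      using order.trans[OF sub[OF xs, of p] fp] a by simp
    then have "a + xs \<bullet> (p - x) + s / 2 * (norm (p - x))\<^sup>2 \<le> \<phi> p" by simp
    then have "(xs - ps) \<bullet> (p - x) + s * (norm (p - x))\<^sup>2 \<le> 0"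
      using 1 by (simp add: inner_diff_left inner_diff_right norm_minus_commute[of x p])
    then have "\<mu> * ((xs - ps) \<bullet> (p - x) + s * (norm (p - x))\<^sup>2) \<le> 0" using \<mu> by (simp add: mult_le_0_iff)
    moreover have "p + \<mu> *\<^sub>R ps = x + \<mu> *\<^sub>R xs" unfolding p_def ps_def by (rule P_G)
    then have e: "\<mu> *\<^sub>R (xs - ps) = p - x" by (simp add: algebra_simps)
    then have "\<mu> * ((xs - ps) \<bullet> (p - x)) = (norm (p - x))\<^sup>2"
      by (metis inner_scaleR_left power2_norm_eq_inner)
    ultimately have "\<kappa> * (norm (p - x))\<^sup>2 \<le> 0" by (simp add: \<kappa>(1) algebra_simps)
    then have "p = x" using \<kappa>(2) by (simp add: mult_le_0_iff)
    moreover have "ps = xs" using e \<open>p = x\<close> \<mu> by simp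
    ultimately show ?thesis using inG f_xb by (auto simp: attentive_def gph_sub_rho_def gph_sub_def)
  qed
  have conv': "ereal_convex_on (ball xb \<eta>) (\<lambda>x. fh x - ereal (s / 2 * (norm x)\<^sup>2))"
    using conv by (simp add: ereal_convex_on_def)
  show ?thesis
    unfolding var_s_convex_def
  proof (rule exI[of _ "ball xb \<eta>"], rule exI[of _ "ball xbs \<eta>"], rule exI[of _ fh], rule exI[of _ "\<phi> xb + \<epsilon>"], intro conjI)
    show "f xb < ereal (\<phi> xb + \<epsilon>)" using f_xb \<epsilon> by simp
    show "gph_sub_rho f (\<phi> xb + \<epsilon>) \<inter> (ball xb \<eta> \<times> ball xbs \<eta>) = gph_sub fh \<inter> (ball xb \<eta> \<times> ball xbs \<eta>)"
      using fwd bwd by (fastforce simp: gph_sub_def simp del: mem_ball)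
    show "\<forall>(x, xs)\<in>gph_sub_rho f (\<phi> xb + \<epsilon>) \<inter> (ball xb \<eta> \<times> ball xbs \<eta>). f x = fh x"
      using fwd by blast
    show "\<forall>x\<in>ball xb \<eta>. fh x \<le> f x" using fh_le \<eta>3 by blast
  qed (use \<eta>(1) lsc conv' fh_ninf in auto)
qed

text \<open>If \<open>P\<close> had a derivative at \<open>w\<close>, normality would say that its
  adjoint maps \<open>v\<close> to \<open>z\<close>; then \<open>y\<close> would be the adjoint of
  the reflection applied to \<open>v\<close>, and \<open>norm y \<le> norm v\<close> the
  nonexpansiveness of that adjoint. The usual proof for adjoints tests in the direction of
  \<open>y\<close>. Here this is done with \<open>d = - y\<close>, and a cluster point
  \<open>u\<close> of difference quotients replaces the derivative.\<close>

lemma coderivative_bound_of_nonexpansive: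
  assumes \<kappa>: "\<kappa> = 1 + \<mu> * s" "\<kappa> > 0" and w: "w \<in> ball wb \<delta>"
    and ne: "\<forall>\<^sub>F w' in nhds w. norm ((2 * \<kappa>) *\<^sub>R (P w' - P w) - (w' - w)) \<le> norm (w' - w)"
    and normal: "(zs, - z) \<in> reg_normal_f f (P w, G w)"
  shows "s * (norm z)\<^sup>2 \<le> zs \<bullet> z"
proof -
  define v where "v = \<mu> *\<^sub>R zs + z"
  define y where "y = (2 * \<kappa>) *\<^sub>R z - v"
  define d where "d = - y"
  obtain t where t: "\<And>k. t k > 0" "t \<longlonglongrightarrow> 0" "\<And>k. w + t k *\<^sub>R d \<in> ball wb \<delta>" using small_steps[OF w] by blast
  define q where "q k = (1 / t k) *\<^sub>R (P (w + t k *\<^sub>R d) - P w)" for k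
  have "norm (q k) \<le> 2 * norm d" for k
  proof -
    have "norm (P (w + t k *\<^sub>R d) - P w) \<le> 2 * (t k * norm d)" using P_lip[OF t(3)[of k] w] t(1)[of k] by simp
    then show ?thesis unfolding q_def norm_scaleR using t(1)[of k] by (simp add: field_simps)
  qed
  then have "q k \<in> cball 0 (2 * norm d)" for k by simp
  then obtain u \<sigma> where u: "strict_mono \<sigma>" "(q \<circ> \<sigma>) \<longlonglongrightarrow> u"
    using compact_cball[of 0 "2 * norm d"] unfolding compact_def by metis
  have t\<sigma>: "(\<lambda>k. t (\<sigma> k)) \<longlonglongrightarrow> 0" using LIMSEQ_subseq_LIMSEQ[OF t(2) u(1)] by (simp add: comp_def)
  have "(u, (d - u) /\<^sub>R \<mu>) \<in> tangent_f f (P w, G w)"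
    by (rule tangent_of_curve[OF w, of "\<lambda>k. t (\<sigma> k)"]) (use t t\<sigma> u(2) in \<open>auto simp: q_def comp_def\<close>)
  then have "(zs, - z) \<bullet> (u, (d - u) /\<^sub>R \<mu>) \<le> 0" using normal by (auto simp: reg_normal_f_def)
  then have "\<mu> * (zs \<bullet> u - z \<bullet> ((d - u) /\<^sub>R \<mu>)) \<le> 0" using \<mu> by (simp add: mult_le_0_iff)
  moreover have "\<mu> * (zs \<bullet> u - z \<bullet> ((d - u) /\<^sub>R \<mu>)) = \<mu> * (zs \<bullet> u) - z \<bullet> (d - u)"
    using \<mu>(1) by (simp add: right_diff_distrib)
  ultimately have vu: "v \<bullet> u \<le> z \<bullet> d" by (simp add: v_def inner_add_left inner_diff_right)
  have "(\<lambda>k. w + t k *\<^sub>R d) \<longlonglongrightarrow> w" using t(2) by (auto intro!: tendsto_eq_intros)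
  then have "(\<lambda>k. w + t (\<sigma> k) *\<^sub>R d) \<longlonglongrightarrow> w" using t\<sigma> by (auto intro!: tendsto_eq_intros)
  from eventually_compose_filterlim[OF ne this]
  have ev: "\<forall>\<^sub>F k in sequentially. norm ((2 * \<kappa>) *\<^sub>R (q \<circ> \<sigma>) k - d) \<le> norm d"
  proof (rule eventually_mono)
    fix k assume "norm ((2 * \<kappa>) *\<^sub>R (P (w + t (\<sigma> k) *\<^sub>R d) - P w) - (w + t (\<sigma> k) *\<^sub>R d - w)) \<le> norm (w + t (\<sigma> k) *\<^sub>R d - w)"
    moreover have "P (w + t (\<sigma> k) *\<^sub>R d) - P w = t (\<sigma> k) *\<^sub>R q (\<sigma> k)" using t(1)[of "\<sigma> k"] by (simp add: q_def)
    ultimately have "norm (t (\<sigma> k) *\<^sub>R ((2 * \<kappa>) *\<^sub>R q (\<sigma> k) - d)) \<le> norm (t (\<sigma> k) *\<^sub>R d)"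
      by (simp add: scaleR_diff_right mult.commute)
    then show "norm ((2 * \<kappa>) *\<^sub>R (q \<circ> \<sigma>) k - d) \<le> norm d" using t(1)[of "\<sigma> k"] by simp
  qed
  have "(\<lambda>k. norm ((2 * \<kappa>) *\<^sub>R (q \<circ> \<sigma>) k - d)) \<longlonglongrightarrow> norm ((2 * \<kappa>) *\<^sub>R u - d)" by (intro tendsto_intros u)
  then have nu: "norm ((2 * \<kappa>) *\<^sub>R u - d) \<le> norm d" using tendsto_upperbound[OF _ ev] by simp
  have "(norm y)\<^sup>2 = - (y \<bullet> d)" by (simp add: d_def power2_norm_eq_inner)
  also have "\<dots> \<le> - (v \<bullet> ((2 * \<kappa>) *\<^sub>R u - d))"
  proof -
    have "2 * \<kappa> * (v \<bullet> u) \<le> 2 * \<kappa> * (z \<bullet> d)" using vu \<kappa>(2) by simp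
    then show ?thesis by (simp add: y_def inner_diff_left inner_diff_right)
  qed
  also have "\<dots> \<le> norm v * norm ((2 * \<kappa>) *\<^sub>R u - d)"
    using norm_cauchy_schwarz[of "- v" "(2 * \<kappa>) *\<^sub>R u - d"] by simp
  also have "\<dots> \<le> norm v * norm y" using nu by (intro mult_left_mono) (auto simp: d_def)
  finally have "norm y * norm y \<le> norm v * norm y" by (simp add: power2_eq_square)
  then have "norm y \<le> norm v" by (cases "y = 0") auto
  then have "\<kappa> * (norm z)\<^sup>2 \<le> z \<bullet> v" unfolding y_def norm_reflection_le_iff[OF \<kappa>(2)] .
  then have "\<mu> * (s * (norm z)\<^sup>2) \<le> \<mu> * (zs \<bullet> z)"
    by (simp add: \<kappa>(1) v_def inner_add_right power2_norm_eq_inner inner_commute algebra_simps)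
  then show ?thesis using \<mu> by simp
qed

lemma nonexpansive_of_monotone:
  assumes \<kappa>: "\<kappa> = 1 + \<mu> * s" "\<kappa> > 0"
    and UV: "open U" "open V" "xb \<in> U" "xbs \<in> V" "f xb < ereal \<rho>"
    and mono: "\<And>x xs y ys. (x, xs) \<in> gph_sub_rho f \<rho> \<inter> (U \<times> V) \<Longrightarrow> (y, ys) \<in> gph_sub_rho f \<rho> \<inter> (U \<times> V) \<Longrightarrow>
       s * (norm (x - y))\<^sup>2 \<le> (xs - ys) \<bullet> (x - y)"
  obtains \<delta>' where "0 < \<delta>'" "\<delta>' \<le> \<delta>"
    "\<And>w w'. w \<in> ball wb \<delta>' \<Longrightarrow> w' \<in> ball wb \<delta>' \<Longrightarrow> norm ((2 * \<kappa>) *\<^sub>R (P w - P w') - (w - w')) \<le> norm (w - w')"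
proof -
  obtain \<delta>' where \<delta>': "0 < \<delta>'" "\<delta>' \<le> \<delta>" "\<And>w. w \<in> ball wb \<delta>' \<Longrightarrow> (P w, G w) \<in> gph_sub_rho f \<rho> \<inter> (U \<times> V)"
    using graph_near_base[OF UV] by metis
  show ?thesis
  proof (rule that[OF \<delta>'(1,2)])
    fix w w' assume w: "w \<in> ball wb \<delta>'" "w' \<in> ball wb \<delta>'"
    define p where "p = P w - P w'"
    have "s * (norm p)\<^sup>2 \<le> (G w - G w') \<bullet> p" unfolding p_def by (intro mono \<delta>'(3) w)
    then have "\<mu> * (s * (norm p)\<^sup>2) \<le> \<mu> * ((G w - G w') \<bullet> p)" using \<mu> by (intro mult_left_mono) auto
    moreover have ww: "w - w' = p + \<mu> *\<^sub>R (G w - G w')"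
      using P_G[of w] P_G[of w'] unfolding p_def by (metis add_diff_add scaleR_diff_right)
    have "p \<bullet> (w - w') = (norm p)\<^sup>2 + \<mu> * ((G w - G w') \<bullet> p)"
      unfolding ww inner_add_right power2_norm_eq_inner inner_scaleR_right by (simp only: inner_commute)
    ultimately have "\<kappa> * (norm p)\<^sup>2 \<le> p \<bullet> (w - w')"
      by (simp add: \<kappa>(1) distrib_right)
    then show "norm ((2 * \<kappa>) *\<^sub>R (P w - P w') - (w - w')) \<le> norm (w - w')"
      unfolding p_def[symmetric] norm_reflection_le_iff[OF \<kappa>(2)] .
  qed
qed

end

section \<open>Existence of the localised proximal mapping\<close>

text \<open>A minimiser over a compact ball exists by semicontinuity but could lie on the boundary.
  Comparison with the value at \<open>xb\<close> and prox-regularity at the base pair bound its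
  distance from \<open>xb\<close> by \<open>4 * norm h\<close>; for \<open>w\<close> close to the
  centre it is interior and yields a regular subgradient.\<close>

lemma prox_regular_param:
  fixes f :: "'a::euclidean_space \<Rightarrow> ereal"
  assumes lsc: "lsc f" and ninf: "\<And>x. f x \<noteq> -\<infinity>" and fxb: "f xb \<noteq> \<infinity>" and base: "xbs \<in> lsub f xb"
    and pr: "prox_regular f xb xbs"
  obtains \<epsilon> r \<mu> \<delta> P where "prox_param f xb xbs \<epsilon> r \<mu> \<delta> P" "1 + \<mu> * s > 0"
proof -
  obtain \<epsilon> r where \<epsilon>: "\<epsilon> > 0" and r: "r \<ge> 0" and prox: "\<And>x' x xs. x' \<in> ball xb \<epsilon> \<Longrightarrow> (x, xs) \<in> gph_sub f \<Longrightarrow> f x < f xb + ereal \<epsilon>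
      \<Longrightarrow> x \<in> ball xb \<epsilon> \<Longrightarrow> xs \<in> ball xbs \<epsilon> \<Longrightarrow> f x' \<ge> f x + ereal (xs \<bullet> (x' - x) - r / 2 * (norm (x' - x))\<^sup>2)"
    using pr unfolding prox_regular_def by metis
  obtain b where b: "f xb = ereal b" using ninf[of xb] fxb by (cases "f xb") auto
  \<comment> \<open>Makes \<open>\<mu> * (r + \<bar>s\<bar> + 1) = 1 / 2\<close>, which yields
    \<open>\<mu> * r \<le> 1 / 2\<close> and \<open>1 + \<mu> * s > 0\<close> at once.\<close>
  define \<mu> where "\<mu> = 1 / (2 * (r + \<bar>s\<bar> + 1))"
  have den: "r + \<bar>s\<bar> + 1 > 0" using r by simp
  then have \<mu>: "\<mu> > 0" by (simp add: \<mu>_def)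
  have \<mu>2: "\<mu> * (r + \<bar>s\<bar> + 1) = 1 / 2" using den by (simp add: \<mu>_def)
  have \<mu>r: "\<mu> * r \<le> 1 / 2"
  proof -
    have "\<mu> * r \<le> \<mu> * (r + \<bar>s\<bar> + 1)" using \<mu> by (intro mult_left_mono) auto
    then show ?thesis using \<mu>2 by simp
  qed
  have \<mu>s: "1 + \<mu> * s > 0"
  proof -
    have "\<mu> * (- s) \<le> \<mu> * (r + \<bar>s\<bar> + 1)" using \<mu> r by (intro mult_left_mono) auto
    then show ?thesis using \<mu>2 by simp
  qed
  \<comment> \<open>Majorises the constants of the smallness estimates:
    \<open>1 / \<mu> + norm xbs\<close> for the value of \<open>f\<close>, \<open>1 / \<mu>\<close>
    for the subgradient, and 1 for the distance to \<open>xb\<close>.\<close>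
  define K where "K = 1 + 1 / \<mu> + norm xbs"
  have K: "K > 0" "K \<ge> 1" "K \<ge> 1 / \<mu>" "K \<ge> 1 / \<mu> + norm xbs" using \<mu> by (auto simp: K_def add_pos_nonneg)
  define \<delta> where "\<delta> = min 1 (\<epsilon> / (10 * K))"
  have \<delta>: "\<delta> > 0" "\<delta> \<le> 1" using \<epsilon> K by (auto simp: \<delta>_def)
  have "\<delta> \<le> \<epsilon> / (10 * K)" by (simp add: \<delta>_def)
  then have \<delta>K: "\<delta> * K \<le> \<epsilon> / 10" using K(1) by (simp add: pos_le_divide_eq)
  let ?wb = "xb + \<mu> *\<^sub>R xbs"
  have ex: "\<exists>p. (p, (w - p) /\<^sub>R \<mu>) \<in> attentive f xb xbs \<epsilon>" if w: "w \<in> ball ?wb \<delta>" for w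
  proof -
    define h where "h = w - ?wb"
    have h: "norm h < \<delta>" using w by (simp add: h_def dist_norm norm_minus_commute)
    have cont: "continuous_on UNIV (\<lambda>x. (norm (x - w))\<^sup>2 / (2 * \<mu>))" using \<mu> by (intro continuous_intros) auto
    obtain p where p: "p \<in> cball xb (\<epsilon> / 2)" "\<And>y. y \<in> cball xb (\<epsilon> / 2) \<Longrightarrow> f p + ereal ((norm (p - w))\<^sup>2 / (2 * \<mu>)) \<le> f y + ereal ((norm (y - w))\<^sup>2 / (2 * \<mu>))"
      using lsc_attains_min[OF lsc compact_cball[of xb "\<epsilon> / 2"] _ cont] \<epsilon> by (metis cball_eq_empty half_gt_zero not_less_iff_gr_or_eq)
    have "f p + ereal ((norm (p - w))\<^sup>2 / (2 * \<mu>)) \<le> ereal (b + (norm (xb - w))\<^sup>2 / (2 * \<mu>))"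
      using p(2)[of xb] \<epsilon> b by simp
    then obtain a where a: "f p = ereal a" and min_xb: "a + (norm (p - w))\<^sup>2 / (2 * \<mu>) \<le> b + (norm (xb - w))\<^sup>2 / (2 * \<mu>)"
      using ninf[of p] by (cases "f p") auto
    have "p \<in> ball xb \<epsilon>" using p(1) \<epsilon> by auto
    then have lower: "b + (xbs \<bullet> (p - xb) - r / 2 * (norm (p - xb))\<^sup>2) \<le> a"
      using prox[of p xb xbs] \<epsilon> base a b by (simp add: gph_sub_def)
    define D where "D = norm (p - xb)"
    have expand: "((norm (xb - w))\<^sup>2 - (norm (p - w))\<^sup>2) / (2 * \<mu>) = xbs \<bullet> (p - xb) + (h \<bullet> (p - xb)) / \<mu> - D\<^sup>2 / (2 * \<mu>)"
    proof -
      have wv: "w = xb + \<mu> *\<^sub>R xbs + h" by (simp add: h_def)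
      have 1: "xb - w = - (\<mu> *\<^sub>R xbs + h)" "p - w = (p - xb) - (\<mu> *\<^sub>R xbs + h)" by (auto simp: wv algebra_simps)
      have "(norm (xb - w))\<^sup>2 - (norm (p - w))\<^sup>2 = 2 * ((\<mu> *\<^sub>R xbs + h) \<bullet> (p - xb)) - D\<^sup>2"
        unfolding 1 D_def power2_norm_eq_inner inner_minus_left inner_minus_right
        by (simp only: inner_diff_left[of "p - xb"] inner_diff_right[of _ "p - xb"] inner_commute[of "p - xb" "\<mu> *\<^sub>R xbs + h"])
      then have "((norm (xb - w))\<^sup>2 - (norm (p - w))\<^sup>2) / (2 * \<mu>) = (2 * (\<mu> * (xbs \<bullet> (p - xb)) + h \<bullet> (p - xb)) - D\<^sup>2) / (2 * \<mu>)"
        by (simp add: inner_add_left)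
      also have "\<dots> = xbs \<bullet> (p - xb) + (h \<bullet> (p - xb)) / \<mu> - D\<^sup>2 / (2 * \<mu>)"
        using \<mu> by (simp add: add_divide_distrib diff_divide_distrib distrib_left)
      finally show ?thesis .
    qed
    \<comment> \<open>In \<open>lower\<close> and \<open>upper\<close> the term
      \<open>xbs \<bullet> (p - xb)\<close> is the same and cancels, which leaves a bound on
      \<open>D\<close> by \<open>norm h\<close>.\<close>
    have upper: "a \<le> b + xbs \<bullet> (p - xb) + (h \<bullet> (p - xb)) / \<mu> - D\<^sup>2 / (2 * \<mu>)"
      using min_xb expand by (simp add: diff_divide_distrib)
    have hD: "h \<bullet> (p - xb) \<le> norm h * D" unfolding D_def by (rule norm_cauchy_schwarz)
    have "D\<^sup>2 / (2 * \<mu>) \<le> r / 2 * D\<^sup>2 + (h \<bullet> (p - xb)) / \<mu>" using lower upper by (simp add: D_def)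
    then have "D\<^sup>2 \<le> \<mu> * r * D\<^sup>2 + 2 * (h \<bullet> (p - xb))" using \<mu> by (simp add: field_simps)
    moreover have "\<mu> * r * D\<^sup>2 \<le> 1 / 2 * D\<^sup>2" using \<mu>r by (intro mult_right_mono) auto
    ultimately have "D * D \<le> 4 * norm h * D" using hD by (simp add: power2_eq_square)
    then have D: "D \<le> 4 * norm h" by (cases "D = 0") (auto simp: D_def)
    have D4: "D < 4 * \<delta>" using D h by simp
    have \<delta>10: "\<delta> \<le> \<epsilon> / 10"
    proof -
      have "\<delta> * 1 \<le> \<delta> * K" using K \<delta> by (intro mult_left_mono) auto
      then show ?thesis using \<delta>K by simp
    qed
    have D\<epsilon>: "D < \<epsilon> / 2" using D4 \<delta>10 \<epsilon> by simp
    have D0: "D \<ge> 0" by (simp add: D_def)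
    have "f p < f xb + ereal \<epsilon>"
    proof -
      have "xbs \<bullet> (p - xb) \<le> norm xbs * D" unfolding D_def by (rule norm_cauchy_schwarz)
      moreover have "(h \<bullet> (p - xb)) / \<mu> \<le> 1 / \<mu> * D"
      proof -
        have "norm h * D \<le> 1 * D" using h \<delta> D0 by (intro mult_right_mono) auto
        then have "(h \<bullet> (p - xb)) / \<mu> \<le> D / \<mu>" using hD \<mu> by (intro divide_right_mono) auto
        then show ?thesis by simp
      qed
      moreover have "0 \<le> D\<^sup>2 / (2 * \<mu>)" using \<mu> by simp
      ultimately have "a \<le> b + (1 / \<mu> + norm xbs) * D" using upper by (simp add: algebra_simps)
      also have "(1 / \<mu> + norm xbs) * D \<le> K * (4 * \<delta>)" using K D4 D0 \<mu> by (intro mult_mono) auto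
      also have "K * (4 * \<delta>) < \<epsilon>" using \<delta>K \<epsilon> by (simp add: mult_ac)
      finally show ?thesis using a b by simp
    qed
    moreover have "p \<in> ball xb \<epsilon>" by fact
    moreover have "(w - p) /\<^sub>R \<mu> \<in> ball xbs \<epsilon>"
    proof -
      have "(w - p) /\<^sub>R \<mu> - xbs = (h - (p - xb)) /\<^sub>R \<mu>"
        using \<mu> by (simp add: h_def scaleR_diff_right scaleR_add_right)
      then have "norm ((w - p) /\<^sub>R \<mu> - xbs) = norm (h - (p - xb)) * (1 / \<mu>)" using \<mu> by (simp add: divide_inverse)
      also have "\<dots> \<le> (5 * \<delta>) * K"
        using norm_triangle_ineq4[of h "p - xb"] D4 h K(3) \<mu> \<delta> by (intro mult_mono) (auto simp: D_def)
      also have "\<dots> < \<epsilon>" using \<delta>K \<epsilon> by (simp add: mult_ac)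
      finally show ?thesis by (simp add: dist_norm norm_minus_commute)
    qed
    moreover have "(w - p) /\<^sub>R \<mu> \<in> regsub f p"
    proof (rule regsubI[of _ _ "\<epsilon> / 2 - D" _ "1 / (2 * \<mu>)"])
      show "\<bar>f p\<bar> \<noteq> \<infinity>" using a by simp
      show "\<epsilon> / 2 - D > 0" using D\<epsilon> by simp
      fix y assume "y \<in> ball p (\<epsilon> / 2 - D)"
      then have "y \<in> cball xb (\<epsilon> / 2)" using dist_triangle[of xb y p] by (simp add: D_def dist_norm norm_minus_commute)
      from p(2)[OF this] a have le: "ereal (a + (norm (p - w))\<^sup>2 / (2 * \<mu>)) \<le> f y + ereal ((norm (y - w))\<^sup>2 / (2 * \<mu>))" by simp
      have id: "((norm (p - w))\<^sup>2 - (norm (y - w))\<^sup>2) / (2 * \<mu>) = ((w - p) /\<^sub>R \<mu>) \<bullet> (y - p) - 1 / (2 * \<mu>) * (norm (y - p))\<^sup>2"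
      proof -
        have "y - w = (y - p) - (w - p)" by simp
        then have "(norm (y - w))\<^sup>2 = (norm (y - p))\<^sup>2 - 2 * ((w - p) \<bullet> (y - p)) + (norm (w - p))\<^sup>2"
          unfolding power2_norm_eq_inner by (simp only: inner_diff_left[of "y - p"] inner_diff_right[of _ "y - p"] inner_commute[of "y - p" "w - p"])
        then have "((norm (p - w))\<^sup>2 - (norm (y - w))\<^sup>2) / (2 * \<mu>) = (2 * ((w - p) \<bullet> (y - p)) - (norm (y - p))\<^sup>2) / (2 * \<mu>)"
          by (simp add: norm_minus_commute[of p w])
        also have "\<dots> = ((w - p) /\<^sub>R \<mu>) \<bullet> (y - p) - 1 / (2 * \<mu>) * (norm (y - p))\<^sup>2"
          using \<mu> unfolding inner_scaleR_left by (simp add: field_simps)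
        finally show ?thesis .
      qed
      show "f p + ereal (((w - p) /\<^sub>R \<mu>) \<bullet> (y - p) - 1 / (2 * \<mu>) * (norm (y - p))\<^sup>2) \<le> f y"
        unfolding id[symmetric] using le a by (cases "f y") (auto simp: diff_divide_distrib)
    qed
    ultimately have "(p, (w - p) /\<^sub>R \<mu>) \<in> attentive f xb xbs \<epsilon>"
      using regsub_subset_lsub by (auto simp: attentive_def gph_sub_def simp del: mem_ball)
    then show ?thesis by blast
  qed
  \<comment> \<open>Outside the ball \<open>SOME\<close> may give any point; the locale constrains
    \<open>P\<close> only inside.\<close>
  define P where "P w = (SOME p. (p, (w - p) /\<^sub>R \<mu>) \<in> attentive f xb xbs \<epsilon>)" for w
  have "prox_param f xb xbs \<epsilon> r \<mu> \<delta> P"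
  proof
    show "(P w, (w - P w) /\<^sub>R \<mu>) \<in> attentive f xb xbs \<epsilon>" if "w \<in> ball ?wb \<delta>" for w
      unfolding P_def by (rule someI_ex[OF ex[OF that]])
    show "f x + ereal (xs \<bullet> (x' - x) - r / 2 * (norm (x' - x))\<^sup>2) \<le> f x'"
      if "x' \<in> ball xb \<epsilon>" "(x, xs) \<in> attentive f xb xbs \<epsilon>" for x' x xs
      using that by (intro prox) (auto simp: attentive_def)
  qed (use \<epsilon> r \<mu> \<mu>r \<delta> ninf fxb base in auto)
  then show ?thesis using that \<mu>s by blast
qed

section \<open>Consequences of variational s-convexity\<close>

text \<open>The minorant \<open>fh\<close> drops out: it equals \<open>f\<close> on the common graph
  and lies below \<open>f\<close> on \<open>U\<close>, so its subgradient inequality holds for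
  \<open>f\<close> itself.\<close>

lemma var_s_convexE:
  assumes vc: "var_s_convex s f xb xbs"
  obtains U V \<rho> where "open U" "open V" "xb \<in> U" "xbs \<in> V" "f xb < ereal \<rho>"
    "\<And>x xs x'. (x, xs) \<in> gph_sub_rho f \<rho> \<inter> (U \<times> V) \<Longrightarrow> x' \<in> U \<Longrightarrow>
       f x + ereal (xs \<bullet> (x' - x) + s / 2 * (norm (x' - x))\<^sup>2) \<le> f x'"
proof -
  obtain U V fh \<rho> where U: "open U" "open V" "xb \<in> U" "xbs \<in> V" and ninf: "\<And>x. fh x \<noteq> -\<infinity>" and \<rho>: "f xb < ereal \<rho>"
    and conv: "ereal_convex_on U (\<lambda>x. fh x - ereal (s / 2 * (norm x)\<^sup>2))" and le: "\<And>x. x \<in> U \<Longrightarrow> fh x \<le> f x"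
    and gph: "gph_sub_rho f \<rho> \<inter> (U \<times> V) = gph_sub fh \<inter> (U \<times> V)"
    and eq: "\<forall>(x, xs) \<in> gph_sub_rho f \<rho> \<inter> (U \<times> V). f x = fh x"
    using vc unfolding var_s_convex_def by blast
  show ?thesis
  proof (rule that[OF U \<rho>])
    fix x xs x' assume x: "(x, xs) \<in> gph_sub_rho f \<rho> \<inter> (U \<times> V)" and x': "x' \<in> U"
    then have "xs \<in> lsub fh x" "x \<in> U" using gph by (auto simp: gph_sub_def)
    from ereal_convex_lsub_ineq[OF U(1) conv this x' ninf]
    have "fh x + ereal (xs \<bullet> (x' - x) + s / 2 * (norm (x' - x))\<^sup>2) \<le> fh x'" .
    moreover have "f x = fh x" using eq x by blast
    ultimately show "f x + ereal (xs \<bullet> (x' - x) + s / 2 * (norm (x' - x))\<^sup>2) \<le> f x'"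
      using le[OF x'] by (simp add: order.trans)
  qed
qed

lemma prox_regular_of_var_s_convex:
  assumes vc: "var_s_convex s f xb xbs" and ninf: "f xb \<noteq> -\<infinity>"
  shows "prox_regular f xb xbs"
proof -
  obtain U V \<rho> where U: "open U" "open V" "xb \<in> U" "xbs \<in> V" "f xb < ereal \<rho>" and
    ineq: "\<And>x xs x'. (x, xs) \<in> gph_sub_rho f \<rho> \<inter> (U \<times> V) \<Longrightarrow> x' \<in> U \<Longrightarrow>
       f x + ereal (xs \<bullet> (x' - x) + s / 2 * (norm (x' - x))\<^sup>2) \<le> f x'"
    using var_s_convexE[OF vc] by metis
  obtain b where b: "f xb = ereal b" using ninf U(5) by (cases "f xb") auto
  obtain e1 where e1: "e1 > 0" "ball xb e1 \<subseteq> U" using U open_contains_ball by blast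
  obtain e2 where e2: "e2 > 0" "ball xbs e2 \<subseteq> V" using U open_contains_ball by blast
  define \<epsilon> where "\<epsilon> = min (min e1 e2) (\<rho> - b)"
  have \<epsilon>: "\<epsilon> > 0" "\<epsilon> \<le> e1" "\<epsilon> \<le> e2" "b + \<epsilon> \<le> \<rho>" using e1 e2 U(5) b by (auto simp: \<epsilon>_def)
  have balls: "ball xb \<epsilon> \<subseteq> U" "ball xbs \<epsilon> \<subseteq> V" using e1 e2 \<epsilon> by (meson order.trans subset_ball)+
  show ?thesis
    unfolding prox_regular_def
  proof (rule exI[of _ \<epsilon>], intro conjI, rule \<epsilon>(1), rule exI[of _ "max 0 (- s)"], intro conjI allI impI)
    fix x' x xs assume *: "x' \<in> ball xb \<epsilon> \<and> (x, xs) \<in> gph_sub f \<and> f x < f xb + ereal \<epsilon> \<and> x \<in> ball xb \<epsilon> \<and> xs \<in> ball xbs \<epsilon>"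
    have "f x < ereal \<rho>" using * b \<epsilon>(4) by (auto intro: less_le_trans)
    then have "f x + ereal (xs \<bullet> (x' - x) + s / 2 * (norm (x' - x))\<^sup>2) \<le> f x'"
      using * balls by (intro ineq) (auto simp: gph_sub_rho_def gph_sub_def)
    moreover have "- max 0 (- s) / 2 * (norm (x' - x))\<^sup>2 \<le> s / 2 * (norm (x' - x))\<^sup>2" by (intro mult_right_mono) auto
    ultimately show "f x + ereal (xs \<bullet> (x' - x) - max 0 (- s) / 2 * (norm (x' - x))\<^sup>2) \<le> f x'"
      by (elim order.trans[rotated], intro add_left_mono) simp
  qed simp
qed

lemma var_s_convex_monotone:
  assumes vc: "var_s_convex s f xb xbs" and ninf: "\<And>x. f x \<noteq> -\<infinity>"
  obtains U V \<rho> where "open U" "open V" "xb \<in> U" "xbs \<in> V" "f xb < ereal \<rho>"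
    "\<And>x xs y ys. (x, xs) \<in> gph_sub_rho f \<rho> \<inter> (U \<times> V) \<Longrightarrow> (y, ys) \<in> gph_sub_rho f \<rho> \<inter> (U \<times> V) \<Longrightarrow>
       s * (norm (x - y))\<^sup>2 \<le> (xs - ys) \<bullet> (x - y)"
proof -
  obtain U V \<rho> where U: "open U" "open V" "xb \<in> U" "xbs \<in> V" "f xb < ereal \<rho>" and
    ineq: "\<And>x xs x'. (x, xs) \<in> gph_sub_rho f \<rho> \<inter> (U \<times> V) \<Longrightarrow> x' \<in> U \<Longrightarrow>
       f x + ereal (xs \<bullet> (x' - x) + s / 2 * (norm (x' - x))\<^sup>2) \<le> f x'"
    using var_s_convexE[OF vc] by metis
  show ?thesis
  proof (rule that[OF U])
    fix x xs y ys assume x: "(x, xs) \<in> gph_sub_rho f \<rho> \<inter> (U \<times> V)" and y: "(y, ys) \<in> gph_sub_rho f \<rho> \<inter> (U \<times> V)"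
    then obtain a b where ab: "f x = ereal a" "f y = ereal b"
      using ninf[of x] ninf[of y] by (cases "f x"; cases "f y") (auto simp: gph_sub_rho_def)
    have "a + (xs \<bullet> (y - x) + s / 2 * (norm (y - x))\<^sup>2) \<le> b" using ineq[OF x, of y] y ab by simp
    moreover have "b + (ys \<bullet> (x - y) + s / 2 * (norm (x - y))\<^sup>2) \<le> a" using ineq[OF y, of x] x ab by simp
    ultimately show "s * (norm (x - y))\<^sup>2 \<le> (xs - ys) \<bullet> (x - y)"
      by (simp add: norm_minus_commute[of y x] inner_diff_left inner_diff_right)
  qed
qed

section \<open>From derivative bounds to variational convexity\<close>

context prox_param
begin

text \<open>Rademacher and averaging work with a globally Lipschitz map. Composing with the
  closest-point projection onto a ball of half the radius supplies one and changes nothing on the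
  open ball where derivatives are taken.\<close>

lemma nonexpansive_of_derivatives:
  assumes \<kappa>: "\<kappa> > 0" and \<delta>': "0 < \<delta>'" "\<delta>' \<le> \<delta>"
    and H: "\<And>w B d. w \<in> ball wb \<delta>' \<Longrightarrow> (P has_derivative B) (at w) \<Longrightarrow> \<kappa> * (norm (B d))\<^sup>2 \<le> B d \<bullet> d"
    and w: "w \<in> ball wb (\<delta>' / 2)" "w' \<in> ball wb (\<delta>' / 2)"
  shows "norm ((2 * \<kappa>) *\<^sub>R (P w - P w') - (w - w')) \<le> norm (w - w')"
proof -
  define K where "K = cball wb (\<delta>' / 2)"
  have K: "convex K" "closed K" "K \<noteq> {}" using \<delta>' by (auto simp: K_def)
  have K\<delta>: "K \<subseteq> ball wb \<delta>" using \<delta>' by (auto simp: K_def)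
  define c where "c = closest_point K"
  have cK: "c z \<in> K" for z unfolding c_def using K by (intro closest_point_in_set) auto
  have cid: "c z = z" if "z \<in> K" for z using that by (simp add: c_def closest_point_self)
  have bK: "ball wb (\<delta>' / 2) \<subseteq> K" by (auto simp: K_def)
  define R where "R z = (2 * \<kappa>) *\<^sub>R P (c z) - c z" for z
  have lip: "(4 * \<kappa> + 1)-lipschitz_on UNIV R"
  proof (rule lipschitz_onI)
    fix y z
    have "dist (R y) (R z) = norm ((2 * \<kappa>) *\<^sub>R (P (c y) - P (c z)) - (c y - c z))"
      by (simp add: dist_norm R_def algebra_simps)
    also have "\<dots> \<le> 2 * \<kappa> * norm (P (c y) - P (c z)) + norm (c y - c z)"
      using norm_triangle_ineq4[of "(2 * \<kappa>) *\<^sub>R (P (c y) - P (c z))" "c y - c z"] \<kappa> by simp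
    also have "\<dots> \<le> 2 * \<kappa> * (2 * norm (c y - c z)) + norm (c y - c z)"
      using P_lip[OF subsetD[OF K\<delta> cK] subsetD[OF K\<delta> cK], of y z] \<kappa> by (intro add_right_mono mult_left_mono) auto
    also have "\<dots> = (4 * \<kappa> + 1) * dist (c y) (c z)" by (simp add: dist_norm algebra_simps)
    also have "\<dots> \<le> (4 * \<kappa> + 1) * dist y z"
      unfolding c_def using closest_point_lipschitz[OF K, of y z] \<kappa> by (intro mult_left_mono) auto
    finally show "dist (R y) (R z) \<le> (4 * \<kappa> + 1) * dist y z" .
  qed (use \<kappa> in simp)
  have "norm (R w - R w') \<le> norm (w - w')"
  proof (rule nonexpansive_of_derivative_bound[OF lip _ w(2,1)])
    fix z D v assume z: "z \<in> ball wb (\<delta>' / 2)" and D: "(R has_derivative D) (at z)"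
    have "((\<lambda>y. (1 / (2 * \<kappa>)) *\<^sub>R (R y + y)) has_derivative (\<lambda>h. (1 / (2 * \<kappa>)) *\<^sub>R (D h + h))) (at z)"
      by (intro derivative_intros D)
    moreover have "(1 / (2 * \<kappa>)) *\<^sub>R (R y + y) = P y" if "y \<in> ball wb (\<delta>' / 2)" for y
      using that bK cid \<kappa> by (auto simp: R_def)
    ultimately have P: "(P has_derivative (\<lambda>h. (1 / (2 * \<kappa>)) *\<^sub>R (D h + h))) (at z)"
      using has_derivative_transform_within_open[OF _ open_ball z] by blast
    have "z \<in> ball wb \<delta>'" using z \<delta>' by auto
    from H[OF this P, of v] have "norm ((2 * \<kappa>) *\<^sub>R ((1 / (2 * \<kappa>)) *\<^sub>R (D v + v)) - v) \<le> norm v"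
      by (subst norm_reflection_le_iff[OF \<kappa>]) auto
    then show "norm (D v) \<le> norm v" using \<kappa> by simp
  qed
  moreover have "R w - R w' = (2 * \<kappa>) *\<^sub>R (P w - P w') - (w - w')"
    using cid[OF subsetD[OF bK w(1)]] cid[OF subsetD[OF bK w(2)]] by (simp add: R_def algebra_simps)
  ultimately show ?thesis by simp
qed

text \<open>Coderivative, tangent and matrix conditions all arrive as an inequality on the pairs
  \<open>(B d, (d - B d) /\<^sub>R \<mu>)\<close>. Multiplication by \<open>\<mu>\<close> turns it
  into \<open>\<kappa> * (norm (B d))\<^sup>2 \<le> B d \<bullet> d\<close>.\<close>

lemma var_s_convex_of_derivative_bound:
  assumes \<kappa>: "1 + \<mu> * s > 0" and \<delta>': "0 < \<delta>'" "\<delta>' \<le> \<delta>"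
    and H: "\<And>w B d. w \<in> ball wb \<delta>' \<Longrightarrow> (P has_derivative B) (at w) \<Longrightarrow>
      s * (norm (B d))\<^sup>2 \<le> ((d - B d) /\<^sub>R \<mu>) \<bullet> B d"
  shows "var_s_convex s f xb xbs"
proof -
  define \<kappa> where "\<kappa> = 1 + \<mu> * s"
  have bound: "\<kappa> * (norm (B d))\<^sup>2 \<le> B d \<bullet> d" if "w \<in> ball wb \<delta>'" "(P has_derivative B) (at w)" for w B d
  proof -
    have "\<mu> * (s * (norm (B d))\<^sup>2) \<le> \<mu> * (((d - B d) /\<^sub>R \<mu>) \<bullet> B d)"
      using H[OF that] \<mu>(1) by (intro mult_left_mono) auto
    also have "\<dots> = (d - B d) \<bullet> B d" using \<mu>(1) by simp
    finally show ?thesis by (simp add: \<kappa>_def inner_diff_left power2_norm_eq_inner inner_commute algebra_simps)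
  qed
  have \<kappa>0: "\<kappa> > 0" using \<kappa> by (simp add: \<kappa>_def)
  show ?thesis
  proof (rule var_s_convex_of_nonexpansive[OF \<kappa>_def \<kappa>0])
    show "0 < \<delta>' / 2" "\<delta>' / 2 \<le> \<delta>" using \<delta>' by auto
    show "norm ((2 * \<kappa>) *\<^sub>R (P w - P w') - (w - w')) \<le> norm (w - w')"
      if "w \<in> ball wb (\<delta>' / 2)" "w' \<in> ball wb (\<delta>' / 2)" for w w'
      using that by (intro nonexpansive_of_derivatives[OF \<kappa>0 \<delta>']) (auto intro: bound simp del: mem_ball)
  qed
qed

end

section \<open>Generalised derivatives of the subdifferential\<close>

lemma f_att_conv_const: "q \<in> gph_sub f \<Longrightarrow> f_att_conv f (\<lambda>_. q) q"
  by (simp add: f_att_conv_def)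

text \<open>The value bound by \<open>\<rho>\<close> persists because attentive convergence includes
  convergence of \<open>f (fst (p k))\<close>; convergence of the pairs alone would not give it for
  a semicontinuous \<open>f\<close>.\<close>

lemma f_att_conv_eventually:
  assumes p: "f_att_conv f p (x, xs)" and "open U" "open V" "x \<in> U" "xs \<in> V" "f x < ereal \<rho>"
  shows "\<forall>\<^sub>F k in sequentially. p k \<in> gph_sub_rho f \<rho> \<inter> (U \<times> V)"
proof -
  have lim: "p \<longlonglongrightarrow> (x, xs)" "(\<lambda>k. f (fst (p k))) \<longlonglongrightarrow> f x" and gph: "\<And>k. p k \<in> gph_sub f"
    using p by (auto simp: f_att_conv_def)
  have "\<forall>\<^sub>F k in sequentially. p k \<in> U \<times> V"
    by (rule topological_tendstoD[OF lim(1) open_Times]) (use assms in auto)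
  moreover have "\<forall>\<^sub>F k in sequentially. f (fst (p k)) < ereal \<rho>"
    using order_tendstoD(2)[OF lim(2) assms(6)] .
  ultimately show ?thesis
  proof eventually_elim
    case (elim k)
    then show ?case using gph[of k] by (cases "p k") (auto simp: gph_sub_rho_def gph_sub_def)
  qed
qed

lemma lim_coderiv_bound:
  assumes "open U" "open V"
    and reg: "\<And>x xs z zs. (x, xs) \<in> gph_sub_rho f \<rho> \<inter> (U \<times> V) \<Longrightarrow> zs \<in> reg_coderiv_f f x xs z \<Longrightarrow> s * (norm z)\<^sup>2 \<le> zs \<bullet> z"
    and x: "(x, xs) \<in> gph_sub_rho f \<rho> \<inter> (U \<times> V)" and zs: "zs \<in> lim_coderiv_f f x xs z"
  shows "s * (norm z)\<^sup>2 \<le> zs \<bullet> z"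
proof -
  obtain p v where p: "f_att_conv f p (x, xs)" and v: "\<And>k. v k \<in> reg_normal_f f (p k)" "v \<longlonglongrightarrow> (zs, - z)"
    using zs unfolding lim_coderiv_f_def lim_normal_f_def by blast
  have "\<forall>\<^sub>F k in sequentially. p k \<in> gph_sub_rho f \<rho> \<inter> (U \<times> V)"
    by (rule f_att_conv_eventually[OF p assms(1,2)]) (use x in \<open>auto simp: gph_sub_rho_def\<close>)
  moreover define a b where "a k = fst (v k)" and "b k = - snd (v k)" for k
  ultimately have ev: "\<forall>\<^sub>F k in sequentially. s * (norm (b k))\<^sup>2 \<le> a k \<bullet> b k"
  proof (elim eventually_mono)
    fix k assume "p k \<in> gph_sub_rho f \<rho> \<inter> (U \<times> V)"
    then show "s * (norm (b k))\<^sup>2 \<le> a k \<bullet> b k"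
      using v(1)[of k] by (intro reg[of "fst (p k)" "snd (p k)"]) (auto simp: reg_coderiv_f_def a_def b_def)
  qed
  have ab: "a \<longlonglongrightarrow> zs" "b \<longlonglongrightarrow> z"
    using tendsto_fst[OF v(2)] tendsto_minus[OF tendsto_snd[OF v(2)]] by (auto simp: a_def[abs_def] b_def[abs_def])
  have "(\<lambda>k. s * (norm (b k))\<^sup>2) \<longlonglongrightarrow> s * (norm z)\<^sup>2" "(\<lambda>k. a k \<bullet> b k) \<longlonglongrightarrow> zs \<bullet> z"
    by (intro tendsto_intros ab)+
  then show ?thesis using tendsto_le[OF _ _ _ ev] by simp
qed

lemma reg_coderiv_subset_lim_coderiv:
  assumes "(x, xs) \<in> gph_sub f"
  shows "reg_coderiv_f f x xs z \<subseteq> lim_coderiv_f f x xs z"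
proof
  fix zs assume "zs \<in> reg_coderiv_f f x xs z"
  then show "zs \<in> lim_coderiv_f f x xs z"
    unfolding reg_coderiv_f_def lim_coderiv_f_def lim_normal_f_def mem_Collect_eq
    by (intro exI[of _ "\<lambda>_. (x, xs)"] exI[of _ "\<lambda>_. (zs, - z)"]) (simp add: f_att_conv_const[OF assms])
qed

lemma tangent_bound_of_monotone:
  assumes UV: "open U" "open V"
    and mono: "\<And>x xs y ys. (x, xs) \<in> gph_sub_rho f \<rho> \<inter> (U \<times> V) \<Longrightarrow> (y, ys) \<in> gph_sub_rho f \<rho> \<inter> (U \<times> V) \<Longrightarrow>
       s * (norm (x - y))\<^sup>2 \<le> (xs - ys) \<bullet> (x - y)"
    and x: "(x, xs) \<in> gph_sub_rho f \<rho> \<inter> (U \<times> V)" and z: "(z, zs) \<in> tangent_f f (x, xs)"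
  shows "s * (norm z)\<^sup>2 \<le> zs \<bullet> z"
proof -
  obtain t p where t: "\<And>k. t k > 0" and p: "f_att_conv f p (x, xs)"
    and lim: "(\<lambda>k. (1 / t k) *\<^sub>R (p k - (x, xs))) \<longlonglongrightarrow> (z, zs)" using z unfolding tangent_f_def by blast
  define u where "u k = (1 / t k) *\<^sub>R (fst (p k) - x)" for k
  define us where "us k = (1 / t k) *\<^sub>R (snd (p k) - xs)" for k
  have u: "u \<longlonglongrightarrow> z" "us \<longlonglongrightarrow> zs"
    using tendsto_fst[OF lim] tendsto_snd[OF lim] by (auto simp: u_def[abs_def] us_def[abs_def])
  have "\<forall>\<^sub>F k in sequentially. p k \<in> gph_sub_rho f \<rho> \<inter> (U \<times> V)"
    by (rule f_att_conv_eventually[OF p UV]) (use x in \<open>auto simp: gph_sub_rho_def\<close>)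
  then have ev: "\<forall>\<^sub>F k in sequentially. s * (norm (u k))\<^sup>2 \<le> us k \<bullet> u k"
  proof (rule eventually_mono)
    fix k assume "p k \<in> gph_sub_rho f \<rho> \<inter> (U \<times> V)"
    then have "s * (norm (fst (p k) - x))\<^sup>2 \<le> (snd (p k) - xs) \<bullet> (fst (p k) - x)"
      using x by (intro mono) auto
    then have "(1 / t k)\<^sup>2 * (s * (norm (fst (p k) - x))\<^sup>2) \<le> (1 / t k)\<^sup>2 * ((snd (p k) - xs) \<bullet> (fst (p k) - x))"
      by (intro mult_left_mono) auto
    then show "s * (norm (u k))\<^sup>2 \<le> us k \<bullet> u k"
      unfolding u_def us_def norm_scaleR power_mult_distrib power2_abs inner_scaleR_left inner_scaleR_right
      by (simp add: power2_eq_square mult_ac)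
  qed
  have "(\<lambda>k. s * (norm (u k))\<^sup>2) \<longlonglongrightarrow> s * (norm z)\<^sup>2" "(\<lambda>k. us k \<bullet> u k) \<longlonglongrightarrow> zs \<bullet> z"
    by (intro tendsto_intros u)+
  then show ?thesis using tendsto_le[OF _ _ _ ev] by simp
qed

text \<open>\<open>onorm\<close> is a real supremum and dominates its quotients only when they are
  bounded above. Projections onto subspaces are nonexpansive and fix 0, which gives the bound 2; at
  0 the quotient is 0 by convention.\<close>

lemma norm_proj_diff_le:
  fixes L L' :: "((real^'n) \<times> (real^'n)) set"
  assumes "subspace L" "subspace L'"
  shows "norm (proj L q - proj L' q) \<le> dZ L L' * norm q"
proof -
  have np: "norm (proj M x) \<le> norm x" if M: "subspace M" for M :: "((real^'n) \<times> (real^'n)) set" and x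
  proof -
    have "0 \<in> M" using M by (rule subspace_0)
    then have "dist (closest_point M x) (closest_point M 0) \<le> dist x 0"
      using M by (intro closest_point_lipschitz) (auto simp: subspace_imp_convex closed_subspace)
    then show ?thesis using closest_point_self[OF \<open>0 \<in> M\<close>] by (simp add: proj_def)
  qed
  define h where "h x = norm (proj L x - proj L' x) / norm x" for x
  have "h x \<le> 2" for x
  proof (cases "x = 0")
    case False
    have "norm (proj L x - proj L' x) \<le> 2 * norm x"
      using norm_triangle_ineq4[of "proj L x" "proj L' x"] np[OF assms(1), of x] np[OF assms(2), of x] by linarith
    then show ?thesis using False by (simp add: h_def field_simps)
  qed (simp add: h_def)
  then have bdd: "bdd_above (range h)" by (auto intro!: bdd_aboveI[of _ 2])
  have "h q \<le> dZ L L'"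
    unfolding dZ_def onorm_def h_def[symmetric] by (rule cSUP_upper[OF _ bdd]) simp
  then show ?thesis
  proof (cases "q = 0")
    case True
    then show ?thesis using np[OF assms(1), of 0] np[OF assms(2), of 0] by simp
  qed (simp add: h_def field_simps)
qed

text \<open>A vector of \<open>L\<close> is approximated by its projections onto the tangent spaces
  at \<open>p k\<close>; these converge to it because \<open>dZ\<close> tends to 0, and the
  inequality passes to the limit.\<close>

lemma S_f_bound:
  fixes f :: "real^'n \<Rightarrow> ereal"
  assumes UV: "open U" "open V"
    and T: "\<And>x xs z zs. (x, xs) \<in> O_f f \<inter> (U \<times> V) \<Longrightarrow> f x < ereal \<rho> \<Longrightarrow> (z, zs) \<in> tangent_f f (x, xs) \<Longrightarrow> s * (norm z)\<^sup>2 \<le> zs \<bullet> z"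
    and x: "(x, xs) \<in> gph_sub_rho f \<rho> \<inter> (U \<times> V)" and L: "L \<in> S_f f (x, xs)" and z: "(z, zs) \<in> L"
  shows "s * (norm z)\<^sup>2 \<le> zs \<bullet> z"
proof -
  obtain p where LZ: "L \<in> Znn" and pO: "\<And>k. p k \<in> O_f f" and p: "f_att_conv f p (x, xs)"
    and lim: "(\<lambda>k. dZ L (tangent_f f (p k))) \<longlonglongrightarrow> 0" using L unfolding S_f_def by blast
  have subs: "subspace L" "subspace (tangent_f f (p k))" for k
    using LZ pO[of k] by (auto simp: Znn_def O_f_def)
  define y where "y k = proj (tangent_f f (p k)) (z, zs)" for k
  have yT: "y k \<in> tangent_f f (p k)" for k
    unfolding y_def proj_def using subs(2)[of k] subspace_0[OF subs(2)[of k]]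
    by (intro closest_point_in_set) (auto simp: closed_subspace)
  have pz: "proj L (z, zs) = (z, zs)" using z by (simp add: proj_def closest_point_self)
  have "y \<longlonglongrightarrow> (z, zs)"
  proof (rule Lim_null_comparison[THEN LIM_zero_cancel])
    show "\<forall>\<^sub>F k in sequentially. norm (y k - (z, zs)) \<le> dZ L (tangent_f f (p k)) * norm (z, zs)"
    proof (intro always_eventually allI)
      show "norm (y k - (z, zs)) \<le> dZ L (tangent_f f (p k)) * norm (z, zs)" for k
        using norm_proj_diff_le[OF subs(1) subs(2)[of k], of "(z, zs)"] unfolding pz y_def[symmetric]
        by (subst norm_minus_commute)
    qed
    show "(\<lambda>k. dZ L (tangent_f f (p k)) * norm (z, zs)) \<longlonglongrightarrow> 0" using lim by (rule tendsto_mult_left_zero)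
  qed
  then have yl: "(\<lambda>k. fst (y k)) \<longlonglongrightarrow> z" "(\<lambda>k. snd (y k)) \<longlonglongrightarrow> zs" using tendsto_fst tendsto_snd by fastforce+
  have "\<forall>\<^sub>F k in sequentially. p k \<in> gph_sub_rho f \<rho> \<inter> (U \<times> V)"
    by (rule f_att_conv_eventually[OF p UV]) (use x in \<open>auto simp: gph_sub_rho_def\<close>)
  then have ev: "\<forall>\<^sub>F k in sequentially. s * (norm (fst (y k)))\<^sup>2 \<le> snd (y k) \<bullet> fst (y k)"
  proof (rule eventually_mono)
    fix k assume pk: "p k \<in> gph_sub_rho f \<rho> \<inter> (U \<times> V)"
    obtain a b where ab: "p k = (a, b)" by (cases "p k")
    show "s * (norm (fst (y k)))\<^sup>2 \<le> snd (y k) \<bullet> fst (y k)"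
      by (rule T[of a b]) (use pk pO[of k] yT[of k] ab in \<open>auto simp: gph_sub_rho_def\<close>)
  qed
  have "(\<lambda>k. s * (norm (fst (y k)))\<^sup>2) \<longlonglongrightarrow> s * (norm z)\<^sup>2" "(\<lambda>k. snd (y k) \<bullet> fst (y k)) \<longlonglongrightarrow> zs \<bullet> z"
    by (intro tendsto_intros yl)+
  then show ?thesis using tendsto_le[OF _ _ _ ev] by simp
qed

lemma tangent_in_S_f:
  fixes f :: "real^'n \<Rightarrow> ereal"
  assumes "q \<in> O_f f"
  shows "tangent_f f q \<in> S_f f q"
  unfolding S_f_def
proof (intro CollectI conjI exI[of _ "\<lambda>_. q"])
  show "(\<lambda>k. dZ (tangent_f f q) (tangent_f f q)) \<longlonglongrightarrow> 0" by (simp add: dZ_def onorm_zero)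
qed (use assms in \<open>auto simp: O_f_def f_att_conv_const\<close>)

section \<open>Tangent subspaces and their matrix representation\<close>

text \<open>\<open>W\<close> is the identity on the kernel of \<open>P\<close>, which is orthogonal
  to the range. Replacing \<open>P *v v\<close> by \<open>v\<close> as the argument of
  \<open>W\<close> therefore does not change the inner product with \<open>P *v v\<close>.\<close>

lemma psd_iff:
  fixes P W :: "real^'n^'n"
  assumes P: "transpose P = P" "P ** P = P" and W: "W ** (mat 1 - P) = mat 1 - P"
  shows "psd (P ** W ** P - s *\<^sub>R P) \<longleftrightarrow> (\<forall>v. s * (norm (P *v v))\<^sup>2 \<le> (W *v v) \<bullet> (P *v v))"
proof -
  have sym: "x \<bullet> (P *v y) = (P *v x) \<bullet> y" for x y
    using P(1) by (metis dot_lmul_matrix transpose_matrix_vector)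
  have PP: "P *v (P *v x) = P *v x" for x using P(2) by (simp add: matrix_vector_mul_assoc)
  have "v \<bullet> ((P ** W ** P - s *\<^sub>R P) *v v) = (W *v v) \<bullet> (P *v v) - s * (norm (P *v v))\<^sup>2" for v
  proof -
    have "(W ** (mat 1 - P)) *v v = (mat 1 - P) *v v" using W by simp
    then have "W *v (v - P *v v) = v - P *v v"
      by (simp add: matrix_vector_mul_assoc[symmetric] matrix_vector_mult_diff_rdistrib)
    then have WP: "W *v (P *v v) = W *v v - (v - P *v v)" by (simp add: matrix_vector_mult_diff_distrib algebra_simps)
    have "(P *v v) \<bullet> (v - P *v v) = 0" by (simp add: inner_diff_right sym[symmetric] PP)
    then have "(P *v v) \<bullet> (W *v (P *v v)) = (P *v v) \<bullet> (W *v v)" unfolding WP by (simp add: inner_diff_right)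
    moreover have "v \<bullet> (P *v v) = (norm (P *v v))\<^sup>2" using sym[of v "P *v v"] unfolding PP power2_norm_eq_inner .
    moreover have "(P ** W ** P - s *\<^sub>R P) *v v = P *v (W *v (P *v v)) - s *\<^sub>R (P *v v)"
      by (simp add: matrix_vector_mult_diff_rdistrib matrix_vector_mul_assoc[symmetric] scaleR_matrix_vector_assoc)
    ultimately show ?thesis by (simp add: inner_diff_right sym[of v "W *v (P *v v)"] inner_commute[of "W *v v"])
  qed
  then show ?thesis by (simp add: psd_def)
qed

lemma transpose_matrix_selfadjoint:
  fixes h :: "real^'n \<Rightarrow> real^'n"
  assumes "\<And>x y. h x \<bullet> y = h y \<bullet> x"
  shows "transpose (matrix h) = matrix h"
proof -
  have "h (axis i 1) $ j = h (axis j 1) $ i" for i j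
    using assms[of "axis i 1" "axis j 1"] by (simp add: inner_axis)
  then show ?thesis by (simp add: vec_eq_iff transpose_def matrix_def)
qed

text \<open>\<open>P\<close> projects onto the range of \<open>B\<close>; \<open>B\<close> plus the complementary projection is invertible,
  and its inverse \<open>N\<close> acts as a pseudo-inverse of \<open>B\<close>.\<close>

lemma symmetric_graph_representation:
  fixes B :: "real^'n \<Rightarrow> real^'n"
  assumes lin: "linear B" and sym: "\<And>u v. B u \<bullet> v = B v \<bullet> u" and \<mu>: "\<mu> > 0"
  obtains P W :: "real^'n^'n" where "transpose P = P" "transpose W = W" "P ** P = P" "W ** (mat 1 - P) = mat 1 - P"
    "{(P *v p, W *v p) | p. True} = range (\<lambda>d. (B d, (d - B d) /\<^sub>R \<mu>))"
proof -
  have subZ: "subspace (range B)" using lin by (rule linear_subspace_image[OF _ subspace_UNIV])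
  obtain C where C: "C \<subseteq> range B" "pairwise orthogonal C" "\<And>x. x \<in> C \<Longrightarrow> norm x = 1" "independent C" "span C = range B"
    using orthonormal_basis_subspace[OF subZ] by metis
  have fin: "finite C" using C(4) by (rule independent_imp_finite)
  define p where "p x = (\<Sum>c\<in>C. (x \<bullet> c) *\<^sub>R c)" for x
  have linp: "linear p"
    unfolding p_def by (rule linearI) (simp_all add: inner_add_left scaleR_left_distrib sum.distrib scaleR_sum_right)
  have symp: "p x \<bullet> y = p y \<bullet> x" for x y
    unfolding p_def inner_sum_left inner_scaleR_left
    by (intro sum.cong refl) (metis inner_commute mult.commute)
  have pZ: "p x \<in> range B" for x
    unfolding p_def using C(1) by (intro subspace_sum[OF subZ] subspace_scale[OF subZ]) auto
  have pc: "p c = c" if "c \<in> C" for c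
  proof -
    have "p c = (\<Sum>c'\<in>C. if c' = c then c else 0)"
      unfolding p_def
    proof (rule sum.cong)
      fix c' assume c': "c' \<in> C"
      show "(c \<bullet> c') *\<^sub>R c' = (if c' = c then c else 0)"
      proof (cases "c' = c")
        case True then show ?thesis using C(3)[OF that] by (simp add: dot_square_norm)
      next
        case False
        then have "c \<bullet> c' = 0" using C(2) that c' by (auto simp: pairwise_def orthogonal_def)
        then show ?thesis using False by simp
      qed
    qed simp
    then show ?thesis using fin that by simp
  qed
  have pz: "p z = z" if "z \<in> range B" for z
    using linear_eq_on_span[OF linp linear_id, of C z] pc that C(5) by auto
  have pp: "p (p x) = p x" for x using pz[OF pZ] .
  have pB: "p (B x) = B x" for x by (rule pz) simp
  have padd: "p (x + y) = p x + p y" "p (x - y) = p x - p y" for x y using linp by (auto simp: linear_add linear_diff)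
  have Badd: "B (x + y) = B x + B y" "B (x - y) = B x - B y" for x y using lin by (auto simp: linear_add linear_diff)
  have Bp: "B (p x) = B x" for x
  proof -
    have "B (x - p x) \<bullet> y = 0" for y
    proof -
      have "B (x - p x) \<bullet> y = B y \<bullet> (x - p x)" by (rule sym)
      also have "\<dots> = B y \<bullet> x - p x \<bullet> B y" by (simp add: inner_diff_right inner_commute)
      also have "p x \<bullet> B y = p (B y) \<bullet> x" by (rule symp)
      finally show ?thesis by (simp add: pB)
    qed
    then have "B (x - p x) = 0" using inner_eq_zero_iff by blast
    then show ?thesis by (simp add: Badd)
  qed
  define M where "M x = B x + (x - p x)" for x
  have linM: "linear M" unfolding M_def by (intro linear_compose_add linear_compose_sub lin linp linear_ident)
  have pM: "p (M x) = B x" for x by (simp add: M_def padd pB pp)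
  have Mp: "M (p x) = B x" for x by (simp add: M_def Bp pp)
  \<comment> \<open>A kernel vector of \<open>M\<close> lies in both the range and the kernel of
    \<open>B\<close>, which are orthogonal by symmetry.\<close>
  have inj: "inj M"
    unfolding linear_injective_0[OF linM]
  proof (intro allI impI)
    fix x assume M0: "M x = 0"
    then have "B x = 0" using pM[of x] linear_0[OF linp] by simp
    moreover have "x = p x" using M0 \<open>B x = 0\<close> by (simp add: M_def)
    ultimately obtain y where y: "x = B y" using pZ[of x] by (metis imageE)
    have "x \<bullet> x = B y \<bullet> x" using y by simp
    also have "\<dots> = B x \<bullet> y" by (rule sym)
    finally show "x = 0" using \<open>B x = 0\<close> by simp
  qed
  obtain N where N: "linear N" "N \<circ> M = id" using linear_injective_left_inverse[OF linM inj] by blast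
  have NM: "N (M x) = x" for x using N(2) by (metis comp_apply id_apply)
  have surj: "surj M" using linear_injective_imp_surjective[OF linM inj] by simp
  have MN: "M (N x) = x" for x using surj NM by (metis surjD)
  have symM: "M x \<bullet> y = M y \<bullet> x" for x y
    using sym[of x y] symp[of x y] by (simp add: M_def inner_add_left inner_diff_left inner_commute[of x y])
  have symN: "N x \<bullet> y = N y \<bullet> x" for x y
    using symM[of "N y" "N x"] by (simp add: MN inner_commute)
  have Np: "N (p x) = p (N x)" for x
  proof -
    have "p x = p (M (N x))" by (simp add: MN)
    also have "\<dots> = M (p (N x))" by (simp add: pM Mp)
    finally show ?thesis by (simp add: NM)
  qed
  \<comment> \<open>On the range of \<open>B\<close> the map \<open>N\<close> inverts
    \<open>B\<close>, so the partner of \<open>z = B d\<close> is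
    \<open>(N z - z) /\<^sub>R \<mu>\<close>, up to the kernel component of \<open>d\<close>; on the
    orthogonal complement \<open>Wf\<close> is the prescribed identity.\<close>
  define Wf where "Wf x = (N (p x) - p x) /\<^sub>R \<mu> + (x - p x)" for x
  have linW: "linear Wf"
    unfolding Wf_def
    by (intro linear_compose_add linear_compose_sub linear_compose_scale_right linear_compose[OF linp N(1), unfolded comp_def] linp linear_ident)
  have symNp: "N (p x) \<bullet> y = N (p y) \<bullet> x" for x y
  proof -
    have "N (p x) \<bullet> y = N y \<bullet> p x" by (rule symN)
    also have "\<dots> = p (N y) \<bullet> x" using symp[of x "N y"] by (simp add: inner_commute)
    finally show ?thesis by (simp add: Np)
  qed
  have symW: "Wf x \<bullet> y = Wf y \<bullet> x" for x y
    using symNp[of x y] symp[of x y] by (simp add: Wf_def inner_add_left inner_diff_left inner_commute[of x y])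
  have mv: "matrix p *v x = p x" "matrix Wf *v x = Wf x" for x
    using matrix_vector_mul(2)[OF linp] matrix_vector_mul(2)[OF linW] by metis+
  show ?thesis
  proof (rule that[of "matrix p" "matrix Wf"])
    show "transpose (matrix p) = matrix p" "transpose (matrix Wf) = matrix Wf"
      using transpose_matrix_selfadjoint symp symW by blast+
    show "matrix p ** matrix p = matrix p"
      by (simp add: matrix_eq matrix_vector_mul_assoc[symmetric] mv pp)
    show "matrix Wf ** (mat 1 - matrix p) = mat 1 - matrix p"
      by (simp add: matrix_eq matrix_vector_mul_assoc[symmetric] matrix_vector_mult_diff_rdistrib mv Wf_def padd pp linear_0[OF N(1)])
    show "{(matrix p *v q, matrix Wf *v q) | q. True} = range (\<lambda>d. (B d, (d - B d) /\<^sub>R \<mu>))"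
    proof (intro equalityI subsetI)
      fix a assume "a \<in> {(matrix p *v q, matrix Wf *v q) | q. True}"
      then obtain q where a: "a = (p q, Wf q)" by (auto simp: mv)
      \<comment> \<open>The kernel component of \<open>d\<close> is free; the factor
        \<open>\<mu>\<close> compensates the later division.\<close>
      define d where "d = N (p q) + \<mu> *\<^sub>R (q - p q)"
      have BN: "B (N (p q)) = p q" using pM[of "N (p q)"] by (simp add: MN pp)
      have "B (q - p q) = 0" by (simp add: Badd Bp)
      moreover have "B d = B (N (p q)) + \<mu> *\<^sub>R B (q - p q)" unfolding d_def Badd(1) by (simp only: linear_cmul[OF lin])
      ultimately have Bd: "B d = p q" by (simp add: BN)
      have "(d - B d) /\<^sub>R \<mu> = Wf q" unfolding Bd using \<mu> by (simp add: Wf_def d_def scaleR_diff_right scaleR_add_right)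
      then show "a \<in> range (\<lambda>d. (B d, (d - B d) /\<^sub>R \<mu>))" using a Bd by (intro image_eqI[of _ _ d]) auto
    next
      fix a assume "a \<in> range (\<lambda>d. (B d, (d - B d) /\<^sub>R \<mu>))"
      then obtain d where a: "a = (B d, (d - B d) /\<^sub>R \<mu>)" by blast
      define q where "q = B d + (d - p d) /\<^sub>R \<mu>"
      have pq: "p q = B d" using linp by (simp add: q_def padd pB linear_cmul pp)
      have "N (B d) = p d" using NM[of "p d"] by (simp add: Mp)
      then have "Wf q = (d - B d) /\<^sub>R \<mu>" by (simp add: Wf_def pq) (simp add: q_def scaleR_diff_right)
      then show "a \<in> {(matrix p *v q, matrix Wf *v q) | q. True}" using a pq by (auto simp: mv intro!: exI[of _ q])
    qed
  qed
qed

text \<open>Where \<open>P\<close> is differentiable the tangent cone is a subspace, and symmetry of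
  \<open>B\<close> makes \<open>((d - B d) /\<^sub>R \<mu>, - B d)\<close> orthogonal to it. Every
  tangent pair is thus also a coderivative pair and falls under the hypothesis.\<close>

lemma (in prox_param) var_s_convex_of_reg_coderiv_bound:
  assumes \<kappa>: "1 + \<mu> * s > 0" and UV: "open U" "open V" "xb \<in> U" "xbs \<in> V" "f xb < ereal \<rho>"
    and reg: "\<And>x xs z zs. (x, xs) \<in> gph_sub_rho f \<rho> \<inter> (U \<times> V) \<Longrightarrow> zs \<in> reg_coderiv_f f x xs z \<Longrightarrow> s * (norm z)\<^sup>2 \<le> zs \<bullet> z"
  shows "var_s_convex s f xb xbs"
proof -
  obtain \<delta>' where \<delta>': "0 < \<delta>'" "\<delta>' \<le> \<delta>" and gph: "\<And>w. w \<in> ball wb \<delta>' \<Longrightarrow> (P w, G w) \<in> gph_sub_rho f \<rho> \<inter> (U \<times> V)"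
    using graph_near_base[OF UV] by metis
  show ?thesis
  proof (rule var_s_convex_of_derivative_bound[OF \<kappa> \<delta>'])
    fix w B d assume w: "w \<in> ball wb \<delta>'" and B: "(P has_derivative B) (at w)"
    have w\<delta>: "w \<in> ball wb \<delta>" using w \<delta>' by auto
    note sym = P_derivative_symmetric[OF w\<delta> B]
    have "((d - B d) /\<^sub>R \<mu>) \<bullet> B c + - B d \<bullet> ((c - B c) /\<^sub>R \<mu>) = 0" for c
    proof -
      have "(d - B d) \<bullet> B c - B d \<bullet> (c - B c) = 0"
        using sym[of c d] by (simp add: inner_diff_left inner_diff_right inner_commute[of d])
      then show ?thesis by (simp flip: right_diff_distrib)
    qed
    then have "(d - B d) /\<^sub>R \<mu> \<in> reg_coderiv_f f (P w) (G w) (B d)"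
      unfolding reg_coderiv_f_def reg_normal_f_def tangent_eq_range[OF w\<delta> B]
      by (auto simp: inner_prod_def simp del: inner_scaleR_left inner_scaleR_right inner_minus_left)
    then show "s * (norm (B d))\<^sup>2 \<le> ((d - B d) /\<^sub>R \<mu>) \<bullet> B d" by (rule reg[OF gph[OF w]])
  qed
qed

text \<open>The pair \<open>(B d, (d - B d) /\<^sub>R \<mu>)\<close> determines \<open>d\<close>, so
  the tangent space has full dimension even when \<open>B\<close> is singular.\<close>

lemma derivative_point_in_O_f:
  fixes f :: "real^'n \<Rightarrow> ereal"
  assumes "prox_param f xb xbs \<epsilon> r \<mu> \<delta> P" and w: "w \<in> ball (xb + \<mu> *\<^sub>R xbs) \<delta>" and B: "(P has_derivative B) (at w)"
  shows "(P w, prox_param.G \<mu> P w) \<in> O_f f"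
proof -
  interpret prox_param f xb xbs \<epsilon> r \<mu> \<delta> P by fact
  let ?T = "\<lambda>d. (B d, (d - B d) /\<^sub>R \<mu>)"
  have lin: "linear B" using B by (rule has_derivative_linear)
  have linT: "linear ?T"
    using lin by (intro linearI) (auto simp: linear_add linear_cmul algebra_simps)
  have "inj ?T"
  proof (rule injI)
    fix d d' assume "?T d = ?T d'"
    then have "B d = B d'" "(d - B d) /\<^sub>R \<mu> = (d' - B d') /\<^sub>R \<mu>" by auto
    then show "d = d'" using \<mu>(1) by simp
  qed
  then have "dim (range ?T) = dim (UNIV :: (real^'n) set)"
    by (intro dim_image_eq[OF linT]) (auto intro: inj_on_subset)
  then have "dim (range ?T) = CARD('n)" by simp
  moreover have "subspace (range ?T)" by (rule linear_subspace_image[OF linT subspace_UNIV])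
  ultimately have "tangent_f f (P w, G w) \<in> Znn" unfolding tangent_eq_range[OF w B] Znn_def by simp
  moreover have "(P w, G w) \<in> gph_sub f" using in_graph[OF w] by (simp add: attentive_def)
  ultimately show ?thesis by (simp add: O_f_def)
qed

lemma var_s_convex_of_tangent_bound:
  fixes f :: "real^'n \<Rightarrow> ereal"
  assumes pp: "prox_param f xb xbs \<epsilon> r \<mu> \<delta> P" and \<kappa>: "1 + \<mu> * s > 0"
    and UV: "open U" "open V" "xb \<in> U" "xbs \<in> V" "f xb < ereal \<rho>"
    and T: "\<And>x xs z zs. (x, xs) \<in> O_f f \<inter> (U \<times> V) \<Longrightarrow> f x < ereal \<rho> \<Longrightarrow> (z, zs) \<in> tangent_f f (x, xs) \<Longrightarrow> s * (norm z)\<^sup>2 \<le> zs \<bullet> z"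
  shows "var_s_convex s f xb xbs"
proof -
  interpret prox_param f xb xbs \<epsilon> r \<mu> \<delta> P by fact
  obtain \<delta>' where \<delta>': "0 < \<delta>'" "\<delta>' \<le> \<delta>" and gph: "\<And>w. w \<in> ball wb \<delta>' \<Longrightarrow> (P w, G w) \<in> gph_sub_rho f \<rho> \<inter> (U \<times> V)"
    using graph_near_base[OF UV] by metis
  show ?thesis
  proof (rule var_s_convex_of_derivative_bound[OF \<kappa> \<delta>'])
    fix w B d assume w: "w \<in> ball wb \<delta>'" and B: "(P has_derivative B) (at w)"
    have w\<delta>: "w \<in> ball wb \<delta>" using w \<delta>' by auto
    show "s * (norm (B d))\<^sup>2 \<le> ((d - B d) /\<^sub>R \<mu>) \<bullet> B d"
    proof (rule T)
      show "(P w, G w) \<in> O_f f \<inter> (U \<times> V)" using derivative_point_in_O_f[OF pp w\<delta> B] gph[OF w] by blast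
      show "f (P w) < ereal \<rho>" using gph[OF w] by (simp add: gph_sub_rho_def)
      show "(B d, (d - B d) /\<^sub>R \<mu>) \<in> tangent_f f (P w, G w)" unfolding tangent_eq_range[OF w\<delta> B] by blast
    qed
  qed
qed

lemma var_s_convex_of_psd:
  fixes f :: "real^'n \<Rightarrow> ereal"
  assumes pp: "prox_param f xb xbs \<epsilon> r \<mu> \<delta> P" and \<kappa>: "1 + \<mu> * s > 0"
    and UV: "open U" "open V" "xb \<in> U" "xbs \<in> V" "f xb < ereal \<rho>"
    and psd: "\<And>x xs P W. (x, xs) \<in> gph_sub_rho f \<rho> \<inter> (U \<times> V) \<Longrightarrow> (P, W) \<in> M_PW f (x, xs) \<Longrightarrow> psd (P ** W ** P - s *\<^sub>R P)"
  shows "var_s_convex s f xb xbs"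
proof -
  interpret prox_param f xb xbs \<epsilon> r \<mu> \<delta> P by fact
  obtain \<delta>' where \<delta>': "0 < \<delta>'" "\<delta>' \<le> \<delta>" and gph: "\<And>w. w \<in> ball wb \<delta>' \<Longrightarrow> (P w, G w) \<in> gph_sub_rho f \<rho> \<inter> (U \<times> V)"
    using graph_near_base[OF UV] by metis
  show ?thesis
  proof (rule var_s_convex_of_derivative_bound[OF \<kappa> \<delta>'])
    fix w B d assume w: "w \<in> ball wb \<delta>'" and B: "(P has_derivative B) (at w)"
    have w\<delta>: "w \<in> ball wb \<delta>" using w \<delta>' by auto
    obtain Q W :: "real^'n^'n" where Q: "transpose Q = Q" "transpose W = W" "Q ** Q = Q" "W ** (mat 1 - Q) = mat 1 - Q"
      and eq: "{(Q *v p, W *v p) | p. True} = range (\<lambda>d. (B d, (d - B d) /\<^sub>R \<mu>))"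
      using symmetric_graph_representation[OF has_derivative_linear[OF B] P_derivative_symmetric[OF w\<delta> B] \<mu>(1)] by blast
    have "(Q, W) \<in> M_PW f (P w, G w)"
    proof -
      have "{(Q *v p, W *v p) | p. True} \<in> S_f f (P w, G w)"
        unfolding eq tangent_eq_range[OF w\<delta> B, symmetric] by (rule tangent_in_S_f[OF derivative_point_in_O_f[OF pp w\<delta> B]])
      then show ?thesis unfolding M_PW_def mem_Collect_eq prod.case using Q by (intro conjI)
    qed
    then have "psd (Q ** W ** Q - s *\<^sub>R Q)" by (rule psd[OF gph[OF w]])
    then have "s * (norm (Q *v p))\<^sup>2 \<le> (W *v p) \<bullet> (Q *v p)" for p
      using psd_iff[OF Q(1,3,4)] by blast
    moreover obtain p where "Q *v p = B d" "W *v p = (d - B d) /\<^sub>R \<mu>"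
    proof -
      have "(B d, (d - B d) /\<^sub>R \<mu>) \<in> {(Q *v p, W *v p) | p. True}" unfolding eq by blast
      then show ?thesis using that by auto
    qed
    ultimately show "s * (norm (B d))\<^sup>2 \<le> ((d - B d) /\<^sub>R \<mu>) \<bullet> B d" by metis
  qed
qed

text \<open>Monotonicity of the graph makes the reflection nonexpansive on a whole parameter ball.
  Each graph point near the base pair has its parameter inside this open ball, which is the local
  form that the coderivative estimate asks for.\<close>

lemma reg_coderiv_bound_of_var_s_convex:
  fixes f :: "'a::euclidean_space \<Rightarrow> ereal"
  assumes "lsc f" and ninf: "\<And>x. f x \<noteq> -\<infinity>" and "f xb \<noteq> \<infinity>" and "xbs \<in> lsub f xb" and vc: "var_s_convex s f xb xbs"
  obtains U V \<rho> where "open U" "open V" "xb \<in> U" "xbs \<in> V" "f xb < ereal \<rho>"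
    "\<And>x xs z zs. (x, xs) \<in> gph_sub_rho f \<rho> \<inter> (U \<times> V) \<Longrightarrow> zs \<in> reg_coderiv_f f x xs z \<Longrightarrow> s * (norm z)\<^sup>2 \<le> zs \<bullet> z"
proof -
  obtain \<epsilon> r \<mu> \<delta> P where pp: "prox_param f xb xbs \<epsilon> r \<mu> \<delta> P" and \<kappa>: "1 + \<mu> * s > 0"
    using prox_regular_param[OF assms(1-4) prox_regular_of_var_s_convex[OF vc ninf]] by blast
  interpret prox_param f xb xbs \<epsilon> r \<mu> \<delta> P by fact
  obtain U V \<rho> where U: "open U" "open V" "xb \<in> U" "xbs \<in> V" "f xb < ereal \<rho>" and
    mono: "\<And>x xs y ys. (x, xs) \<in> gph_sub_rho f \<rho> \<inter> (U \<times> V) \<Longrightarrow> (y, ys) \<in> gph_sub_rho f \<rho> \<inter> (U \<times> V) \<Longrightarrow>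
       s * (norm (x - y))\<^sup>2 \<le> (xs - ys) \<bullet> (x - y)"
    using var_s_convex_monotone[OF vc ninf] by metis
  obtain \<delta>' where \<delta>': "0 < \<delta>'" "\<delta>' \<le> \<delta>" and
    ne: "\<And>w w'. w \<in> ball wb \<delta>' \<Longrightarrow> w' \<in> ball wb \<delta>' \<Longrightarrow> norm ((2 * (1 + \<mu> * s)) *\<^sub>R (P w - P w') - (w - w')) \<le> norm (w - w')"
    using nonexpansive_of_monotone[OF refl \<kappa> U mono] by blast
  obtain \<eta> where \<eta>: "0 < \<eta>" and
    gph: "\<And>x xs. (x, xs) \<in> gph_sub_rho f (\<phi> xb + \<epsilon>) \<inter> (ball xb \<eta> \<times> ball xbs \<eta>) \<Longrightarrow>
       x + \<mu> *\<^sub>R xs \<in> ball wb \<delta>' \<and> P (x + \<mu> *\<^sub>R xs) = x \<and> G (x + \<mu> *\<^sub>R xs) = xs"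
    using graph_parametrised[OF \<delta>'] by metis
  show ?thesis
  proof (rule that[of "ball xb \<eta>" "ball xbs \<eta>" "\<phi> xb + \<epsilon>"])
    show "f xb < ereal (\<phi> xb + \<epsilon>)" using f_xb \<epsilon> by simp
    fix x xs z zs assume x: "(x, xs) \<in> gph_sub_rho f (\<phi> xb + \<epsilon>) \<inter> (ball xb \<eta> \<times> ball xbs \<eta>)" and zs: "zs \<in> reg_coderiv_f f x xs z"
    let ?w = "x + \<mu> *\<^sub>R xs"
    have w: "?w \<in> ball wb \<delta>'" "P ?w = x" "G ?w = xs" using gph[OF x] by auto
    have "\<forall>\<^sub>F w' in nhds ?w. norm ((2 * (1 + \<mu> * s)) *\<^sub>R (P w' - P ?w) - (w' - ?w)) \<le> norm (w' - ?w)"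
      using eventually_nhds_in_open[OF open_ball w(1)] by (rule eventually_mono) (rule ne[OF _ w(1)])
    moreover have "?w \<in> ball wb \<delta>" using w(1) \<delta>'(2) by auto
    moreover have "(zs, - z) \<in> reg_normal_f f (P ?w, G ?w)" using zs unfolding w by (simp add: reg_coderiv_f_def)
    ultimately show "s * (norm z)\<^sup>2 \<le> zs \<bullet> z"
      using coderivative_bound_of_nonexpansive[OF refl \<kappa>] by blast
  qed (use \<eta> in auto)
qed

theorem theorem4p3:
  fixes f :: "real^'n \<Rightarrow> ereal" and xb xbs :: "real^'n" and s :: real
  assumes "lsc f" and "\<forall>x. f x \<noteq> -\<infinity>"
    and "f xb \<noteq> \<infinity>" and "xbs \<in> lsub f xb"
  shows
   "(var_s_convex s f xb xbs \<longleftrightarrow>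
      prox_regular f xb xbs \<and> (\<exists>U V \<rho>. open U \<and> open V \<and> xb \<in> U \<and> xbs \<in> V \<and> ereal \<rho> > f xb \<and>
        (\<forall>x xs z zs. (x, xs) \<in> gph_sub_rho f \<rho> \<inter> (U \<times> V) \<and> zs \<in> reg_coderiv_f f x xs z
            \<longrightarrow> zs \<bullet> z \<ge> s * (norm z)\<^sup>2))) \<and>
    (var_s_convex s f xb xbs \<longleftrightarrow>
      prox_regular f xb xbs \<and> (\<exists>U V \<rho>. open U \<and> open V \<and> xb \<in> U \<and> xbs \<in> V \<and> ereal \<rho> > f xb \<and>
        (\<forall>x xs z zs. (x, xs) \<in> gph_sub_rho f \<rho> \<inter> (U \<times> V) \<and> zs \<in> lim_coderiv_f f x xs z
            \<longrightarrow> zs \<bullet> z \<ge> s * (norm z)\<^sup>2))) \<and>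
    (var_s_convex s f xb xbs \<longleftrightarrow>
      prox_regular f xb xbs \<and> (\<exists>U V \<rho>. open U \<and> open V \<and> xb \<in> U \<and> xbs \<in> V \<and> ereal \<rho> > f xb \<and>
        (\<forall>x xs z zs. (x, xs) \<in> O_f f \<inter> (U \<times> V) \<and> f x < ereal \<rho> \<and> (z, zs) \<in> tangent_f f (x, xs)
            \<longrightarrow> zs \<bullet> z \<ge> s * (norm z)\<^sup>2))) \<and>
    (var_s_convex s f xb xbs \<longleftrightarrow>
      prox_regular f xb xbs \<and> (\<exists>U V \<rho>. open U \<and> open V \<and> xb \<in> U \<and> xbs \<in> V \<and> ereal \<rho> > f xb \<and>
        (\<forall>x xs z zs L. (x, xs) \<in> gph_sub_rho f \<rho> \<inter> (U \<times> V) \<and> L \<in> S_f f (x, xs) \<and> (z, zs) \<in> L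
            \<longrightarrow> zs \<bullet> z \<ge> s * (norm z)\<^sup>2))) \<and>
    (var_s_convex s f xb xbs \<longleftrightarrow>
      prox_regular f xb xbs \<and> (\<exists>U V \<rho>. open U \<and> open V \<and> xb \<in> U \<and> xbs \<in> V \<and> ereal \<rho> > f xb \<and>
        (\<forall>x xs P W. (x, xs) \<in> gph_sub_rho f \<rho> \<inter> (U \<times> V) \<and> (P, W) \<in> M_PW f (x, xs)
            \<longrightarrow> psd (P ** W ** P - s *\<^sub>R P))))"
proof -
  have ninf: "\<And>x. f x \<noteq> -\<infinity>" using assms(2) by blast
  let "(?V \<longleftrightarrow> ?PR \<and> ?E2) \<and> (_ \<longleftrightarrow> _ \<and> ?E3) \<and> (_ \<longleftrightarrow> _ \<and> ?E4) \<and> (_ \<longleftrightarrow> _ \<and> ?E5) \<and> (_ \<longleftrightarrow> _ \<and> ?E6)" = ?thesis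
  \<comment> \<open>\<open>e3\<close> returns to \<open>v\<close> through \<open>e2\<close>, and
    \<open>e5\<close> through \<open>e6\<close>. The passages between \<open>e2\<close> and
    \<open>e3\<close> and from \<open>e4\<close> to \<open>e6\<close> keep the same neighbourhood
    and \<open>\<rho>\<close>.\<close>
  have logic: "(v \<longleftrightarrow> pr \<and> e2) \<and> (v \<longleftrightarrow> pr \<and> e3) \<and> (v \<longleftrightarrow> pr \<and> e4) \<and> (v \<longleftrightarrow> pr \<and> e5) \<and> (v \<longleftrightarrow> pr \<and> e6)"
    if "v \<Longrightarrow> pr" "v \<Longrightarrow> e2" "v \<Longrightarrow> e4" "e2 \<Longrightarrow> e3" "e3 \<Longrightarrow> e2" "e4 \<Longrightarrow> e5" "e5 \<Longrightarrow> e6"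
      "pr \<Longrightarrow> e2 \<Longrightarrow> v" "pr \<Longrightarrow> e4 \<Longrightarrow> v" "pr \<Longrightarrow> e6 \<Longrightarrow> v" for v pr e2 e3 e4 e5 e6
    using that by blast
  have param: "\<exists>\<epsilon> r \<mu> \<delta> P. prox_param f xb xbs \<epsilon> r \<mu> \<delta> P \<and> 1 + \<mu> * s > 0" if "prox_regular f xb xbs"
    using prox_regular_param[OF assms(1) ninf assms(3,4) that] by metis
  show ?thesis
  proof (rule logic)
    assume ?V
    then show ?PR by (rule prox_regular_of_var_s_convex[OF _ ninf])
  next
    assume v: ?V
    obtain U V \<rho> where U: "open U" "open V" "xb \<in> U" "xbs \<in> V" "f xb < ereal \<rho>"
      and reg: "\<And>x xs z zs. (x, xs) \<in> gph_sub_rho f \<rho> \<inter> (U \<times> V) \<Longrightarrow> zs \<in> reg_coderiv_f f x xs z \<Longrightarrow> s * (norm z)\<^sup>2 \<le> zs \<bullet> z"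
      using reg_coderiv_bound_of_var_s_convex[OF assms(1) ninf assms(3,4) v] by metis
    show ?E2
    proof (rule exI[of _ U], rule exI[of _ V], rule exI[of _ \<rho>], intro conjI U allI impI)
      fix x xs z zs assume "(x, xs) \<in> gph_sub_rho f \<rho> \<inter> (U \<times> V) \<and> zs \<in> reg_coderiv_f f x xs z"
      then show "s * (norm z)\<^sup>2 \<le> zs \<bullet> z" by (elim conjE) (rule reg)
    qed
  next
    assume v: ?V
    obtain U V \<rho> where U: "open U" "open V" "xb \<in> U" "xbs \<in> V" "f xb < ereal \<rho>"
      and mono: "\<And>x xs y ys. (x, xs) \<in> gph_sub_rho f \<rho> \<inter> (U \<times> V) \<Longrightarrow> (y, ys) \<in> gph_sub_rho f \<rho> \<inter> (U \<times> V) \<Longrightarrow>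
        s * (norm (x - y))\<^sup>2 \<le> (xs - ys) \<bullet> (x - y)"
      using var_s_convex_monotone[OF v ninf] by metis
    show ?E4
    proof (rule exI[of _ U], rule exI[of _ V], rule exI[of _ \<rho>], intro conjI U allI impI)
      fix x xs z zs assume h: "(x, xs) \<in> O_f f \<inter> (U \<times> V) \<and> f x < ereal \<rho> \<and> (z, zs) \<in> tangent_f f (x, xs)"
      then have x: "(x, xs) \<in> gph_sub_rho f \<rho> \<inter> (U \<times> V)" by (auto simp: O_f_def gph_sub_def gph_sub_rho_def)
      show "s * (norm z)\<^sup>2 \<le> zs \<bullet> z"
        by (rule tangent_bound_of_monotone[OF U(1,2)], erule (1) mono, rule x, rule conjunct2[OF conjunct2[OF h]])
    qed
  next
    assume ?E2
    then obtain U V \<rho> where U: "open U" "open V" "xb \<in> U" "xbs \<in> V" "f xb < ereal \<rho>"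
      and *: "\<forall>x xs z zs. (x, xs) \<in> gph_sub_rho f \<rho> \<inter> (U \<times> V) \<and> zs \<in> reg_coderiv_f f x xs z \<longrightarrow> zs \<bullet> z \<ge> s * (norm z)\<^sup>2"
      by (elim exE conjE) (rule that)
    have reg: "zs \<bullet> z \<ge> s * (norm z)\<^sup>2" if "(x, xs) \<in> gph_sub_rho f \<rho> \<inter> (U \<times> V)" "zs \<in> reg_coderiv_f f x xs z" for x xs z zs
      by (rule *[rule_format, OF conjI[OF that]])
    show ?E3
    proof (rule exI[of _ U], rule exI[of _ V], rule exI[of _ \<rho>], intro conjI U allI impI)
      fix x xs z zs assume h: "(x, xs) \<in> gph_sub_rho f \<rho> \<inter> (U \<times> V) \<and> zs \<in> lim_coderiv_f f x xs z"
      show "s * (norm z)\<^sup>2 \<le> zs \<bullet> z"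
        by (rule lim_coderiv_bound[OF U(1,2)], erule (1) reg, rule conjunct1[OF h], rule conjunct2[OF h])
    qed
  next
    assume ?E3
    then obtain U V \<rho> where U: "open U" "open V" "xb \<in> U" "xbs \<in> V" "f xb < ereal \<rho>"
      and *: "\<forall>x xs z zs. (x, xs) \<in> gph_sub_rho f \<rho> \<inter> (U \<times> V) \<and> zs \<in> lim_coderiv_f f x xs z \<longrightarrow> zs \<bullet> z \<ge> s * (norm z)\<^sup>2"
      by (elim exE conjE) (rule that)
    have lim: "zs \<bullet> z \<ge> s * (norm z)\<^sup>2" if "(x, xs) \<in> gph_sub_rho f \<rho> \<inter> (U \<times> V)" "zs \<in> lim_coderiv_f f x xs z" for x xs z zs
      by (rule *[rule_format, OF conjI[OF that]])
    show ?E2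
    proof (rule exI[of _ U], rule exI[of _ V], rule exI[of _ \<rho>], intro conjI U allI impI)
      fix x xs z zs assume h: "(x, xs) \<in> gph_sub_rho f \<rho> \<inter> (U \<times> V) \<and> zs \<in> reg_coderiv_f f x xs z"
      then have "(x, xs) \<in> gph_sub f" by (auto simp: gph_sub_def gph_sub_rho_def)
      from subsetD[OF reg_coderiv_subset_lim_coderiv[OF this] conjunct2[OF h]]
      show "s * (norm z)\<^sup>2 \<le> zs \<bullet> z" by (rule lim[OF conjunct1[OF h]])
    qed
  next
    assume ?E4
    then obtain U V \<rho> where U: "open U" "open V" "xb \<in> U" "xbs \<in> V" "f xb < ereal \<rho>"
      and *: "\<forall>x xs z zs. (x, xs) \<in> O_f f \<inter> (U \<times> V) \<and> f x < ereal \<rho> \<and> (z, zs) \<in> tangent_f f (x, xs) \<longrightarrow> zs \<bullet> z \<ge> s * (norm z)\<^sup>2"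
      by (elim exE conjE) (rule that)
    have T: "zs \<bullet> z \<ge> s * (norm z)\<^sup>2" if "(x, xs) \<in> O_f f \<inter> (U \<times> V)" "f x < ereal \<rho>" "(z, zs) \<in> tangent_f f (x, xs)" for x xs z zs
      by (rule *[rule_format, OF conjI[OF that(1) conjI[OF that(2,3)]]])
    show ?E5
    proof (rule exI[of _ U], rule exI[of _ V], rule exI[of _ \<rho>], intro conjI U allI impI)
      fix x xs z zs L assume h: "(x, xs) \<in> gph_sub_rho f \<rho> \<inter> (U \<times> V) \<and> L \<in> S_f f (x, xs) \<and> (z, zs) \<in> L"
      show "s * (norm z)\<^sup>2 \<le> zs \<bullet> z"
        by (rule S_f_bound[OF U(1,2)], erule (2) T, rule conjunct1[OF h], rule conjunct1[OF conjunct2[OF h]], rule conjunct2[OF conjunct2[OF h]])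
    qed
  next
    assume ?E5
    then obtain U V \<rho> where U: "open U" "open V" "xb \<in> U" "xbs \<in> V" "f xb < ereal \<rho>"
      and *: "\<forall>x xs z zs L. (x, xs) \<in> gph_sub_rho f \<rho> \<inter> (U \<times> V) \<and> L \<in> S_f f (x, xs) \<and> (z, zs) \<in> L \<longrightarrow> zs \<bullet> z \<ge> s * (norm z)\<^sup>2"
      by (elim exE conjE) (rule that)
    have S: "zs \<bullet> z \<ge> s * (norm z)\<^sup>2" if "(x, xs) \<in> gph_sub_rho f \<rho> \<inter> (U \<times> V)" "L \<in> S_f f (x, xs)" "(z, zs) \<in> L" for x xs z zs L
      by (rule *[rule_format, OF conjI[OF that(1) conjI[OF that(2,3)]]])
    show ?E6
    proof (rule exI[of _ U], rule exI[of _ V], rule exI[of _ \<rho>], intro conjI U allI impI)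
      fix x xs P W assume h: "(x, xs) \<in> gph_sub_rho f \<rho> \<inter> (U \<times> V) \<and> (P, W) \<in> M_PW f (x, xs)"
      then have P: "transpose P = P" "P ** P = P" "W ** (mat 1 - P) = mat 1 - P" and L: "{(P *v p, W *v p) | p. True} \<in> S_f f (x, xs)"
        unfolding M_PW_def by blast+
      have "s * (norm (P *v v))\<^sup>2 \<le> (W *v v) \<bullet> (P *v v)" for v
        by (rule S[OF conjunct1[OF h] L]) blast
      then show "psd (P ** W ** P - s *\<^sub>R P)" unfolding psd_iff[OF P] by blast
    qed
  next
    assume ?PR ?E2
    from param[OF \<open>?PR\<close>] obtain \<epsilon> r \<mu> \<delta> P where pp: "prox_param f xb xbs \<epsilon> r \<mu> \<delta> P" and \<kappa>: "1 + \<mu> * s > 0" by blast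
    from \<open>?E2\<close> obtain U V \<rho> where U: "open U" "open V" "xb \<in> U" "xbs \<in> V" "f xb < ereal \<rho>"
      and *: "\<forall>x xs z zs. (x, xs) \<in> gph_sub_rho f \<rho> \<inter> (U \<times> V) \<and> zs \<in> reg_coderiv_f f x xs z \<longrightarrow> zs \<bullet> z \<ge> s * (norm z)\<^sup>2"
      by (elim exE conjE) (rule that)
    have bound: "zs \<bullet> z \<ge> s * (norm z)\<^sup>2" if "(x, xs) \<in> gph_sub_rho f \<rho> \<inter> (U \<times> V)" "zs \<in> reg_coderiv_f f x xs z" for x xs z zs
      by (rule *[rule_format, OF conjI[OF that]])
    show ?V by (rule prox_param.var_s_convex_of_reg_coderiv_bound[OF pp \<kappa> U], erule (1) bound)
  next
    assume ?PR ?E4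
    from param[OF \<open>?PR\<close>] obtain \<epsilon> r \<mu> \<delta> P where pp: "prox_param f xb xbs \<epsilon> r \<mu> \<delta> P" and \<kappa>: "1 + \<mu> * s > 0" by blast
    from \<open>?E4\<close> obtain U V \<rho> where U: "open U" "open V" "xb \<in> U" "xbs \<in> V" "f xb < ereal \<rho>"
      and *: "\<forall>x xs z zs. (x, xs) \<in> O_f f \<inter> (U \<times> V) \<and> f x < ereal \<rho> \<and> (z, zs) \<in> tangent_f f (x, xs) \<longrightarrow> zs \<bullet> z \<ge> s * (norm z)\<^sup>2"
      by (elim exE conjE) (rule that)
    have bound: "zs \<bullet> z \<ge> s * (norm z)\<^sup>2" if "(x, xs) \<in> O_f f \<inter> (U \<times> V)" "f x < ereal \<rho>" "(z, zs) \<in> tangent_f f (x, xs)" for x xs z zs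
      by (rule *[rule_format, OF conjI[OF that(1) conjI[OF that(2,3)]]])
    show ?V by (rule var_s_convex_of_tangent_bound[OF pp \<kappa> U], erule (2) bound)
  next
    assume ?PR ?E6
    from param[OF \<open>?PR\<close>] obtain \<epsilon> r \<mu> \<delta> P where pp: "prox_param f xb xbs \<epsilon> r \<mu> \<delta> P" and \<kappa>: "1 + \<mu> * s > 0" by blast
    from \<open>?E6\<close> obtain U V \<rho> where U: "open U" "open V" "xb \<in> U" "xbs \<in> V" "f xb < ereal \<rho>"
      and *: "\<forall>x xs P W. (x, xs) \<in> gph_sub_rho f \<rho> \<inter> (U \<times> V) \<and> (P, W) \<in> M_PW f (x, xs) \<longrightarrow> psd (P ** W ** P - s *\<^sub>R P)"
      by (elim exE conjE) (rule that)
    have bound: "psd (P ** W ** P - s *\<^sub>R P)" if "(x, xs) \<in> gph_sub_rho f \<rho> \<inter> (U \<times> V)" "(P, W) \<in> M_PW f (x, xs)" for x xs P W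
      by (rule *[rule_format, OF conjI[OF that]])
    show ?V by (rule var_s_convex_of_psd[OF pp \<kappa> U], erule (1) bound)
  qed
qed

end
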